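(* Let $q$ be an odd prime power. For all $\varepsilon>0$ and all integers $n\geq 1$, the average over hyperelliptic curves of genus $g$ satisfies $$\left\langle -q^{\frac n2}\operatorname{tr}\Theta_C^n\right\rangle_{\mathcal{H}_g}=\eta_n q^{\frac n2}-\eta_n\sum_{\substack{\deg v\,\mid\,\frac n2\\ \deg v\ne1}}\frac{\deg v}{1+q^{\deg v}}+O\left(q^{(\varepsilon-1)(g+1)+n(1+\varepsilon)}\right),$$ where the sum is over all finite places $v$ of $\mathbb{F}_q(X)$.
   Context: $\eta_n=1$ if $n$ is even and $\eta_n=0$ if $n$ is odd. For a smooth projective curve $C$ of genus $g$ over $\mathbb{F}_q$, the zeta function is $Z_C(u)=P_C(u)/((1-u)(1-qu))$ with $P_C(u)=\prod_{j=1}^{2g}(1-\sqrt q\,e^{i\theta_j}u)$. $\Theta_C$ is the conjugacy class of unitary symplectic $2g\times 2g$ matrices with eigenvalues $e^{i\theta_j}$, so $\operatorname{tr}\Theta_C^n=\sum_{j=1}^{2g}e^{in\theta_j}$. $\mathcal{H}_g$ is the moduli space of hyperelliptic curves of genus $g$, with affine models $Y^2=Q(X)$, $Q\in\mathbb{F}_q[X]$ square-free of degree $2g+1$ or $2g+2$. The average $\langle\cdot\rangle_{\mathcal{H}_g}$ is the uniform average over the finite set $E(\mathbb{Z}/2\mathbb{Z},g)$ of quadratic extensions of $\mathbb{F}_q(X)$ of genus $g$, where $C$ is the curve whose function field is the given extension. The implied constant may depend on $q$ and $\varepsilon$, but not on $g$ or $n$. Finite places of $\mathbb{F}_q(X)$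 correspond to monic irreducible polynomials in $\mathbb{F}_q[X]$. *)

theory Defs
  imports
    "HOL-Algebra.Algebraic_Closure_Type"
    "HOL-Computational_Algebra.Computational_Algebra"
    "Jordan_Normal_Form.Schur_Decomposition"
    "Jordan_Normal_Form.Char_Poly"
    "HOL-Library.Cardinality"
begin

text \<open>
  The base field \<open>\<F>\<^sub>q\<close> is a type \<open>'a\<close> of sort \<open>{field, finite}\<close> with \<open>q = CARD('a)\<close>;
  the rational function field \<open>\<F>\<^sub>q(X)\<close> is \<open>'a poly fract\<close>. Extensions of \<open>\<F>\<^sub>q(X)\<close> are taken
  inside its algebraic closure. A quadratic extension is normal (here \<open>q\<close> is odd), so the
  subfields of degree 2 are exactly the isomorphism classes of quadratic extensions.
\<close>

type_synonym 'a ratfun = "'a poly fract"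

definition quadratic_extension :: "('a::{field,finite}) ratfun alg_closure set \<Rightarrow> bool" where
  "quadratic_extension L \<longleftrightarrow>
     range to_ac \<subseteq> L \<and>
     (\<forall>x\<in>L. \<forall>y\<in>L. x - y \<in> L \<and> x * y \<in> L) \<and> (\<forall>x\<in>L. inverse x \<in> L) \<and>
     vector_space.dim (\<lambda>(c::'a ratfun) x. to_ac c * x) L = 2"

text \<open>
  \<open>L\<close> is the function field of the affine curve \<open>Y\<^sup>2 = Q(X)\<close>, where \<open>Q\<close> is square-free of
  degree \<open>2g + 1\<close> or \<open>2g + 2\<close>. For a given \<open>L\<close> the polynomial \<open>Q\<close> is unique up to
  multiplication by a nonzero square of \<open>\<F>\<^sub>q\<close>.
\<close>

definition hyperelliptic_model ::
    "nat \<Rightarrow> ('a::{field,finite}) ratfun alg_closure set \<Rightarrow> 'a poly \<Rightarrow> bool" where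
  "hyperelliptic_model g L Q \<longleftrightarrow>
     squarefree Q \<and> (degree Q = 2 * g + 1 \<or> degree Q = 2 * g + 2) \<and>
     (\<exists>y\<in>L. y\<^sup>2 = to_ac (Fraction_Field.Fract Q 1))"

text \<open>The set \<open>E(\<int>/2\<int>, g)\<close>.\<close>

definition quad_exts :: "nat \<Rightarrow> ('a::{field,finite}) ratfun alg_closure set set" where
  "quad_exts g = {L. quadratic_extension L \<and> (\<exists>Q. hyperelliptic_model g L Q)}"

definition average :: "'b set \<Rightarrow> ('b \<Rightarrow> complex) \<Rightarrow> complex" where
  "average A f = (\<Sum>x\<in>A. f x) / of_nat (card A)"

text \<open>\<open>\<F>\<^bsub>q^n\<^esub>\<close> inside the algebraic closure of \<open>\<F>\<^sub>q\<close> (for \<open>n \<ge> 1\<close>).\<close>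

definition ext_field :: "nat \<Rightarrow> ('a::{field,finite}) alg_closure set" where
  "ext_field n = {x. x ^ (CARD('a) ^ n) = x}"

text \<open>
  Rational points over \<open>\<F>\<^bsub>q^n\<^esub>\<close> of the smooth projective curve with affine model \<open>Y\<^sup>2 = Q(X)\<close>.
  It is glued from this affine curve and the chart \<open>V\<^sup>2 = U\<^bsup>2g+2\<^esup> Q(1/U)\<close>, where
  \<open>U = 1/X\<close> and \<open>V = Y/X\<^bsup>g+1\<^esup>\<close>. The points of the second chart missing from the first are
  those with \<open>U = 0\<close>, i.e. \<open>V\<^sup>2\<close> is the coefficient of \<open>X\<^bsup>2g+2\<^esup>\<close> in \<open>Q\<close> (one ramified point if
  \<open>degree Q = 2g + 1\<close>).
\<close>

definition affine_points ::
    "('a::{field,finite}) poly \<Rightarrow> nat \<Rightarrow> ('a alg_closure \<times> 'a alg_closure) set" where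
  "affine_points Q n =
     {(x, y). x \<in> ext_field n \<and> y \<in> ext_field n \<and> y\<^sup>2 = poly (map_poly to_ac Q) x}"

definition infinite_points :: "nat \<Rightarrow> ('a::{field,finite}) poly \<Rightarrow> nat \<Rightarrow> 'a alg_closure set" where
  "infinite_points g Q n = {v \<in> ext_field n. v\<^sup>2 = to_ac (coeff Q (2 * g + 2))}"

definition num_points :: "nat \<Rightarrow> ('a::{field,finite}) poly \<Rightarrow> nat \<Rightarrow> nat" where
  "num_points g Q n = card (affine_points Q n) + card (infinite_points g Q n)"

text \<open>\<open>Z\<^sub>C(u) = exp (\<Sum>n\<ge>1. #C(\<F>\<^bsub>q^n\<^esub>) u\<^sup>n / n)\<close>; the coefficient below vanishes for \<open>n = 0\<close>.\<close>

definition zeta_fps :: "nat \<Rightarrow> ('a::{field,finite}) poly \<Rightarrow> complex fps" where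
  "zeta_fps g Q =
     fps_compose (fps_exp 1) (Abs_fps (\<lambda>n. of_nat (num_points g Q n) / of_nat n))"

text \<open>\<open>P\<^sub>C(u) = (1 - u) (1 - q u) Z\<^sub>C(u)\<close> for the curve \<open>C\<close> with function field \<open>L\<close>.\<close>

definition P_fps :: "nat \<Rightarrow> ('a::{field,finite}) ratfun alg_closure set \<Rightarrow> complex fps" where
  "P_fps g L =
     (1 - fps_X) * (1 - fps_const (of_nat CARD('a)) * fps_X) *
     zeta_fps g (SOME Q. hyperelliptic_model g L Q)"

text \<open>
  \<open>e\<^sub>0, \<dots>, e\<^bsub>2g-1\<^esub>\<close> satisfy \<open>P\<^sub>C(u) = \<Prod>j. (1 - \<surd>q e\<^sub>j u)\<close>. By the Riemann hypothesis for
  curves (Weil) the \<open>e\<^sub>j\<close> are the \<open>exp (\<i> \<theta>\<^sub>j)\<close>, but this is not needed to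
  define them or their power sums, which for exponent \<open>n \<ge> 1\<close> do not depend on their order.
\<close>

definition frob_eigenvalues ::
    "nat \<Rightarrow> ('a::{field,finite}) ratfun alg_closure set \<Rightarrow> (nat \<Rightarrow> complex) \<Rightarrow> bool" where
  "frob_eigenvalues g L e \<longleftrightarrow>
     P_fps g L =
       (\<Prod>j<2*g. 1 - fps_const (complex_of_real (sqrt (real CARD('a))) * e j) * fps_X)"

text \<open>
  \<open>tr \<Theta>\<^sub>C\<^sup>n\<close>, as the sum of the \<open>n\<close>-th powers of the eigenvalues; see
  \<open>trace_Theta_eq\<close> below for the comparison with the matrix \<open>\<Theta>\<^sub>C\<close>.
\<close>

definition tr_Theta :: "nat \<Rightarrow> ('a::{field,finite}) ratfun alg_closure set \<Rightarrow> nat \<Rightarrow> complex" where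
  "tr_Theta g L n = (\<Sum>j<2*g. (SOME e. frob_eigenvalues g L e) j ^ n)"

definition eta :: "nat \<Rightarrow> real" where
  "eta n = (if even n then 1 else 0)"

text \<open>Finite places of \<open>\<F>\<^sub>q(X)\<close>.\<close>

definition finite_places :: "('a::{field,finite}) poly set" where
  "finite_places = {v. irreducible v \<and> lead_coeff v = 1}"

subsection \<open>The unitary symplectic class\<close>

text \<open>
  The following is not used in the definitions above; it shows that \<^term>\<open>tr_Theta\<close> is
  \<open>tr \<Theta>\<^sup>n\<close> for every \<open>\<Theta>\<close> in the conjugacy class \<open>\<Theta>\<^sub>C\<close> of unitary symplectic matrices.
\<close>

definition unitary_symplectic :: "nat \<Rightarrow> complex mat set" where
  "unitary_symplectic g =
     (let J = four_block_mat (0\<^sub>m g g) (1\<^sub>m g) (- 1\<^sub>m g) (0\<^sub>m g g) in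
      {A \<in> carrier_mat (2 * g) (2 * g).
         mat_adjoint A * A = 1\<^sub>m (2 * g) \<and> A\<^sup>T * J * A = J})"

definition Theta_class ::
    "nat \<Rightarrow> ('a::{field,finite}) ratfun alg_closure set \<Rightarrow> complex mat set" where
  "Theta_class g L =
     {A \<in> unitary_symplectic g. \<exists>\<theta> :: nat \<Rightarrow> real.
        frob_eigenvalues g L (\<lambda>j. cis (\<theta> j)) \<and>
        char_poly A = (\<Prod>j<2*g. [:- cis (\<theta> j), 1:])}"

definition mat_trace :: "'b::comm_monoid_add mat \<Rightarrow> 'b" where
  "mat_trace A = (\<Sum>i<dim_row A. A $$ (i, i))"

lemma power_sums_unique:
  fixes c d :: "nat \<Rightarrow> complex"
  assumes eq: "(\<Prod>j<m. 1 - fps_const (c j) * fps_X) = (\<Prod>j<m. 1 - fps_const (d j) * fps_X)"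
    and n: "n \<ge> 1"
  shows "(\<Sum>j<m. c j ^ n) = (\<Sum>j<m. d j ^ n)"
proof -
  define F where "F c = (\<Prod>j<m. 1 - fps_const (c j) * fps_X)" for c :: "nat \<Rightarrow> complex"
  define G where "G c = (\<Sum>j<m. fps_const (c j) * Abs_fps (\<lambda>k. c j ^ k))" for c :: "nat \<Rightarrow> complex"
  have geo: "(1 - fps_const a * fps_X) * Abs_fps (\<lambda>k. a ^ k) = 1" for a :: complex
  proof (rule fps_ext)
    fix k show "fps_nth ((1 - fps_const a * fps_X) * Abs_fps (\<lambda>k. a ^ k)) k = fps_nth 1 k"
      by (cases k) (simp_all add: algebra_simps)
  qed
  have deriv: "fps_deriv (F c) = - F c * G c" for c
  proof -
    have "fps_deriv (\<Prod>j<k. 1 - fps_const (c j) * fps_X) =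
        - (\<Prod>j<k. 1 - fps_const (c j) * fps_X) * (\<Sum>j<k. fps_const (c j) * Abs_fps (\<lambda>i. c j ^ i))" for k
    proof (induction k)
      case (Suc k)
      define P where "P = (\<Prod>j<k. 1 - fps_const (c j) * fps_X)"
      define S where "S = (\<Sum>j<k. fps_const (c j) * Abs_fps (\<lambda>i. c j ^ i))"
      define t where "t = 1 - fps_const (c k) * fps_X"
      define w where "w = Abs_fps (\<lambda>i. c k ^ i)"
      have tw: "t * w = 1" unfolding t_def w_def by (rule geo)
      have IH: "fps_deriv P = - P * S" using Suc.IH unfolding P_def S_def .
      have dt: "fps_deriv t = - fps_const (c k)" by (simp add: t_def)
      have "fps_deriv (P * t) = fps_deriv P * t + P * fps_deriv t" by simp
      also have "\<dots> = - P * S * t - P * fps_const (c k) * (t * w)"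
        unfolding IH dt tw by (simp only: mult_1_right mult_minus_right diff_conv_add_uminus mult_minus_left)
      also have "\<dots> = - (P * t) * (S + fps_const (c k) * w)"
        by (simp add: algebra_simps del: fps_const_neg)
      finally show ?case by (simp add: P_def S_def t_def w_def)
    qed simp
    thus ?thesis unfolding F_def G_def .
  qed
  have nz: "F c \<noteq> 0"
  proof
    assume "F c = 0"
    moreover have "fps_nth (F c) 0 = 1" by (simp add: F_def fps_prod_nth')
    ultimately show False by simp
  qed
  have "F c * G c = F c * G d"
    using deriv[of c] deriv[of d] eq unfolding F_def by simp
  with nz have "G c = G d" by simp
  hence "fps_nth (G c) (n - 1) = fps_nth (G d) (n - 1)" by simp
  moreover have "fps_nth (G c) (n - 1) = (\<Sum>j<m. c j ^ n)" for c
    using n by (auto simp: G_def fps_sum_nth simp flip: power_Suc)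
  ultimately show ?thesis by simp
qed

lemma tr_Theta_eq:
  assumes e: "frob_eigenvalues g L e" and n: "n \<ge> 1"
  shows "tr_Theta g (L :: ('a::{field,finite}) ratfun alg_closure set) n = (\<Sum>j<2*g. e j ^ n)"
proof -
  define s where "s = complex_of_real (sqrt (real CARD('a)))"
  define e' where "e' = (SOME e. frob_eigenvalues g L e)"
  have s: "s \<noteq> 0" by (simp add: s_def)
  have e': "frob_eigenvalues g L e'"
    unfolding e'_def using e by (rule someI[of "frob_eigenvalues g L"])
  have "(\<Sum>j<2*g. (s * e' j) ^ n) = (\<Sum>j<2*g. (s * e j) ^ n)"
    by (rule power_sums_unique[OF _ n])
       (use e e' in \<open>simp add: frob_eigenvalues_def s_def\<close>)
  hence "s ^ n * (\<Sum>j<2*g. e' j ^ n) = s ^ n * (\<Sum>j<2*g. e j ^ n)"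
    by (simp add: power_mult_distrib sum_distrib_left)
  thus ?thesis using s by (simp add: tr_Theta_def e'_def)
qed

lemma mat_trace_comm:
  fixes A B :: "complex mat"
  assumes "A \<in> carrier_mat m m" "B \<in> carrier_mat m m"
  shows "mat_trace (A * B) = mat_trace (B * A)"
proof -
  have "mat_trace (A * B) = (\<Sum>i<m. \<Sum>j<m. A $$ (i, j) * B $$ (j, i))"
    using assms by (auto simp: mat_trace_def scalar_prod_def lessThan_atLeast0 intro!: sum.cong)
  also have "\<dots> = (\<Sum>j<m. \<Sum>i<m. B $$ (j, i) * A $$ (i, j))"
    by (subst sum.swap) (simp add: mult.commute)
  also have "\<dots> = mat_trace (B * A)"
    using assms by (auto simp: mat_trace_def scalar_prod_def lessThan_atLeast0 intro!: sum.cong)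
  finally show ?thesis .
qed

lemma upper_triangular_pow:
  fixes B :: "complex mat"
  assumes B: "B \<in> carrier_mat m m" "upper_triangular B"
  shows "(\<forall>i<m. \<forall>j<i. (B ^\<^sub>m n) $$ (i, j) = 0) \<and> (\<forall>i<m. (B ^\<^sub>m n) $$ (i, i) = B $$ (i, i) ^ n)"
proof (induction n)
  case 0
  show ?case using B by auto
next
  case (Suc n)
  have C: "B ^\<^sub>m n \<in> carrier_mat m m" using B by (simp add: pow_carrier_mat)
  have entry: "(B ^\<^sub>m Suc n) $$ (i, j) = (\<Sum>k<m. (B ^\<^sub>m n) $$ (i, k) * B $$ (k, j))"
    if "i < m" "j < m" for i j
    using B C that by (auto simp: scalar_prod_def lessThan_atLeast0 intro!: sum.cong)
  have up: "B $$ (k, j) = 0" if "j < k" "k < m" for j k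
    using B that by (auto simp: upper_triangular_def)
  show ?case
  proof (intro conjI allI impI)
    fix i j assume ij: "i < m" "j < i"
    have "(B ^\<^sub>m n) $$ (i, k) * B $$ (k, j) = 0" if "k < m" for k
      using Suc.IH up ij that by (cases "k < i") auto
    thus "(B ^\<^sub>m Suc n) $$ (i, j) = 0"
      using ij by (subst entry) (auto intro!: sum.neutral simp del: mult_eq_0_iff)
  next
    fix i assume i: "i < m"
    have "(B ^\<^sub>m n) $$ (i, k) * B $$ (k, i) = (if k = i then B $$ (i, i) ^ Suc n else 0)"
      if "k < m" for k
      using Suc.IH up i that by (cases k i rule: linorder_cases) auto
    thus "(B ^\<^sub>m Suc n) $$ (i, i) = B $$ (i, i) ^ Suc n"
      using i by (subst entry) auto
  qed
qed

lemma mat_trace_pow: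
  fixes A :: "complex mat"
  assumes A: "A \<in> carrier_mat m m" and cp: "char_poly A = (\<Prod>j<m. [:- e j, 1:])"
  shows "mat_trace (A ^\<^sub>m n) = (\<Sum>j<m. e j ^ n)"
proof -
  define es where "es = map e [0..<m]"
  have cp': "char_poly A = (\<Prod>a\<leftarrow>es. [:- a, 1:])"
    unfolding cp es_def
    by (simp add: prod.distinct_set_conv_list[symmetric] comp_def lessThan_atLeast0)
  obtain B P Q where schur: "schur_decomposition A es = (B, P, Q)"
    by (cases "schur_decomposition A es") auto
  from schur_decomposition[OF A cp' schur]
  have sim: "similar_mat_wit A B P Q" and ut: "upper_triangular B" and dg: "diag_mat B = es"
    by auto
  note w = similar_mat_witD2[OF A sim]
  have Bn: "B ^\<^sub>m n \<in> carrier_mat m m" using w by (simp add: pow_carrier_mat)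
  have "similar_mat_wit (A ^\<^sub>m n) (B ^\<^sub>m n) P Q"
    using sim by (rule similar_mat_wit_pow)
  hence An: "A ^\<^sub>m n = P * (B ^\<^sub>m n) * Q"
    by (auto simp: similar_mat_wit_def Let_def)
  have "mat_trace (A ^\<^sub>m n) = mat_trace (P * ((B ^\<^sub>m n) * Q))"
    unfolding An using w Bn by (subst assoc_mult_mat[of P m m "B ^\<^sub>m n" m Q m]) auto
  also have "\<dots> = mat_trace (((B ^\<^sub>m n) * Q) * P)"
    using w Bn by (intro mat_trace_comm[of _ m]) auto
  also have "((B ^\<^sub>m n) * Q) * P = (B ^\<^sub>m n) * (Q * P)"
    using w Bn by (intro assoc_mult_mat[of _ m m _ m _ m]) auto
  also have "\<dots> = B ^\<^sub>m n" using w Bn by simp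
  also have "mat_trace (B ^\<^sub>m n) = (\<Sum>i<m. B $$ (i, i) ^ n)"
    using upper_triangular_pow[OF w(5) ut, of n] w(5) by (simp add: mat_trace_def)
  also have "\<dots> = (\<Sum>j<m. e j ^ n)"
  proof (rule sum.cong)
    fix i assume "i \<in> {..<m}"
    moreover have "diag_mat B ! i = es ! i" using dg by simp
    ultimately show "B $$ (i, i) ^ n = e i ^ n"
      using w(5) by (simp add: diag_mat_def es_def)
  qed simp
  finally show ?thesis .
qed

lemma trace_Theta_eq:
  fixes L :: "('a::{field,finite}) ratfun alg_closure set"
  assumes "A \<in> Theta_class g L" and "n \<ge> 1"
  shows "tr_Theta g L n = mat_trace (A ^\<^sub>m n)"
proof -
  from assms(1) obtain \<theta> :: "nat \<Rightarrow> real" where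
    A: "A \<in> carrier_mat (2 * g) (2 * g)" and e: "frob_eigenvalues g L (\<lambda>j. cis (\<theta> j))" and
    cp: "char_poly A = (\<Prod>j<2*g. [:- cis (\<theta> j), 1:])"
    by (auto simp: Theta_class_def unitary_symplectic_def Let_def)
  show ?thesis
    using tr_Theta_eq[OF e assms(2)] mat_trace_pow[OF A cp, of n] by simp
qed

end

theory Submission
  imports Defs
begin

text \<open>
  Write \<open>(f|Q)\<close> for the quadratic character of the resultant of \<open>f\<close> and \<open>Q\<close>. It is completely
  multiplicative in both arguments, symmetric up to a sign depending on the degrees, and periodic
  in \<open>Q\<close> modulo \<open>f\<close>; hence \<open>\<Sum>\<^sub>f (f|D) = 0\<close> over monic \<open>f\<close> of degree \<open>n \<ge> deg D\<close> unless \<open>D\<close> is a square.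
  This makes \<open>L(u) = \<Sum>\<^sub>f (f|Q) u\<^bsup>deg f\<^esup>\<close> a polynomial, so that the Frobenius eigenvalues exist and
  \<open>-q\<^bsup>n/2\<^esup> tr \<Theta>\<^sup>n\<close> is the sum over the places \<open>v\<close> with \<open>deg v\<close> dividing \<open>n\<close> (including infinity) of
  \<open>deg v (v|Q)\<^bsup>n / deg v\<^esup>\<close>.

  Averaging over \<open>Q\<close>, everything cancels for odd \<open>n\<close>. For even \<open>n\<close> the places with \<open>n / deg v\<close> even
  only ask for the density of square-free \<open>Q\<close> prime to \<open>v\<close>, which gives the main terms. For the
  other places \<open>d = deg v\<close> is even, and a sieve reduces to the sums \<open>a\<^sub>m(v)\<close> of \<open>(v|f)\<close> over monic \<open>f\<close> of
  degree \<open>m < d\<close>. No Riemann hypothesis is needed to bound them on average over \<open>v\<close>: if \<open>2 m \<le> d\<close>,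
  enlarge the mean square over \<open>v\<close> to all monic polynomials of degree \<open>d\<close>, where the orthogonality
  relation leaves only the pairs \<open>(f, f')\<close> with \<open>f f'\<close> a square; if \<open>2 m > d\<close>, the functional
  equation reduces to the first case.
\<close>

subsection \<open>Polynomials over a finite field\<close>

text \<open>The exponent \<open>(\<epsilon> - 1) * (g + 1) + n * (1 + \<epsilon>)\<close> is
  square-root cancellation on average over places. For the places of one even degree
  \<open>d \<le> n\<close>, the square-free sums in degree \<open>m \<le> 2g + 2\<close> add up in
  absolute value to at most \<open>q^d * q^((m + 1)/2)\<close> times a polynomial in
  \<open>d\<close> and \<open>m\<close>. Division by about \<open>q^(2g + 2)\<close> polynomials
  leaves a multiple of \<open>q^n / q^(g + 1)\<close>, and \<epsilon> absorbs the polynomial factor.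
  The restriction \<open>deg v \<noteq> 1\<close> comes from infinity: the places of degree 1
  contribute \<open>- q / (1 + q)\<close>, and for \<open>g \<ge> 1\<close> the place at infinity
  contributes exactly \<open>q / (1 + q)\<close>, the share of degree \<open>2g + 2\<close> among
  the \<open>Q\<close>. As \<open>tr_Theta\<close> is read from a \<open>SOME\<close>, it has a
  meaning only once a tuple of eigenvalues exists. Hence \<open>P_C\<close> has to be shown to be a
  polynomial of degree at most \<open>2g\<close>, for both parities of the degree of
  \<open>Q\<close>; for even degree this needs an extra zero of \<open>L\<close>, which belongs to
  infinity.\<close>

definition polys_lt :: "nat \<Rightarrow> 'a::zero poly set" where
  "polys_lt n = {f. f = 0 \<or> degree f < n}"

definition monics :: "nat \<Rightarrow> 'a::{zero,one} poly set" where
  "monics n = {f. lead_coeff f = 1 \<and> degree f = n}"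

text \<open>Because of the disjunct \<open>f = 0\<close>, each \<open>polys_lt n\<close> is a vector
  space of dimension \<open>n\<close> over the base field, also for \<open>n = 0\<close>, although
  the degree of 0 is 0.\<close>

lemma polys_lt_0 [simp]: "polys_lt 0 = {0}"
  by (auto simp: polys_lt_def)

lemma polys_lt_Suc: "polys_lt (Suc n) = (\<lambda>(c, p). pCons c p) ` (UNIV \<times> polys_lt n)"
proof (intro equalityI subsetI)
  fix f :: "'a poly" assume "f \<in> polys_lt (Suc n)"
  thus "f \<in> (\<lambda>(c, p). pCons c p) ` (UNIV \<times> polys_lt n)"
    by (cases f) (force simp: polys_lt_def image_iff split: if_splits)
qed (auto simp: polys_lt_def split: if_splits)

lemma finite_card_polys_lt:
  "finite (polys_lt n :: 'a::{field,finite} poly set) \<and> card (polys_lt n :: 'a poly set) = CARD('a) ^ n"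
proof (induction n)
  case (Suc n)
  have "inj_on (\<lambda>(c, p). pCons c p) (UNIV \<times> (polys_lt n :: 'a poly set))"
    by (auto simp: inj_on_def)
  thus ?case using Suc by (simp add: polys_lt_Suc card_image card_cartesian_product)
qed simp

lemmas finite_polys_lt [simp] = finite_card_polys_lt[THEN conjunct1]
lemmas card_polys_lt = finite_card_polys_lt[THEN conjunct2]

lemma mem_polys_lt_degree: "n > 0 \<Longrightarrow> f \<in> polys_lt n \<longleftrightarrow> degree f < n"
  by (auto simp: polys_lt_def)

lemma polys_lt_mono: "m \<le> n \<Longrightarrow> polys_lt m \<subseteq> polys_lt n"
  by (auto simp: polys_lt_def)

lemma zero_in_polys_lt [simp]: "0 \<in> polys_lt n"
  by (simp add: polys_lt_def)

lemma polys_lt_coeff: "f \<in> polys_lt n \<longleftrightarrow> (\<forall>i\<ge>n. coeff f i = 0)"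
proof
  assume *: "\<forall>i\<ge>n. coeff f i = 0"
  show "f \<in> polys_lt n"
  proof (rule ccontr)
    assume "f \<notin> polys_lt n"
    hence "f \<noteq> 0" "degree f \<ge> n" by (auto simp: polys_lt_def)
    with * have "lead_coeff f = 0" by blast
    with \<open>f \<noteq> 0\<close> show False by simp
  qed
qed (auto simp: polys_lt_def coeff_eq_0)

lemma polys_lt_add: "f \<in> polys_lt n \<Longrightarrow> g \<in> polys_lt n \<Longrightarrow> f + g \<in> polys_lt n"
  and polys_lt_diff: "f' \<in> polys_lt n \<Longrightarrow> g' \<in> polys_lt n \<Longrightarrow> f' - g' \<in> polys_lt n"
  and polys_lt_smult: "h \<in> polys_lt n \<Longrightarrow> smult c h \<in> polys_lt n"
  for f g f' g' h :: "'a::field poly"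
  by (auto simp: polys_lt_coeff)

lemma monics_nonzero: "f \<in> monics n \<Longrightarrow> (f :: 'a::field poly) \<noteq> 0"
  by (auto simp: monics_def)

lemma monics_mult: "f \<in> monics m \<Longrightarrow> g \<in> monics n \<Longrightarrow> f * g \<in> monics (m + n)" for f g :: "'a::field poly"
  using monics_nonzero[of f] monics_nonzero[of g]
  by (auto simp: monics_def lead_coeff_mult degree_mult_eq)

lemma monics_cancel: "f * g \<in> monics n \<Longrightarrow> f \<in> monics m \<Longrightarrow> m \<le> n \<and> g \<in> monics (n - m)"
  for f g :: "'a::field poly"
  by (cases "g = 0"; cases "f = 0") (auto simp: monics_def degree_mult_eq coeff_mult_degree_sum)

lemma monics_eq_image: "monics n = (\<lambda>r. monom 1 n + r) ` (polys_lt n :: 'a::field poly set)"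
proof (intro equalityI subsetI)
  fix f :: "'a poly" assume f: "f \<in> monics n"
  have "f - monom 1 n \<in> polys_lt n"
    using f by (auto simp: polys_lt_coeff monics_def coeff_eq_0 le_less)
  thus "f \<in> (\<lambda>r. monom 1 n + r) ` polys_lt n"
    by (intro image_eqI[of _ _ "f - monom 1 n"]) auto
next
  fix f :: "'a poly" assume "f \<in> (\<lambda>r. monom 1 n + r) ` polys_lt n"
  then obtain r where r: "r \<in> polys_lt n" "f = monom 1 n + r" by auto
  have "degree f \<le> n"
    using r by (intro degree_le) (auto simp: polys_lt_coeff)
  moreover have "coeff f n = 1" using r by (auto simp: polys_lt_coeff)
  ultimately have "degree f = n" by (metis le_degree one_neq_zero order_antisym)
  thus "f \<in> monics n" using \<open>coeff f n = 1\<close> by (simp add: monics_def)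
qed

lemma monics_add: "f \<in> monics n \<Longrightarrow> r \<in> polys_lt n \<Longrightarrow> f + r \<in> monics n" for f r :: "'a::field poly"
  by (auto simp: monics_eq_image add.assoc intro: polys_lt_add)

lemma monics_diff: "f \<in> monics n \<Longrightarrow> r \<in> polys_lt n \<Longrightarrow> f - r \<in> monics n" for f r :: "'a::field poly"
  using monics_add[of f n "- r"] polys_lt_diff[of 0 n r] by simp

lemma finite_monics [simp]: "finite (monics n :: 'a::{field,finite} poly set)"
  by (simp add: monics_eq_image)

lemma card_monics: "card (monics n :: 'a::{field,finite} poly set) = CARD('a) ^ n"
  by (simp add: monics_eq_image card_image inj_on_def card_polys_lt)

lemma monics_0 [simp]: "monics 0 = {1 :: 'a::field poly}"
proof -
  have "f = 1" if "f \<in> monics 0" for f :: "'a poly"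
    using that by (auto simp: monics_def elim!: degree_eq_zeroE)
  thus ?thesis by (auto simp: monics_def)
qed

lemma dvd_monics_degree_le: "f \<in> monics n \<Longrightarrow> g \<in> monics m \<Longrightarrow> g dvd f \<Longrightarrow> m \<le> n"
  for f g :: "'a::field poly"
  using dvd_imp_degree_le[of g f] monics_nonzero[of f n] by (auto simp: monics_def)

lemma bij_betw_mult_monics:
  fixes g :: "'a::field poly"
  assumes g: "g \<in> monics m" and mn: "m \<le> n"
  shows "bij_betw ((*) g) (monics (n - m)) {f \<in> monics n. g dvd f}"
  unfolding bij_betw_def
proof (intro conjI equalityI subsetI inj_onI)
  fix x y assume "g * x = g * y"
  thus "x = y" using monics_nonzero[OF g] by simp
next
  fix f assume "f \<in> (*) g ` monics (n - m)"
  thus "f \<in> {f \<in> monics n. g dvd f}" using monics_mult[OF g, of _ "n - m"] mn by auto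
next
  fix f assume "f \<in> {f \<in> monics n. g dvd f}"
  thus "f \<in> (*) g ` monics (n - m)" using monics_cancel[OF _ g, of _ n] by (auto elim!: dvdE)
qed

text \<open>Division with remainder: the monic polynomials of degree \<open>n\<close> meet every
  residue class modulo \<open>D\<close> equally often, which turns sums over \<open>monics n\<close>
  into sums over residues.\<close>

lemma bij_betw_divmod:
  fixes D :: "'a::field poly"
  assumes D: "D \<in> monics e" and n: "e \<le> n"
  shows "bij_betw (\<lambda>(k, r). D * k + r) (monics (n - e) \<times> polys_lt e) (monics n)"
proof (rule bij_betw_byWitness[where f' = "\<lambda>f. (f div D, f mod D)"])
  have D0: "D \<noteq> 0" and dD: "degree D = e" using D by (auto simp: monics_def)
  have md: "r mod D = r" "r div D = 0" if "r \<in> polys_lt e" for r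
    using that dD by (auto simp: polys_lt_def mod_poly_less div_poly_less)
  show "\<forall>a\<in>monics (n - e) \<times> polys_lt e.
       (\<lambda>f. (f div D, f mod D)) (case a of (k, r) \<Rightarrow> D * k + r) = a"
    using D0 md by (auto simp: div_plus_div_distrib_dvd_left)
  show "\<forall>a'\<in>monics n. (case (a' div D, a' mod D) of (k, r) \<Rightarrow> D * k + r) = a'"
    by simp
  show "(\<lambda>(k, r). D * k + r) ` (monics (n - e) \<times> polys_lt e) \<subseteq> monics n"
  proof safe
    fix k r :: "'a poly" assume k: "k \<in> monics (n - e)" and r: "r \<in> polys_lt e"
    have "D * k \<in> monics n" using monics_mult[OF D k] n by simp
    thus "D * k + r \<in> monics n" using monics_add r polys_lt_mono[OF n] by blast
  qed
  show "(\<lambda>f. (f div D, f mod D)) ` monics n \<subseteq> monics (n - e) \<times> polys_lt e"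
  proof safe
    fix f :: "'a poly" assume f: "f \<in> monics n"
    show r: "f mod D \<in> polys_lt e"
      using degree_mod_less[OF D0, of f] dD by (auto simp: polys_lt_def)
    have "D * (f div D) = f - f mod D" by (simp add: minus_mod_eq_mult_div)
    moreover have "f - f mod D \<in> monics n"
      using monics_diff[OF f] r polys_lt_mono[OF n] by blast
    ultimately show "f div D \<in> monics (n - e)" using monics_cancel[OF _ D] by metis
  qed
qed

section \<open>Places and factorisation\<close>

lemma irreducible_degree_pos: "irreducible (v :: 'a::field poly) \<Longrightarrow> degree v > 0"
  by (metis irreducible_def is_unit_iff_degree neq0_conv)

lemma place_degree_pos: "v \<in> finite_places \<Longrightarrow> degree v > 0"
  and place_prime: "v \<in> finite_places \<Longrightarrow> prime_elem v"
  and place_monic: "v \<in> finite_places \<Longrightarrow> v \<in> monics (degree v)"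
  and place_nonzero: "v \<in> finite_places \<Longrightarrow> v \<noteq> 0"
  by (auto simp: finite_places_def monics_def field_poly_irreducible_imp_prime irreducible_degree_pos)

lemma monic_dvd_antisym: "monic f \<Longrightarrow> monic g \<Longrightarrow> f dvd g \<Longrightarrow> g dvd f \<Longrightarrow> f = g"
  for f g :: "'a::field poly"
  by (rule poly_dvd_antisym) auto

lemma exists_place_dvd:
  fixes f :: "'a::{field,finite} poly"
  assumes "degree f > 0"
  shows "\<exists>v\<in>finite_places. v dvd f"
  using assms
proof (induction "degree f" arbitrary: f rule: less_induct)
  case less
  show ?case
  proof (cases "irreducible f")
    case True
    define v where "v = smult (inverse (lead_coeff f)) f"
    have f0: "f \<noteq> 0" using less.prems by auto
    have "f = v * [:lead_coeff f:]" using f0 by (simp add: v_def)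
    moreover have "is_unit [:lead_coeff f:]" using f0 by (simp add: is_unit_const_poly_iff)
    ultimately have "irreducible v" using True
      by (metis irreducible_mult_unit_right)
    moreover have "lead_coeff v = 1" using f0 by (simp add: v_def)
    moreover have "v dvd f" using \<open>f = v * _\<close> by (metis dvd_triv_left)
    ultimately show ?thesis by (auto simp: finite_places_def)
  next
    case False
    have f0: "f \<noteq> 0" "\<not> is_unit f" using less.prems by (auto simp: is_unit_iff_degree)
    with False obtain a b where ab: "f = a * b" "\<not> is_unit a" "\<not> is_unit b"
      by (auto simp: irreducible_def)
    have "a \<noteq> 0" "b \<noteq> 0" using ab f0 by auto
    hence "degree a > 0" "degree a < degree f"
      using ab by (auto simp: is_unit_iff_degree degree_mult_eq)
    from less.hyps[OF this(2,1)] show ?thesis by (auto simp: ab(1) intro: dvd_mult2)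
  qed
qed

lemma place_dvd_place: "u \<in> finite_places \<Longrightarrow> v \<in> finite_places \<Longrightarrow> u dvd v \<Longrightarrow> u = v"
  for u v :: "'a::{field,finite} poly"
proof -
  assume uv: "u \<in> finite_places" "v \<in> finite_places" "u dvd v"
  then obtain k where k: "v = u * k" by (elim dvdE)
  have "\<not> is_unit u" using place_degree_pos[OF uv(1)] place_nonzero[OF uv(1)]
    by (auto simp: is_unit_iff_degree)
  moreover have "irreducible v" using uv by (simp add: finite_places_def)
  ultimately have "is_unit k" using k by (metis irreducibleD)
  hence "v dvd u" using k by simp
  thus "u = v" using uv by (intro monic_dvd_antisym) (auto simp: finite_places_def)
qed

lemma place_decompose:
  fixes f :: "'a::{field,finite} poly"
  assumes v: "v \<in> finite_places" and f: "f \<noteq> 0"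
  obtains k g where "f = v ^ k * g" "\<not> v dvd g" "\<And>j. v ^ j dvd f \<longleftrightarrow> j \<le> k"
proof -
  have v0: "v \<noteq> 0" using place_nonzero[OF v] .
  have "\<exists>k g. f = v ^ k * g \<and> \<not> v dvd g" using f
  proof (induction "degree f" arbitrary: f rule: less_induct)
    case less
    show ?case
    proof (cases "v dvd f")
      case True
      then obtain g where g: "f = v * g" by (elim dvdE)
      hence "g \<noteq> 0" using less.prems by auto
      moreover from this have "degree g < degree f"
        using v0 place_degree_pos[OF v] by (simp add: g degree_mult_eq)
      ultimately obtain k h where "g = v ^ k * h" "\<not> v dvd h" using less.hyps by blast
      thus ?thesis by (intro exI[of _ "Suc k"] exI[of _ h]) (simp add: g)
    next
      case False
      thus ?thesis by (intro exI[of _ 0] exI[of _ f]) simp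
    qed
  qed
  then obtain k g where g: "f = v ^ k * g" "\<not> v dvd g" by blast
  have "v ^ j dvd f \<longleftrightarrow> j \<le> k" for j
  proof
    assume dv: "v ^ j dvd f"
    show "j \<le> k"
    proof (rule ccontr)
      assume "\<not> j \<le> k"
      hence "v ^ Suc k dvd f" using dv by (meson dvd_trans le_imp_power_dvd not_less_eq_eq)
      hence "v ^ k * v dvd v ^ k * g" by (simp add: g mult.commute)
      with v0 g(2) show False by simp
    qed
  qed (auto simp: g le_imp_power_dvd)
  with g that show ?thesis by blast
qed

lemma place_dvd_mult: "v \<in> finite_places \<Longrightarrow> v dvd f * g \<longleftrightarrow> v dvd f \<or> v dvd g"
  using prime_elem_dvd_mult_iff[OF place_prime] .

lemma place_dvd_power: "v \<in> finite_places \<Longrightarrow> v dvd f ^ n \<Longrightarrow> v dvd f"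
  using prime_elem_dvd_power[OF place_prime] .

text \<open>The second assumption says that \<open>h\<close> is a unit modulo \<open>D\<close>, in
  the form of a cancellation rule; multiplication by \<open>h\<close> is then an injective self-map
  of a finite set of representatives.\<close>

lemma bij_betw_mult_mod:
  fixes D h :: "'a::{field,finite} poly"
  assumes D: "D \<noteq> 0" and h: "\<And>x. D dvd h * x \<Longrightarrow> D dvd x"
  shows "bij_betw (\<lambda>f. (h * f) mod D) (polys_lt (degree D)) (polys_lt (degree D))"
proof -
  have "inj_on (\<lambda>f. (h * f) mod D) (polys_lt (degree D))"
  proof (rule inj_onI)
    fix f g assume fg: "f \<in> polys_lt (degree D)" "g \<in> polys_lt (degree D)" "(h * f) mod D = (h * g) mod D"
    hence "D dvd h * (f - g)" by (simp add: right_diff_distrib mod_eq_dvd_iff)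
    hence "D dvd f - g" by (rule h)
    moreover have "f - g \<in> polys_lt (degree D)" using fg by (intro polys_lt_diff)
    ultimately show "f = g" using dvd_imp_degree_le[of D "f - g"]
      by (cases "f = g") (auto simp: polys_lt_def)
  qed
  moreover have "(\<lambda>f. (h * f) mod D) ` polys_lt (degree D) \<subseteq> polys_lt (degree D)"
    using degree_mod_less[OF D] by (auto simp: polys_lt_def)
  ultimately show ?thesis by (simp add: bij_betw_def endo_inj_surj)
qed

lemma bij_betw_mult_mod_place:
  fixes v E :: "'a::{field,finite} poly"
  assumes v: "v \<in> finite_places" and E: "\<not> v dvd E"
  shows "bij_betw (\<lambda>f. (E * f) mod v) (polys_lt (degree v)) (polys_lt (degree v))"
  by (rule bij_betw_mult_mod[OF place_nonzero[OF v]]) (use place_dvd_mult[OF v] E in blast)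

lemma place_inverse_mod:
  fixes v E :: "'a::{field,finite} poly"
  assumes v: "v \<in> finite_places" and E: "\<not> v dvd E"
  obtains b where "(E * b) mod v = 1"
proof -
  have "1 \<in> polys_lt (degree v)" using place_degree_pos[OF v] by (auto simp: polys_lt_def)
  thus ?thesis using bij_betw_mult_mod_place[OF v E] that
    by (metis (no_types, lifting) bij_betw_def imageE)
qed

text \<open>A place of multiplicity \<open>k\<close> in \<open>f\<close> gives the \<open>k\<close>
  pairs with \<open>j = 1, ..., k\<close>; the weight \<open>degree v\<close> on each pair plays the
  part of the von Mangoldt function.\<close>

definition place_powers :: "'a::{field,finite} poly \<Rightarrow> ('a poly \<times> nat) set" where
  "place_powers f = {(v, j). v \<in> finite_places \<and> j \<ge> 1 \<and> v ^ j dvd f}"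

lemma monic_induct [consumes 1, case_names one mult]:
  fixes f :: "'a::{field,finite} poly"
  assumes "monic f" "P 1" "\<And>v f. v \<in> finite_places \<Longrightarrow> monic f \<Longrightarrow> P f \<Longrightarrow> P (v * f)"
  shows "P f"
  using assms(1)
proof (induction "degree f" arbitrary: f rule: less_induct)
  case less
  show ?case
  proof (cases "degree f = 0")
    case True
    hence "f = 1" using less.prems by (auto elim!: degree_eq_zeroE)
    thus ?thesis using assms(2) by simp
  next
    case False
    then obtain v g where v: "v \<in> finite_places" and g: "f = v * g"
      using exists_place_dvd[of f] by (auto elim!: dvdE)
    have "g \<noteq> 0" using less.prems g by auto
    hence "degree g < degree f" using place_degree_pos[OF v] place_nonzero[OF v]
      by (simp add: g degree_mult_eq)
    moreover have "monic g" using less.prems v by (simp add: g lead_coeff_mult finite_places_def)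
    ultimately show ?thesis using assms(3)[OF v] less.hyps g by blast
  qed
qed

text \<open>Removing one prime factor \<open>u\<close> from \<open>f\<close> removes exactly one
  pair, that of the highest power of \<open>u\<close>, and lowers the degree by
  \<open>degree u\<close>.\<close>

lemma degree_eq_sum_place_powers:
  fixes f :: "'a::{field,finite} poly"
  assumes "f \<noteq> 0"
  shows "finite (place_powers f) \<and> (\<Sum>(v, j)\<in>place_powers f. degree v) = degree f"
  using assms
proof (induction "degree f" arbitrary: f rule: less_induct)
  case less
  show ?case
  proof (cases "degree f = 0")
    case True
    have "(v, j) \<notin> place_powers f" for v j
    proof
      assume "(v, j) \<in> place_powers f"
      hence v: "v \<in> finite_places" and "j \<ge> 1" "v ^ j dvd f" by (auto simp: place_powers_def)
      hence "v dvd f" using dvd_trans[OF dvd_power[of j v]] by simp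
      with less.prems True place_degree_pos[OF v] show False
        using dvd_imp_degree_le[of v f] by auto
    qed
    hence "place_powers f = {}" by auto
    thus ?thesis using True by simp
  next
    case False
    then obtain u where u: "u \<in> finite_places" "u dvd f" using exists_place_dvd by auto
    then obtain g where g: "f = u * g" by (elim dvdE)
    have g0: "g \<noteq> 0" and u0: "u \<noteq> 0" using g less.prems by auto
    have dg: "degree f = degree u + degree g" using g g0 u0 by (simp add: degree_mult_eq)
    hence "degree g < degree f" using place_degree_pos[OF u(1)] by auto
    note IH = less.hyps[OF this g0]
    obtain k h where kh: "g = u ^ k * h" "\<not> u dvd h" "\<And>j. u ^ j dvd g \<longleftrightarrow> j \<le> k"
      using place_decompose[OF u(1) g0] by blast
    have uj: "u ^ j dvd f \<longleftrightarrow> j \<le> Suc k" for j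
    proof (cases j)
      case (Suc i)
      have "u ^ j dvd f \<longleftrightarrow> u ^ i dvd g" using u0 by (simp add: Suc g)
      thus ?thesis using kh(3) Suc by simp
    qed auto
    \<comment> \<open>Climb from \<open>v ^ i\<close> to \<open>v ^ Suc i\<close>: after cancelling
      \<open>v ^ i\<close>, the prime \<open>v\<close> divides \<open>u * t\<close> but not
      \<open>u\<close>.\<close>
    have vj: "v ^ j dvd f \<longleftrightarrow> v ^ j dvd g" if v: "v \<in> finite_places" "v \<noteq> u" for v j
    proof
      assume "v ^ j dvd f"
      have "v ^ i dvd g \<Longrightarrow> i < j \<Longrightarrow> v ^ Suc i dvd g" for i
      proof -
        assume "v ^ i dvd g" "i < j"
        then obtain t where t: "g = v ^ i * t" by (elim dvdE)
        have "v ^ Suc i dvd f" using \<open>i < j\<close> \<open>v ^ j dvd f\<close>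
          by (meson Suc_leI dvd_trans le_imp_power_dvd)
        hence "v ^ i * v dvd v ^ i * (u * t)" by (simp add: g t ac_simps)
        hence "v dvd u * t" using place_nonzero[OF v(1)] by simp
        hence "v dvd t" using v u place_dvd_mult place_dvd_place by blast
        thus "v ^ Suc i dvd g" by (simp add: t mult.commute)
      qed
      hence "i \<le> j \<Longrightarrow> v ^ i dvd g" for i by (induction i) auto
      thus "v ^ j dvd g" by simp
    qed (simp add: g)
    have "(v, j) \<in> place_powers f \<longleftrightarrow> (v, j) \<in> insert (u, Suc k) (place_powers g)" for v j
    proof (cases "v = u")
      case True
      have "(u, j) \<in> place_powers f \<longleftrightarrow> 1 \<le> j \<and> j \<le> Suc k"
        unfolding place_powers_def by (simp add: u(1) uj)
      moreover have "(u, j) \<in> place_powers g \<longleftrightarrow> 1 \<le> j \<and> j \<le> k"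
        unfolding place_powers_def by (simp add: u(1) kh(3))
      ultimately show ?thesis using True by auto
    next
      case False
      thus ?thesis unfolding place_powers_def using vj[of v j] by blast
    qed
    hence "place_powers f = insert (u, Suc k) (place_powers g)" by auto
    moreover have "(u, Suc k) \<notin> place_powers g" using kh(3) by (auto simp: place_powers_def)
    ultimately show ?thesis using IH dg by simp
  qed
qed

section \<open>Square-free polynomials and the splitting off of a square\<close>

definition sqfree_monics :: "nat \<Rightarrow> 'a::field poly set" where
  "sqfree_monics n = {Q \<in> monics n. squarefree Q}"

lemma finite_sqfree_monics [simp]: "finite (sqfree_monics n :: 'a::{field,finite} poly set)"
  by (simp add: sqfree_monics_def)

lemma place_square_dvd_squarefree:
  "v \<in> finite_places \<Longrightarrow> squarefree s \<Longrightarrow> \<not> v\<^sup>2 dvd s"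
  by (auto simp: squarefree_def finite_places_def irreducible_def)

lemma squarefree_places:
  fixes s :: "'a::{field,finite} poly"
  assumes s: "s \<noteq> 0" and *: "\<And>v. v \<in> finite_places \<Longrightarrow> \<not> v\<^sup>2 dvd s"
  shows "squarefree s"
proof (rule squarefreeI)
  fix x assume x: "x\<^sup>2 dvd s"
  hence x0: "x \<noteq> 0" using s by auto
  show "is_unit x"
  proof (rule ccontr)
    assume "\<not> is_unit x"
    hence "degree x > 0" using x0 by (auto simp: is_unit_iff_degree)
    then obtain v where v: "v \<in> finite_places" "v dvd x" using exists_place_dvd by auto
    hence "v\<^sup>2 dvd s" using x by (meson dvd_power_same dvd_trans)
    with * v show False by auto
  qed
qed

text \<open>Descent on the degree of \<open>h\<close>: a place dividing \<open>h\<close> must divide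
  \<open>h'\<close> as well, because the square-free \<open>s'\<close> can take up only one of the
  two copies; cancel it on both sides.\<close>

lemma squarefree_decomp_unique:
  fixes s s' h h' :: "'a::{field,finite} poly"
  assumes "squarefree s" "squarefree s'" "monic s" "monic s'" "monic h" "monic h'"
    and "s * h\<^sup>2 = s' * h'\<^sup>2"
  shows "s = s' \<and> h = h'"
  using assms(5-7)
proof (induction "degree h" arbitrary: h h' rule: less_induct)
  case less
  have h0: "h \<noteq> 0" "h' \<noteq> 0" using less.prems by auto
  \<comment> \<open>If \<open>v\<close> does not divide \<open>b\<close>, both copies of
    \<open>v\<close> in \<open>v\<^sup>2 dvd S' * b\<^sup>2\<close> have to come from
    \<open>S'\<close>.\<close>
  have key: "v dvd b" if "v \<in> finite_places" "v dvd a" "S' * b\<^sup>2 = S * a\<^sup>2" "squarefree S'" for v a b S S'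
  proof (rule ccontr)
    assume nb: "\<not> v dvd b"
    have "v\<^sup>2 dvd S' * b\<^sup>2" using that(2) by (simp add: that(3) dvd_mult dvd_power_same)
    then obtain t where "S' * b\<^sup>2 = v\<^sup>2 * t" by (elim dvdE)
    hence t: "S' * b\<^sup>2 = v * (v * t)" by (simp add: power2_eq_square mult.assoc)
    have "v dvd S' * b\<^sup>2" by (simp add: t)
    hence "v dvd S'" using nb that(1) place_dvd_mult place_dvd_power by blast
    then obtain u where u: "S' = v * u" by (elim dvdE)
    have "v * (u * b\<^sup>2) = v * (v * t)" using t by (simp add: u ac_simps)
    hence "u * b\<^sup>2 = v * t" using place_nonzero[OF that(1)] by simp
    hence "v dvd u * b\<^sup>2" by simp
    hence "v dvd u" using nb that(1) place_dvd_mult place_dvd_power by blast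
    hence "v\<^sup>2 dvd S'" by (simp add: u power2_eq_square)
    thus False using that place_square_dvd_squarefree by blast
  qed
  show ?case
  proof (cases "degree h = 0")
    case True
    hence h1: "h = 1" using less.prems(1) by (auto elim!: degree_eq_zeroE)
    have "degree h' = 0"
    proof (rule ccontr)
      assume "degree h' \<noteq> 0"
      then obtain v where v: "v \<in> finite_places" "v dvd h'" using exists_place_dvd by auto
      from key[OF v less.prems(3) assms(1)] h1 v show False
        by (auto simp: finite_places_def irreducible_def)
    qed
    hence "h' = 1" using less.prems(2) by (auto elim!: degree_eq_zeroE)
    thus ?thesis using h1 less.prems by simp
  next
    case False
    then obtain v where v: "v \<in> finite_places" "v dvd h" using exists_place_dvd by auto
    from key[OF v less.prems(3)[symmetric] assms(2)] have "v dvd h'" .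
    with v obtain a b where ab: "h = v * a" "h' = v * b" by (elim dvdE) blast
    have v0: "v \<noteq> 0" and vm: "monic v" using v by (auto simp: finite_places_def)
    have a0: "a \<noteq> 0" using h0 ab by auto
    have "degree a < degree h" using a0 v0 ab place_degree_pos[OF v(1)] by (simp add: degree_mult_eq)
    moreover have "monic a" "monic b" using less.prems(1,2) vm by (auto simp: ab lead_coeff_mult)
    moreover have "s * a\<^sup>2 = s' * b\<^sup>2"
    proof -
      have "v\<^sup>2 * (s * a\<^sup>2) = v\<^sup>2 * (s' * b\<^sup>2)" using less.prems(3)
        by (simp add: ab power_mult_distrib ac_simps)
      thus ?thesis using v0 by simp
    qed
    ultimately show ?thesis using less.hyps ab by auto
  qed
qed

lemma squarefree_decomp_exists:
  fixes f :: "'a::{field,finite} poly"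
  assumes "monic f"
  shows "\<exists>s h. squarefree s \<and> monic s \<and> monic h \<and> f = s * h\<^sup>2"
  using assms
proof (induction "degree f" arbitrary: f rule: less_induct)
  case less
  have f0: "f \<noteq> 0" using less.prems by auto
  show ?case
  proof (cases "\<exists>v\<in>finite_places. v\<^sup>2 dvd f")
    case True
    then obtain v g where v: "v \<in> finite_places" and g: "f = v\<^sup>2 * g" by (elim bexE dvdE)
    have vm: "monic v" using v by (auto simp: finite_places_def)
    have "g \<noteq> 0" using f0 g by auto
    hence "degree g < degree f" using place_degree_pos[OF v] place_nonzero[OF v]
      by (simp add: g degree_mult_eq degree_power_eq)
    moreover have "monic g" using less.prems vm by (simp add: g lead_coeff_mult lead_coeff_power)
    ultimately obtain s h where *: "squarefree s" "monic s" "monic h" "g = s * h\<^sup>2" using less.hyps by blast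
    hence "f = s * (v * h)\<^sup>2" by (simp add: g power_mult_distrib ac_simps)
    moreover have "monic (v * h)" using vm * by (simp add: lead_coeff_mult)
    ultimately show ?thesis using * by blast
  next
    case False
    hence "squarefree f" using squarefree_places[OF f0] by blast
    thus ?thesis using less.prems by (intro exI[of _ f] exI[of _ 1]) auto
  qed
qed

text \<open>Combinatorial form of \<open>Z(u) = Z(u^2) * S(u)\<close>, with \<open>Z\<close> and
  \<open>S\<close> the generating functions of all monic and of the square-free monic
  polynomials.\<close>

lemma bij_betw_squarefree_decomp:
  "bij_betw (\<lambda>(k, h, s). s * h\<^sup>2) (SIGMA k:{..n div 2}. monics k \<times> sqfree_monics (n - 2 * k))
     (monics n :: 'a::{field,finite} poly set)"
  unfolding bij_betw_def
proof (intro conjI equalityI subsetI inj_onI)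
  fix x y :: "nat \<times> 'a poly \<times> 'a poly"
  assume "x \<in> (SIGMA k:{..n div 2}. monics k \<times> sqfree_monics (n - 2 * k))"
    "y \<in> (SIGMA k:{..n div 2}. monics k \<times> sqfree_monics (n - 2 * k))"
    "(case x of (k, h, s) \<Rightarrow> s * h\<^sup>2) = (case y of (k, h, s) \<Rightarrow> s * h\<^sup>2)"
  moreover obtain k h s k' h' s' where "x = (k, h, s)" "y = (k', h', s')" by (cases x, cases y) auto
  ultimately show "x = y"
    using squarefree_decomp_unique[of s s' h h'] by (auto simp: monics_def sqfree_monics_def)
next
  fix f :: "'a poly" assume f: "f \<in> monics n"
  then obtain s h where *: "squarefree s" "monic s" "monic h" "f = s * h\<^sup>2"
    using squarefree_decomp_exists[of f] by (auto simp: monics_def)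
  have "s \<noteq> 0" "h \<noteq> 0" using * by auto
  hence "n = degree s + 2 * degree h" using f *(4) by (auto simp: monics_def degree_mult_eq degree_power_eq)
  thus "f \<in> (\<lambda>(k, h, s). s * h\<^sup>2) ` (SIGMA k:{..n div 2}. monics k \<times> sqfree_monics (n - 2 * k))"
    using * by (intro image_eqI[of _ _ "(degree h, h, s)"]) (auto simp: monics_def sqfree_monics_def)
next
  fix f :: "'a poly" assume "f \<in> (\<lambda>(k, h, s). s * h\<^sup>2) ` (SIGMA k:{..n div 2}. monics k \<times> sqfree_monics (n - 2 * k))"
  then obtain k h s where *: "k \<le> n div 2" "h \<in> monics k" "s \<in> sqfree_monics (n - 2 * k)" "f = s * (h * h)"
    by (auto simp: power2_eq_square)
  have "s * (h * h) \<in> monics (n - 2 * k + (k + k))"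
    using * by (intro monics_mult) (auto simp: sqfree_monics_def)
  thus "f \<in> monics n" using * by simp
qed

lemma sum_monics_squarefree_decomp:
  fixes w :: "'a::{field,finite} poly \<Rightarrow> real"
  assumes "\<And>s h. w (s * h) = w s * w h"
  shows "(\<Sum>f\<in>monics n. w f) =
    (\<Sum>k\<le>n div 2. (\<Sum>h\<in>monics k. (w h)\<^sup>2) * (\<Sum>s\<in>sqfree_monics (n - 2 * k). w s))"
proof -
  have "(\<Sum>f\<in>monics n. w f) =
      (\<Sum>(k, h, s)\<in>(SIGMA k:{..n div 2}. monics k \<times> sqfree_monics (n - 2 * k)). w (s * h\<^sup>2))"
    by (subst sum.reindex_bij_betw[OF bij_betw_squarefree_decomp, symmetric]) (simp add: case_prod_unfold)
  also have "\<dots> = (\<Sum>k\<le>n div 2. \<Sum>h\<in>monics k. \<Sum>s\<in>sqfree_monics (n - 2 * k). w (s * h\<^sup>2))"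
    by (subst sum.Sigma[symmetric]) (auto simp: sum.cartesian_product)
  also have "\<dots> = (\<Sum>k\<le>n div 2. (\<Sum>h\<in>monics k. (w h)\<^sup>2) * (\<Sum>s\<in>sqfree_monics (n - 2 * k). w s))"
    by (simp add: sum_product assms power2_eq_square mult_ac)
  finally show ?thesis .
qed

lemma square_product_monics:
  fixes Q R h :: "'a::{field,finite} poly"
  assumes "Q \<in> monics n" "R \<in> monics n" "Q * R = h\<^sup>2"
  shows "\<exists>k\<le>n div 2. \<exists>s\<in>monics (n - 2 * k). \<exists>a\<in>monics k. \<exists>b\<in>monics k. Q = s * a\<^sup>2 \<and> R = s * b\<^sup>2"
proof -
  from assms(1,2) have "Q \<in> (\<lambda>(k, h, s). s * h\<^sup>2) ` (SIGMA k:{..n div 2}. monics k \<times> sqfree_monics (n - 2 * k))"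
    "R \<in> (\<lambda>(k, h, s). s * h\<^sup>2) ` (SIGMA k:{..n div 2}. monics k \<times> sqfree_monics (n - 2 * k))"
    using bij_betw_squarefree_decomp[of n] by (auto simp: bij_betw_def)
  then obtain k s a k' s' b where
    1: "k \<le> n div 2" "a \<in> monics k" "s \<in> sqfree_monics (n - 2 * k)" "Q = s * a\<^sup>2" and
    2: "k' \<le> n div 2" "b \<in> monics k'" "s' \<in> sqfree_monics (n - 2 * k')" "R = s' * b\<^sup>2"
    by auto
  have m: "monic a" "monic b" "monic s" "monic s'" "squarefree s" "squarefree s'"
    using 1 2 by (auto simp: monics_def sqfree_monics_def)
  \<comment> \<open>The leading coefficient of \<open>h\<close> is 1 or -1 and the sign of
    \<open>h\<close> is free, so \<open>h\<close> may be replaced by a monic polynomial.\<close>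
  have "(lead_coeff h)\<^sup>2 = 1"
    using assms(3)[symmetric] m
      by (simp add: 1 2 lead_coeff_mult lead_coeff_power flip: lead_coeff_power[of h])
  hence "lead_coeff h = 1 \<or> lead_coeff h = -1" by (simp add: power2_eq_1_iff)
  then obtain h' where h': "monic h'" "h'\<^sup>2 = h\<^sup>2"
    by (metis lead_coeff_minus minus_minus power2_minus)
  \<comment> \<open>Multiplying \<open>Q * R\<close> by \<open>s'\<close> displays one polynomial
    both with square-free part \<open>s'\<close> and with square-free part \<open>s\<close>;
    uniqueness identifies the two.\<close>
  have "s' * h'\<^sup>2 = s * (s' * a * b)\<^sup>2"
    unfolding h'(2) assms(3)[symmetric] 1 2 by (simp add: power_mult_distrib power2_eq_square ac_simps)
  hence "s' = s" using squarefree_decomp_unique[of s' s h' "s' * a * b"] m h'(1)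
    by (auto simp: lead_coeff_mult)
  moreover have "k = k'"
  proof -
    have "n - 2 * k = n - 2 * k'" using \<open>s' = s\<close> 1 2 by (auto simp: sqfree_monics_def monics_def)
    moreover have "2 * k \<le> n" "2 * k' \<le> n" using 1(1) 2(1) by linarith+
    ultimately show ?thesis by linarith
  qed
  ultimately show ?thesis using 1 2 by (intro exI[of _ k]) (auto simp: sqfree_monics_def)
qed

text \<open>For each \<open>k\<close> there are \<open>q^(n - 2k)\<close> choices of
  \<open>s\<close> and \<open>q^k\<close> of each of \<open>a\<close> and \<open>b\<close>, together
  \<open>q^n\<close>. This is only an upper bound, since \<open>s\<close> is allowed to run over all
  monic polynomials.\<close>

lemma card_square_pairs:
  "card {(Q, R). Q \<in> monics n \<and> R \<in> monics n \<and> (\<exists>h :: 'a::{field,finite} poly. Q * R = h\<^sup>2)}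
    \<le> (n + 1) * CARD('a) ^ n"
proof -
  let ?T = "SIGMA k:{..n div 2}. (monics (n - 2 * k) :: 'a poly set) \<times> (monics k :: 'a poly set) \<times> (monics k :: 'a poly set)"
  have sub: "{(Q, R). Q \<in> monics n \<and> R \<in> monics n \<and> (\<exists>h :: 'a poly. Q * R = h\<^sup>2)}
      \<subseteq> (\<lambda>(k, s, a, b). (s * a\<^sup>2, s * b\<^sup>2)) ` ?T"
  proof safe
    fix Q R h :: "'a poly" assume "Q \<in> monics n" "R \<in> monics n" "Q * R = h\<^sup>2"
    from square_product_monics[OF this] show
      "(Q, R) \<in> (\<lambda>(k, s, a, b). (s * a\<^sup>2, s * b\<^sup>2)) ` ?T" by force
  qed
  have fin: "finite ?T" by (intro finite_SigmaI finite_cartesian_product) simp_all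
  have "card {(Q, R). Q \<in> monics n \<and> R \<in> monics n \<and> (\<exists>h :: 'a poly. Q * R = h\<^sup>2)} \<le> card ?T"
    using surj_card_le[OF fin sub] .
  also have "card ?T = (\<Sum>k\<le>n div 2. CARD('a) ^ (n - 2 * k) * (CARD('a) ^ k * CARD('a) ^ k))"
    by (subst card_SigmaI) (simp_all add: card_cartesian_product card_monics)
  also have "\<dots> = (\<Sum>k\<le>n div 2. CARD('a) ^ n)"
    by (intro sum.cong) (auto simp flip: power_add)
  also have "\<dots> \<le> (n + 1) * CARD('a) ^ n" by simp
  finally show ?thesis .
qed

text \<open>A product \<open>v * R\<close> is square-free exactly when \<open>R\<close> is
  square-free and prime to \<open>v\<close>. This is the source of the recursion for
  \<open>coprime_count\<close>.\<close>

lemma bij_betw_sqfree_dvd: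
  fixes v :: "'a::{field,finite} poly"
  assumes v: "v \<in> finite_places" and d: "degree v = d" and dn: "d \<le> n"
  shows "bij_betw (\<lambda>Q. v * Q) {Q \<in> sqfree_monics (n - d). \<not> v dvd Q} {Q \<in> sqfree_monics n. v dvd Q}"
  unfolding bij_betw_def
proof (intro conjI equalityI subsetI inj_onI)
  fix x y assume "v * x = v * y" thus "x = y" using place_nonzero[OF v] by simp
next
  have vm: "v \<in> monics d" using place_monic[OF v] d by simp
  fix Q assume "Q \<in> {Q \<in> sqfree_monics n. v dvd Q}"
  then obtain R where R: "Q = v * R" "Q \<in> sqfree_monics n" by (auto elim!: dvdE)
  have "R \<in> monics (n - d)" using monics_cancel[of v R n d] R vm by (auto simp: sqfree_monics_def)
  moreover have "squarefree R" using R by (auto simp: sqfree_monics_def squarefree_def)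
  moreover have "\<not> v dvd R"
    using place_square_dvd_squarefree[OF v, of Q] R by (auto simp: sqfree_monics_def power2_eq_square)
  ultimately show "Q \<in> (\<lambda>Q. v * Q) ` {Q \<in> sqfree_monics (n - d). \<not> v dvd Q}"
    using R by (auto simp: sqfree_monics_def)
next
  have vm: "v \<in> monics d" using place_monic[OF v] d by simp
  fix Q assume "Q \<in> (\<lambda>Q. v * Q) ` {Q \<in> sqfree_monics (n - d). \<not> v dvd Q}"
  then obtain R where R: "Q = v * R" "R \<in> sqfree_monics (n - d)" "\<not> v dvd R" by auto
  have Qm: "Q \<in> monics n" using monics_mult[OF vm, of R "n - d"] R dn by (auto simp: sqfree_monics_def)
  have "squarefree Q"
  proof (rule squarefree_places)
    show "Q \<noteq> 0" using Qm by (auto simp: monics_def)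
    fix u :: "'a poly" assume u: "u \<in> finite_places"
    show "\<not> u\<^sup>2 dvd Q"
    proof
      assume "u\<^sup>2 dvd Q"
      then obtain t where "Q = u\<^sup>2 * t" by (elim dvdE)
      hence t: "v * R = u * (u * t)" using R by (simp add: power2_eq_square mult.assoc)
      show False
      proof (cases "u = v")
        case True
        hence "R = v * t" using t place_nonzero[OF v] by simp
        thus False using R by simp
      next
        case False
        hence nd: "\<not> u dvd v" using u v place_dvd_place by blast
        have "u dvd v * R" by (simp add: t)
        hence "u dvd R" using nd u place_dvd_mult by blast
        then obtain r where r: "R = u * r" by (elim dvdE)
        have "u * (v * r) = u * (u * t)" using t by (simp add: r ac_simps)
        hence "u dvd v * r" using place_nonzero[OF u] by simp
        hence "u dvd r" using nd u place_dvd_mult by blast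
        hence "u\<^sup>2 dvd R" by (simp add: r power2_eq_square)
        thus False using R u place_square_dvd_squarefree by (auto simp: sqfree_monics_def)
      qed
    qed
  qed
  thus "Q \<in> {Q \<in> sqfree_monics n. v dvd Q}" using Qm R by (auto simp: sqfree_monics_def)
qed

subsection \<open>Frobenius and the finite subfields of the algebraic closure\<close>

lemma finite_field_fermat: "(c :: 'a::{field,finite}) ^ CARD('a) = c"
proof (cases "c = 0")
  case False
  have "bij_betw (\<lambda>x. c * x) (UNIV - {0}) (UNIV - {0 :: 'a})"
    using False by (intro bij_betw_byWitness[where f' = "\<lambda>x. x / c"]) auto
  hence "(\<Prod>x\<in>UNIV - {0 :: 'a}. c * x) = \<Prod>(UNIV - {0})"
    by (rule prod.reindex_bij_betw)
  moreover have "\<Prod>(UNIV - {0 :: 'a}) \<noteq> 0" by simp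
  ultimately have "c ^ card (UNIV - {0 :: 'a}) = 1" by (simp add: prod.distrib)
  hence "c ^ (CARD('a) - 1) * c = c" by (simp add: card_Diff_singleton)
  thus ?thesis by (simp flip: power_Suc2)
qed simp

lemma card_field_gt_1: "CARD('a::{field,finite}) > 1"
proof -
  have "card {0, 1 :: 'a} \<le> CARD('a)" by (intro card_mono) auto
  thus ?thesis by simp
qed

text \<open>Translation by 1 permutes the field, so the sum of all elements is unchanged when 1 is
  added \<open>q\<close> times.\<close>

lemma of_nat_card_field: "of_nat CARD('a) = (0 :: 'a::{field,finite})"
proof -
  have "(\<Sum>x\<in>UNIV. x + 1) = \<Sum>(UNIV :: 'a set)"
    by (rule sum.reindex_bij_betw) (rule bij_betw_byWitness[where f' = "\<lambda>x. x - 1"]; simp)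
  thus ?thesis by (simp add: sum.distrib)
qed

lemma alg_closure_2_neq_0:
  assumes "odd CARD('a::{field,finite})"
  shows "(2 :: 'a alg_closure) \<noteq> 0"
proof
  assume "(2 :: 'a alg_closure) = 0"
  hence "to_ac (2 :: 'a) = 0" by simp
  hence 2: "(2 :: 'a) = 0" by (simp only: to_ac_eq_0_iff)
  obtain k where "CARD('a) = 2 * k + 1" using assms by (elim oddE)
  thus False using 2 of_nat_card_field[where 'a='a] by simp
qed

definition ev :: "'a::{field,finite} poly \<Rightarrow> 'a alg_closure \<Rightarrow> 'a alg_closure" where
  "ev Q x = poly (map_poly to_ac Q) x"

lemma map_poly_to_ac_simps:
  fixes P Q :: "'a::field poly"
  shows "map_poly to_ac (P + Q) = map_poly to_ac P + map_poly to_ac Q"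
    "map_poly to_ac (P - Q) = map_poly to_ac P - map_poly to_ac Q"
    "map_poly to_ac (P * Q) = map_poly to_ac P * map_poly to_ac Q"
    "map_poly to_ac (P ^ n) = map_poly to_ac P ^ n"
    "map_poly to_ac (monom c n) = monom (to_ac c) n"
    "degree (map_poly to_ac P) = degree P"
    "lead_coeff (map_poly to_ac P) = to_ac (lead_coeff P)"
    "map_poly to_ac P = 0 \<longleftrightarrow> P = 0"
proof -
  show mult: "map_poly to_ac (P * Q) = map_poly to_ac P * map_poly to_ac Q" for P Q :: "'a poly"
    by (intro poly_eqI) (simp add: coeff_map_poly coeff_mult to_ac_sum)
  show "map_poly to_ac (P ^ n) = map_poly to_ac P ^ n"
    by (induction n) (simp_all add: mult)
  show "map_poly to_ac (P + Q) = map_poly to_ac P + map_poly to_ac Q"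
    "map_poly to_ac (P - Q) = map_poly to_ac P - map_poly to_ac Q"
    by (intro poly_eqI; simp add: coeff_map_poly)+
  show "map_poly to_ac (monom c n) = monom (to_ac c) n"
    by (simp add: map_poly_monom)
  show "degree (map_poly to_ac P) = degree P"
    by (simp add: degree_map_poly)
  show "lead_coeff (map_poly to_ac P) = to_ac (lead_coeff P)"
    by (simp add: degree_map_poly coeff_map_poly)
  show "map_poly to_ac P = 0 \<longleftrightarrow> P = 0"
    by (simp add: map_poly_eq_0_iff)
qed

lemma map_poly_to_ac_pCons: "map_poly to_ac (pCons c Q) = pCons (to_ac c) (map_poly to_ac Q)"
  by (intro poly_eqI) (simp add: coeff_map_poly coeff_pCons split: nat.splits)

lemma ev_simps [simp]:
  "ev (P + Q) x = ev P x + ev Q x" "ev (P - Q) x = ev P x - ev Q x"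
  "ev (P * Q) x = ev P x * ev Q x" "ev (P ^ n) x = ev P x ^ n"
  "ev 0 x = 0" "ev 1 x = 1" "ev (pCons c Q) x = to_ac c + x * ev Q x"
  "ev (smult c Q) x = to_ac c * ev Q x" "ev (monom c n) x = to_ac c * x ^ n"
  by (simp_all add: ev_def map_poly_to_ac_simps poly_monom map_poly_to_ac_pCons map_poly_smult)

lemma ev_mod: "ev v b = 0 \<Longrightarrow> ev (f mod v) b = ev f b"
proof -
  assume b: "ev v b = 0"
  have "ev (v * (f div v) + f mod v) b = ev (f mod v) b" unfolding ev_simps b by simp
  thus ?thesis by simp
qed

text \<open>
  The polynomial \<open>(X + 1)\<^sup>q - X\<^sup>q - 1\<close> has degree less than \<open>q\<close> and vanishes on \<open>\<F>\<^sub>q\<close>.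
\<close>

lemma frobenius_add:
  fixes x y :: "'a::{field,finite} alg_closure"
  shows "(x + y) ^ CARD('a) = x ^ CARD('a) + y ^ CARD('a)"
proof -
  let ?q = "CARD('a)"
  define P :: "'a poly" where "P = [:1, 1:] ^ ?q - (monom 1 ?q + 1)"
  have q: "?q > 0" by simp
  have "[:1, 1:] ^ ?q \<in> (monics ?q :: 'a poly set)"
    using lead_coeff_power[of "[:1, 1:] :: 'a poly" ?q]
      by (simp add: monics_def degree_power_eq del: lead_coeff_power)
  moreover have "monom 1 ?q + 1 \<in> (monics ?q :: 'a poly set)"
    by (subst monics_eq_image) (use q in \<open>simp add: polys_lt_def\<close>)
  ultimately have "P \<in> polys_lt ?q"
    unfolding P_def monics_eq_image by (auto intro: polys_lt_diff)
  hence "degree P < ?q" using q by (simp add: mem_polys_lt_degree)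
  moreover have "poly P c = 0" for c
    by (simp add: P_def finite_field_fermat poly_monom)
  ultimately have "P = 0"
    using card_poly_roots_bound[of P] by (cases "P = 0") auto
  hence eq: "[:1, 1:] ^ ?q = monom (1 :: 'a) ?q + 1" by (simp add: P_def)
  have *: "(1 + t) ^ ?q = t ^ ?q + 1" for t :: "'a alg_closure"
    using arg_cong[OF eq, of "\<lambda>P. ev P t"] by simp
  show ?thesis
  proof (cases "y = 0")
    case False
    have "(x + y) ^ ?q = (y * (1 + x / y)) ^ ?q" using False by (simp add: field_simps)
    also have "\<dots> = y ^ ?q * ((x / y) ^ ?q + 1)" unfolding power_mult_distrib * ..
    also have "\<dots> = x ^ ?q + y ^ ?q" using False by (simp add: field_simps)
    finally show ?thesis .
  qed (use q in simp)
qed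

lemma frobenius_pow_add:
  fixes x y :: "'a::{field,finite} alg_closure"
  shows "(x + y) ^ (CARD('a) ^ k) = x ^ (CARD('a) ^ k) + y ^ (CARD('a) ^ k)"
  by (induction k) (simp_all add: power_mult mult.commute[of "CARD('a)"] frobenius_add)

lemma to_ac_frobenius_pow [simp]: "to_ac (c :: 'a::{field,finite}) ^ (CARD('a) ^ k) = to_ac c"
proof (induction k)
  case (Suc k)
  have "to_ac c ^ (CARD('a) ^ Suc k) = (to_ac c ^ (CARD('a) ^ k)) ^ CARD('a)"
    by (simp flip: power_mult add: mult.commute)
  also have "\<dots> = to_ac c" unfolding Suc.IH by (simp add: finite_field_fermat flip: to_ac_power)
  finally show ?case .
qed simp

lemma ev_frobenius_pow:
  fixes x :: "'a::{field,finite} alg_closure"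
  shows "ev Q (x ^ (CARD('a) ^ k)) = ev Q x ^ (CARD('a) ^ k)"
  by (induction Q) (simp_all add: frobenius_pow_add power_mult_distrib)

lemma frobenius_pow_inj:
  fixes x y :: "'a::{field,finite} alg_closure"
  shows "x ^ (CARD('a) ^ k) = y ^ (CARD('a) ^ k) \<longleftrightarrow> x = y"
proof
  assume "x ^ (CARD('a) ^ k) = y ^ (CARD('a) ^ k)"
  moreover have "x ^ (CARD('a) ^ k) = (x - y) ^ (CARD('a) ^ k) + y ^ (CARD('a) ^ k)"
    using frobenius_pow_add[of "x - y" y k] by simp
  ultimately show "x = y" by simp
qed simp

lemma mem_ext_field: "x \<in> ext_field k \<longleftrightarrow> x ^ (CARD('a) ^ k) = x" for x :: "'a::{field,finite} alg_closure"
  by (simp add: ext_field_def)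

lemma ext_field_closed:
  fixes x y :: "'a::{field,finite} alg_closure"
  assumes "x \<in> ext_field k" "y \<in> ext_field k"
  shows "x + y \<in> ext_field k" "x * y \<in> ext_field k" "x ^ n \<in> ext_field k"
proof -
  show "x + y \<in> ext_field k" "x * y \<in> ext_field k"
    using assms by (simp_all add: mem_ext_field frobenius_pow_add power_mult_distrib)
  have "(x ^ n) ^ (CARD('a) ^ k) = (x ^ (CARD('a) ^ k)) ^ n"
    by (simp flip: power_mult add: mult.commute)
  thus "x ^ n \<in> ext_field k" using assms by (simp add: mem_ext_field)
qed

lemma ext_field_ev: "x \<in> ext_field k \<Longrightarrow> ev Q x \<in> ext_field k"
  by (simp add: mem_ext_field flip: ev_frobenius_pow)

lemma to_ac_in_ext_field [simp]: "to_ac c \<in> ext_field k"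
  by (simp add: mem_ext_field)

lemma ext_field_eq_roots:
  "ext_field k = {x. ev (monom 1 (CARD('a) ^ k) - [:0, 1:] :: 'a::{field,finite} poly) x = 0}"
  by (auto simp: ext_field_def)

lemma artin_schreier_degree:
  assumes "k \<ge> 1"
  shows "degree (monom 1 (CARD('a) ^ k) - [:0, 1:] :: 'a::{field,finite} poly) = CARD('a) ^ k"
proof -
  have "CARD('a) ^ k \<ge> CARD('a) ^ 1" using assms by (intro power_increasing) (auto simp: Suc_leI)
  hence "CARD('a) ^ k > 1" using card_field_gt_1[where 'a='a] by simp
  hence "degree (monom 1 (CARD('a) ^ k) + - [:0, 1:] :: 'a poly) = degree (monom 1 (CARD('a) ^ k) :: 'a poly)"
    by (intro degree_add_eq_left) (simp add: degree_monom_eq)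
  also have "monom 1 (CARD('a) ^ k) + - [:0, 1:] = (monom 1 (CARD('a) ^ k) - [:0, 1:] :: 'a poly)"
    by (rule add_uminus_conv_diff)
  finally show ?thesis by (simp only: degree_monom_eq one_neq_zero if_False not_False_eq_True)
qed

lemma finite_ext_field:
  assumes "k \<ge> 1"
  shows "finite (ext_field k :: 'a::{field,finite} alg_closure set)"
proof -
  let ?P = "map_poly to_ac (monom 1 (CARD('a) ^ k) - [:0, 1:] :: 'a poly)"
  have "degree ?P = CARD('a) ^ k"
    using artin_schreier_degree[OF assms] by (simp only: map_poly_to_ac_simps(6))
  hence "?P \<noteq> 0" by auto
  thus ?thesis
    unfolding ext_field_eq_roots ev_def by (rule poly_roots_finite)
qed

lemma proots_prod_linear: "proots (\<Prod>x\<in>#A. [:-x, 1 :: 'b::idom:]) = A"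
proof (induction A)
  case (add a A)
  have "(\<Prod>x\<in>#A. [:-x, 1 :: 'b:]) \<noteq> 0" by (auto simp: prod_mset_zero_iff)
  thus ?case using add by (simp add: proots_mult del: mult_pCons_left)
qed simp

text \<open>Every root of \<open>X^(q^k) - X\<close> is simple: \<open>q^k\<close> is 0 in the
  field, so the derivative is -1. The number of roots is therefore the degree.\<close>

lemma card_ext_field:
  assumes "k \<ge> 1"
  shows "card (ext_field k :: 'a::{field,finite} alg_closure set) = CARD('a) ^ k"
proof -
  let ?P = "map_poly to_ac (monom 1 (CARD('a) ^ k) - [:0, 1:] :: 'a poly)"
  have deg: "degree ?P = CARD('a) ^ k"
    using artin_schreier_degree[OF assms] by (simp only: map_poly_to_ac_simps(6))
  hence P0: "?P \<noteq> 0" by auto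
  have "(of_nat CARD('a) :: 'a alg_closure) = to_ac (of_nat CARD('a) :: 'a)" by simp
  hence q0': "(of_nat CARD('a) :: 'a alg_closure) = 0" unfolding of_nat_card_field by simp
  have "pderiv ?P = pderiv (monom 1 (CARD('a) ^ k)) - pderiv [:0, 1:]"
    by (simp only: map_poly_to_ac_simps pderiv_diff map_poly_to_ac_pCons) simp
  moreover have "(of_nat (CARD('a) ^ k) :: 'a alg_closure) = 0" using assms q0' by simp
  ultimately have pd: "pderiv ?P = - 1"
    by (simp only: pderiv_monom pderiv_pCons) (simp add: one_pCons)
  have ord: "order x ?P = 1" if x: "poly ?P x = 0" for x
  proof (rule ccontr)
    assume "order x ?P \<noteq> 1"
    moreover have "order x ?P \<noteq> 0" using x P0 order_root by blast
    ultimately have "2 \<le> order x ?P" by simp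
    hence "[:-x, 1:]\<^sup>2 dvd ?P" using order_1[of x ?P] by (meson dvd_trans le_imp_power_dvd)
    then obtain g where g: "?P = [:-x, 1:]\<^sup>2 * g" by (elim dvdE)
    have "poly (pderiv ?P) x = 0"
      by (simp only: g power2_eq_square pderiv_mult poly_add poly_mult) simp
    thus False unfolding pd by simp
  qed
  obtain A where A: "size A = degree ?P" "?P = smult (lead_coeff ?P) (\<Prod>x\<in>#A. [:-x, 1:])"
    using alg_closed_imp_factorization[OF P0] by blast
  have "proots ?P = A"
    by (subst A(2)) (use P0 in \<open>simp only: proots_smult leading_coeff_0_iff not_False_eq_True proots_prod_linear\<close>)
  hence sz: "size (proots ?P) = CARD('a) ^ k" using A deg by simp
  have "proots ?P = mset_set {x. poly ?P x = 0}"
  proof (rule multiset_eqI)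
    fix x
    have "count (mset_set {x. poly ?P x = 0}) x = (if poly ?P x = 0 then 1 else 0)"
      using poly_roots_finite[OF P0] by (subst count_mset_set') simp
    thus "count (proots ?P) x = count (mset_set {x. poly ?P x = 0}) x"
      using ord[of x] P0 order_root[of ?P x] by (simp only: count_proots) auto
  qed
  hence "CARD('a) ^ k = card {x. poly ?P x = 0}" using sz by (metis size_mset_set)
  thus ?thesis unfolding ext_field_eq_roots ev_def ..
qed

lemma range_to_ac: "range (to_ac :: 'a \<Rightarrow> _) = (ext_field 1 :: 'a::{field,finite} alg_closure set)"
proof (rule card_subset_eq)
  show "card (range (to_ac :: 'a \<Rightarrow> _)) = card (ext_field 1 :: 'a alg_closure set)"
    by (simp add: card_ext_field card_image inj_to_ac)
qed (auto simp: finite_ext_field)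

section \<open>The roots of a place as a Frobenius orbit\<close>

definition ac_roots :: "'a::{field,finite} poly \<Rightarrow> 'a alg_closure multiset" where
  "ac_roots f = proots (map_poly to_ac f)"

lemma ac_roots_split:
  assumes "monic f"
  shows "map_poly to_ac f = (\<Prod>x\<in>#ac_roots f. [:-x, 1:])" and "size (ac_roots f) = degree f"
proof -
  have f0: "map_poly to_ac f \<noteq> 0" using assms by (auto simp: map_poly_to_ac_simps)
  obtain A where A: "size A = degree (map_poly to_ac f)"
    "map_poly to_ac f = smult (lead_coeff (map_poly to_ac f)) (\<Prod>x\<in>#A. [:-x, 1:])"
    using alg_closed_imp_factorization[OF f0] by blast
  have l: "lead_coeff (map_poly to_ac f) = 1" unfolding map_poly_to_ac_simps(7) using assms by simp
  have "ac_roots f = A"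
    unfolding ac_roots_def by (subst A(2)) (simp only: l smult_1_left proots_prod_linear)
  thus "map_poly to_ac f = (\<Prod>x\<in>#ac_roots f. [:-x, 1:])" "size (ac_roots f) = degree f"
    using A(2)[unfolded l] A(1)[unfolded map_poly_to_ac_simps(6)] by simp_all
qed

lemma ac_roots_mult: "f \<noteq> 0 \<Longrightarrow> g \<noteq> 0 \<Longrightarrow> ac_roots (f * g) = ac_roots f + ac_roots g"
  by (simp add: ac_roots_def map_poly_to_ac_simps proots_mult)

lemma ac_roots_1 [simp]: "ac_roots 1 = {#}"
  by (simp add: ac_roots_def)

lemma mem_ac_roots: "f \<noteq> 0 \<Longrightarrow> x \<in># ac_roots f \<longleftrightarrow> ev f x = 0"
  by (simp add: ac_roots_def ev_def map_poly_to_ac_simps)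

lemma place_has_root:
  assumes "v \<in> finite_places"
  obtains b where "ev v b = 0"
proof -
  have "degree (map_poly to_ac v) > 0" using place_degree_pos[OF assms] by (simp add: map_poly_to_ac_simps)
  thus ?thesis using alg_closed_imp_poly_has_root that unfolding ev_def by blast
qed

text \<open>\<open>v\<close> is the minimal polynomial of its root \<open>b\<close>: if
  \<open>v\<close> does not divide \<open>Q\<close>, an inverse of \<open>Q\<close> modulo
  \<open>v\<close> shows that \<open>Q\<close> does not vanish at \<open>b\<close>.\<close>

lemma ev_place_eq_0_iff:
  assumes v: "v \<in> finite_places" and b: "ev v b = 0"
  shows "ev Q b = 0 \<longleftrightarrow> v dvd Q"
proof
  assume Q: "ev Q b = 0"
  show "v dvd Q"
  proof (rule ccontr)
    assume "\<not> v dvd Q"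
    then obtain c where c: "(Q * c) mod v = 1" using place_inverse_mod[OF v] by blast
    have "Q * c = v * (Q * c div v) + 1" using mult_div_mod_eq[of v "Q * c"] c by simp
    hence "ev (Q * c) b = ev (v * (Q * c div v) + 1) b" by (rule arg_cong)
    thus False using Q b by simp
  qed
qed (use b in \<open>auto elim!: dvdE\<close>)

text \<open>The residue field of \<open>v\<close>: evaluation at \<open>b\<close> is injective on
  representatives and its image is closed under multiplication. Hence multiplication by a non-zero
  \<open>y\<close> permutes the non-zero elements of the image, which gives
  \<open>y^(q^d - 1) = 1\<close>; the image is the whole of F_(q^d) by counting.\<close>

lemma place_root_field:
  fixes v :: "'a::{field,finite} poly"
  assumes v: "v \<in> finite_places" and b: "ev v b = 0"
  shows "bij_betw (\<lambda>f. ev f b) (polys_lt (degree v)) (ext_field (degree v))"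
proof -
  let ?d = "degree v" and ?V = "(\<lambda>f. ev f b) ` polys_lt (degree v)"
  have d: "?d \<ge> 1" using place_degree_pos[OF v] by simp
  have inj: "inj_on (\<lambda>f. ev f b) (polys_lt ?d)"
  proof (rule inj_onI)
    fix f g assume fg: "f \<in> polys_lt ?d" "g \<in> polys_lt ?d" "ev f b = ev g b"
    hence "v dvd f - g" using ev_place_eq_0_iff[OF v b, of "f - g"] by simp
    moreover have "f - g \<in> polys_lt ?d" using fg by (intro polys_lt_diff)
    ultimately show "f = g" using dvd_imp_degree_le[of v "f - g"]
      by (cases "f = g") (auto simp: polys_lt_def)
  qed
  have card: "card ?V = CARD('a) ^ ?d" using inj by (simp add: card_image card_polys_lt)
  have red: "ev f b \<in> ?V" for f
  proof (rule image_eqI)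
    show "ev f b = ev (f mod v) b" using ev_mod[OF b] by simp
    show "f mod v \<in> polys_lt ?d"
      using degree_mod_less[OF place_nonzero[OF v], of f] by (auto simp: polys_lt_def)
  qed
  have "y ^ (CARD('a) ^ ?d) = y" if y: "y \<in> ?V" for y
  proof (cases "y = 0")
    case False
    have "inj_on (\<lambda>x. y * x) (?V - {0})" using False by (auto simp: inj_on_def)
    moreover have "(\<lambda>x. y * x) ` (?V - {0}) \<subseteq> ?V - {0}"
    proof safe
      fix f :: "'a poly" assume "f \<in> polys_lt ?d"
      obtain g where "y = ev g b" using y by auto
      thus "y * ev f b \<in> ?V" using red[of "g * f"] by simp
    qed (use False in auto)
    ultimately have "bij_betw (\<lambda>x. y * x) (?V - {0}) (?V - {0})"
      by (simp add: bij_betw_def endo_inj_surj)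
    hence "(\<Prod>x\<in>?V - {0}. y * x) = \<Prod>(?V - {0})"
      by (rule prod.reindex_bij_betw)
    moreover have "\<Prod>(?V - {0}) \<noteq> 0" by simp
    ultimately have "y ^ card (?V - {0}) = 1" by (simp add: prod.distrib)
    moreover have "0 \<in> ?V" using red[of 0] by simp
    ultimately have "y ^ (CARD('a) ^ ?d - 1) = 1" using card by (simp add: card_Diff_singleton)
    hence "y ^ (CARD('a) ^ ?d - 1) * y = y" by simp
    thus ?thesis by (simp flip: power_Suc2)
  qed (use d in simp)
  hence "?V \<subseteq> ext_field ?d" by (auto simp: mem_ext_field)
  moreover have "card ?V = card (ext_field ?d :: 'a alg_closure set)"
    using card card_ext_field[OF d, where 'a='a] by simp
  ultimately have "?V = ext_field ?d"
    using finite_ext_field[OF d] by (intro card_subset_eq)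
  with inj show ?thesis by (simp add: bij_betw_def)
qed

lemma place_root_in_ext_field:
  fixes v :: "'a::{field,finite} poly"
  assumes v: "v \<in> finite_places" and b: "ev v b = 0"
  shows "b \<in> ext_field (degree v)"
proof -
  let ?d = "degree v"
  have d: "?d \<ge> 1" using place_degree_pos[OF v] by simp
  have V: "(\<lambda>f. ev f b) ` polys_lt ?d = ext_field ?d"
    using place_root_field[OF v b] by (simp add: bij_betw_def)
  have "ev ([:0, 1:] mod v) b = ev [:0, 1:] b" by (rule ev_mod[OF b])
  moreover have "[:0, 1:] mod v \<in> polys_lt ?d"
    using degree_mod_less[OF place_nonzero[OF v], of "[:0, 1:]"] by (auto simp: polys_lt_def)
  ultimately have "ev [:0, 1:] b \<in> ext_field ?d" using V by (metis image_eqI)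
  thus ?thesis by simp
qed

text \<open>If \<open>b^(q^m) = b\<close> with \<open>0 < m < d\<close>, then every element of
  F_(q^d), being a polynomial in \<open>b\<close>, would lie in the smaller field F_(q^m).\<close>

lemma place_root_frobenius_inj:
  fixes v :: "'a::{field,finite} poly"
  assumes v: "v \<in> finite_places" and b: "ev v b = 0"
  shows "inj_on (\<lambda>i. b ^ (CARD('a) ^ i)) {..<degree v}"
proof -
  let ?d = "degree v"
  have d: "?d \<ge> 1" using place_degree_pos[OF v] by simp
  have V: "(\<lambda>f. ev f b) ` polys_lt ?d = ext_field ?d"
    using place_root_field[OF v b] by (simp add: bij_betw_def)
  have *: False if "i < j" "j < ?d" "b ^ (CARD('a) ^ i) = b ^ (CARD('a) ^ j)" for i j
  proof -
    define m where "m = j - i"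
    have m: "m \<ge> 1" "m < ?d" "j = m + i" using that by (auto simp: m_def)
    have "b ^ (CARD('a) ^ j) = (b ^ (CARD('a) ^ m)) ^ (CARD('a) ^ i)"
      by (simp only: m(3) power_add power_mult)
    with that(3) have "(b ^ (CARD('a) ^ m)) ^ (CARD('a) ^ i) = b ^ (CARD('a) ^ i)" by (simp only:)
    hence bm: "b ^ (CARD('a) ^ m) = b" by (simp only: frobenius_pow_inj)
    have "y \<in> ext_field m" if "y \<in> ext_field ?d" for y :: "'a alg_closure"
    proof -
      from that have "y \<in> (\<lambda>f. ev f b) ` polys_lt ?d" by (simp only: V)
      then obtain f where "y = ev f b" by (rule imageE)
      hence "y ^ (CARD('a) ^ m) = ev f (b ^ (CARD('a) ^ m))" by (simp only: ev_frobenius_pow)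
      also have "\<dots> = y" by (simp only: bm \<open>y = ev f b\<close>)
      finally show ?thesis by (simp only: mem_ext_field)
    qed
    hence "card (ext_field ?d :: 'a alg_closure set) \<le> card (ext_field m :: 'a alg_closure set)"
      using finite_ext_field[OF m(1)] by (intro card_mono) auto
    hence "CARD('a) ^ ?d \<le> CARD('a) ^ m"
      by (simp add: card_ext_field[OF d] card_ext_field[OF m(1)])
    thus False using power_le_imp_le_exp[OF card_field_gt_1[where 'a='a]] m(2) by fastforce
  qed
  show ?thesis
  proof (rule inj_onI)
    fix i j assume "i \<in> {..<?d}" "j \<in> {..<?d}" "b ^ (CARD('a) ^ i) = b ^ (CARD('a) ^ j)"
    thus "i = j" using *[of i j] *[of j i] by (metis lessThan_iff linorder_neqE_nat)
  qed
qed

text \<open>The Frobenius orbit of \<open>b\<close> consists of roots, and its \<open>d\<close>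
  distinct elements use up the degree of \<open>v\<close>; so all roots are conjugate and
  simple.\<close>

lemma place_ac_roots:
  fixes v :: "'a::{field,finite} poly"
  assumes v: "v \<in> finite_places" and b: "ev v b = 0"
  shows "ac_roots v = image_mset (\<lambda>i. b ^ (CARD('a) ^ i)) (mset_set {..<degree v})"
proof -
  let ?S = "(\<lambda>i. b ^ (CARD('a) ^ i)) ` {..<degree v}"
  have v0: "v \<noteq> 0" and vm: "monic v" using v by (auto simp: finite_places_def)
  have "ev v (b ^ (CARD('a) ^ i)) = 0" for i by (simp add: ev_frobenius_pow b)
  hence "?S \<subseteq> set_mset (ac_roots v)" by (auto simp: mem_ac_roots[OF v0])
  hence "mset_set ?S \<subseteq># mset_set (set_mset (ac_roots v))"
    by (intro subset_imp_msubset_mset_set) simp_all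
  also have "\<dots> \<subseteq># ac_roots v" by (rule mset_set_set_mset_msubset)
  finally have "mset_set ?S \<subseteq># ac_roots v" .
  moreover have "size (mset_set ?S) = size (ac_roots v)"
    using place_root_frobenius_inj[OF v b] by (simp add: card_image ac_roots_split(2)[OF vm])
  ultimately have "ac_roots v = mset_set ?S"
    using mset_subset_size[of "mset_set ?S" "ac_roots v"] unfolding subset_mset.le_less by (metis less_irrefl)
  thus ?thesis using image_mset_mset_set[OF place_root_frobenius_inj[OF v b]] by simp
qed

lemma place_root_in_ext_field_iff:
  fixes v :: "'a::{field,finite} poly"
  assumes v: "v \<in> finite_places" and b: "ev v b = 0"
  shows "b \<in> ext_field k \<longleftrightarrow> degree v dvd k"
proof -
  let ?d = "degree v"
  have d: "?d \<ge> 1" using place_degree_pos[OF v] by simp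
  have bd: "b ^ (CARD('a) ^ ?d) = b" using place_root_in_ext_field[OF v b] by (simp add: mem_ext_field)
  have per: "b ^ (CARD('a) ^ (?d * m)) = b" for m
    by (induction m) (simp_all add: power_add power_mult bd)
  have "b ^ (CARD('a) ^ k) = (b ^ (CARD('a) ^ (?d * (k div ?d)))) ^ (CARD('a) ^ (k mod ?d))"
    by (simp flip: power_mult power_add)
  also have "\<dots> = b ^ (CARD('a) ^ (k mod ?d))" by (simp add: per)
  finally have "b \<in> ext_field k \<longleftrightarrow> b ^ (CARD('a) ^ (k mod ?d)) = b ^ (CARD('a) ^ 0)"
    by (simp add: mem_ext_field)
  also have "\<dots> \<longleftrightarrow> k mod ?d = 0"
    using inj_on_eq_iff[OF place_root_frobenius_inj[OF v b], of "k mod ?d" 0] d by auto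
  finally show ?thesis by (simp add: mod_eq_0_iff_dvd)
qed

lemma root_of_some_place:
  fixes f :: "'a::{field,finite} poly"
  assumes "f \<noteq> 0" "ev f x = 0"
  shows "\<exists>v\<in>finite_places. ev v x = 0"
  using assms
proof (induction "degree f" arbitrary: f rule: less_induct)
  case less
  have "degree f > 0"
  proof (rule ccontr)
    assume "\<not> degree f > 0"
    hence "degree f = 0" by simp
    then obtain c where "f = [:c:]" by (rule degree_eq_zeroE)
    with less.prems show False by simp
  qed
  then obtain v g where v: "v \<in> finite_places" and g: "f = v * g"
    using exists_place_dvd[of f] by (auto elim!: dvdE)
  have g0: "g \<noteq> 0" using less.prems g by auto
  hence "degree g < degree f" using place_degree_pos[OF v] place_nonzero[OF v]
    by (simp add: g degree_mult_eq)
  from less.hyps[OF this g0] have IH: "ev g x = 0 \<Longrightarrow> \<exists>v\<in>finite_places. ev v x = 0" .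
  have "ev v x = 0 \<or> ev g x = 0" using less.prems(2) unfolding g by simp
  thus ?case using IH v by blast
qed

section \<open>Sums over F_(q^k) as sums over places\<close>

definition places_dvd :: "nat \<Rightarrow> 'a::{field,finite} poly set" where
  "places_dvd k = {v \<in> finite_places. degree v dvd k}"

lemma finite_places_dvd [simp]: "k \<ge> 1 \<Longrightarrow> finite (places_dvd k :: 'a::{field,finite} poly set)"
proof -
  assume "k \<ge> 1"
  hence "places_dvd k \<subseteq> (\<Union>d\<le>k. monics d :: 'a poly set)"
    by (force simp: places_dvd_def dest: place_monic dvd_imp_le)
  thus ?thesis by (rule finite_subset) simp
qed

text \<open>F_(q^k) is the disjoint union of the root sets of the places of degree dividing
  \<open>k\<close>.\<close>

lemma sum_ext_field:
  fixes F :: "'a::{field,finite} alg_closure \<Rightarrow> real"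
  assumes k: "k \<ge> 1"
  shows "(\<Sum>x\<in>ext_field k. F x) = (\<Sum>v\<in>places_dvd k. \<Sum>x\<in>#ac_roots v. F x)"
proof -
  have rt: "(\<Sum>x\<in>#ac_roots v. F x) = (\<Sum>x | ev v x = 0. F x)" "finite {x. ev v x = 0}" if v: "v \<in> finite_places"
    for v
  proof -
    have v0: "v \<noteq> 0" using place_nonzero v .
    obtain b where b: "ev v b = 0" using place_has_root[OF v] .
    let ?S = "(\<lambda>i. b ^ (CARD('a) ^ i)) ` {..<degree v}"
    have m: "ac_roots v = mset_set ?S"
      using image_mset_mset_set[OF place_root_frobenius_inj[OF v b]] place_ac_roots[OF v b] by simp
    have "{x. ev v x = 0} = set_mset (ac_roots v)" using mem_ac_roots[OF v0] by auto
    also have "\<dots> = ?S" unfolding m by simp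
    finally have e: "{x. ev v x = 0} = ?S" .
    show "(\<Sum>x\<in>#ac_roots v. F x) = (\<Sum>x | ev v x = 0. F x)"
      unfolding m e by (simp only: sum_unfold_sum_mset)
    show "finite {x. ev v x = 0}" unfolding e by simp
  qed
  have U: "ext_field k = (\<Union>v\<in>places_dvd k. {x :: 'a alg_closure. ev v x = 0})"
  proof (intro equalityI subsetI)
    fix x :: "'a alg_closure" assume x: "x \<in> ext_field k"
    have "(monom 1 (CARD('a) ^ k) - [:0, 1:] :: 'a poly) \<noteq> 0"
      using artin_schreier_degree[OF k, where 'a='a] by auto
    moreover have "ev (monom 1 (CARD('a) ^ k) - [:0, 1:]) x = 0"
      using x unfolding ext_field_eq_roots by simp
    ultimately obtain v where v: "v \<in> finite_places" "ev v x = 0"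
      using root_of_some_place by blast
    hence "v \<in> places_dvd k"
      using place_root_in_ext_field_iff[OF v] x by (simp add: places_dvd_def)
    thus "x \<in> (\<Union>v\<in>places_dvd k. {x. ev v x = 0})" using v(2) by blast
  next
    fix x :: "'a alg_closure" assume "x \<in> (\<Union>v\<in>places_dvd k. {x. ev v x = 0})"
    then obtain v where "v \<in> finite_places" "degree v dvd k" "ev v x = 0"
      by (auto simp: places_dvd_def)
    thus "x \<in> ext_field k" using place_root_in_ext_field_iff by blast
  qed
  have dj: "{x. ev u x = 0} \<inter> {x. ev v x = 0} = {}"
    if uv: "u \<in> places_dvd k" "v \<in> places_dvd k" "u \<noteq> v" for u v :: "'a poly"
  proof (rule ccontr)
    assume "{x. ev u x = 0} \<inter> {x. ev v x = 0} \<noteq> {}"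
    then obtain x where x: "ev u x = 0" "ev v x = 0" by auto
    hence "u dvd v" using uv ev_place_eq_0_iff[of u x v] by (simp add: places_dvd_def)
    thus False using uv place_dvd_place[of u v] by (simp add: places_dvd_def)
  qed
  have fin: "\<forall>v\<in>places_dvd k. finite {x :: 'a alg_closure. ev v x = 0}"
    using rt(2) by (simp add: places_dvd_def)
  have "(\<Sum>x\<in>ext_field k. F x) = (\<Sum>v\<in>places_dvd k. \<Sum>x | ev v x = 0. F x)"
    unfolding U by (rule sum.UNION_disjoint[OF finite_places_dvd[OF k] fin]) (use dj in blast)
  also have "\<dots> = (\<Sum>v\<in>places_dvd k. \<Sum>x\<in>#ac_roots v. F x)"
    by (intro sum.cong) (auto simp: rt(1) places_dvd_def)
  finally show ?thesis .
qed

text \<open>Gauss's count of irreducible polynomials: a place of degree \<open>d\<close> dividing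
  \<open>k\<close> accounts for \<open>d\<close> elements of F_(q^k).\<close>

lemma sum_degree_places_dvd:
  assumes k: "k \<ge> 1"
  shows "(\<Sum>v\<in>places_dvd k. degree (v :: 'a::{field,finite} poly)) = CARD('a) ^ k"
proof -
  have "real (CARD('a) ^ k) = (\<Sum>x\<in>(ext_field k :: 'a alg_closure set). 1)"
    using card_ext_field[OF k, where 'a='a] by simp
  also have "\<dots> = (\<Sum>v\<in>(places_dvd k :: 'a poly set). real (size (ac_roots v)))"
    by (subst sum_ext_field[OF k]) simp
  also have "\<dots> = (\<Sum>v\<in>(places_dvd k :: 'a poly set). real (degree v))"
    by (intro sum.cong) (auto simp: places_dvd_def finite_places_def ac_roots_split(2))
  finally have "real (\<Sum>v\<in>(places_dvd k :: 'a poly set). degree v) = real (CARD('a) ^ k)" by simp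
  thus ?thesis by (simp only: of_nat_eq_iff)
qed

subsection \<open>The quadratic symbol of polynomials\<close>

text \<open>
  \<open>tau\<close> reads the elements \<open>0, 1, -1\<close> of the algebraic closure as real numbers, so that by Euler's
  criterion \<open>chi k\<close> is the quadratic character of \<open>\<F>\<^bsub>q^k\<^esub>\<close>; other arguments do not occur.
\<close>

definition tau :: "'b::ring_1 \<Rightarrow> real" where
  "tau x = (if x = 0 then 0 else if x = 1 then 1 else - 1)"

definition chi :: "nat \<Rightarrow> 'a::{field,finite} alg_closure \<Rightarrow> real" where
  "chi k y = tau (y ^ ((CARD('a) ^ k - 1) div 2))"

definition res :: "'a::{field,finite} poly \<Rightarrow> 'a poly \<Rightarrow> 'a alg_closure" where
  "res f Q = (\<Prod>x\<in>#ac_roots f. ev Q x)"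

text \<open>The symbol \<open>(f|Q)\<close>. It is defined through the resultant for all
  \<open>f\<close> at once, not place by place, so that multiplicativity and reciprocity are
  inherited from the resultant.\<close>

definition sy :: "'a::{field,finite} poly \<Rightarrow> 'a poly \<Rightarrow> real" where
  "sy f Q = chi 1 (res f Q)"

lemma tau_0 [simp]: "tau 0 = 0" and tau_1 [simp]: "tau 1 = 1"
  by (simp_all add: tau_def)

lemma chi_values: "chi k y \<in> {0, 1, -1}"
  by (simp add: chi_def tau_def)

lemma sy_values: "sy f Q \<in> {0, 1, -1}"
  by (simp add: sy_def chi_values del: insert_iff)

lemma abs_sy_le_1: "\<bar>sy f Q\<bar> \<le> 1"
  using sy_values[of f Q] by auto

text \<open>The parameter only carries the type of the base field; the assumption separates 1 from
  -1.\<close>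

locale odd_field =
  fixes ty :: "'a::{field,finite} itself"
  assumes odd_card: "odd CARD('a)"
begin

lemma two_neq_0: "(2 :: 'a alg_closure) \<noteq> 0"
  by (rule alg_closure_2_neq_0[OF odd_card])

lemma one_neq_minus_one: "(1 :: 'a alg_closure) \<noteq> - 1"
  using two_neq_0 by (metis add.right_inverse one_add_one)

lemma card_ge_3: "CARD('a) \<ge> 3"
proof -
  have "CARD('a) \<noteq> 2" using odd_card by auto
  thus ?thesis using card_field_gt_1[where 'a='a] by linarith
qed

lemma tau_minus_1 [simp]: "tau (- 1 :: 'a alg_closure) = - 1"
  using one_neq_minus_one by (auto simp: tau_def)

lemma tau_mult:
  "a \<in> {0, 1, -1} \<Longrightarrow> b \<in> {0, 1, -1} \<Longrightarrow> tau (a * b) = tau a * tau b" for a b :: "'a alg_closure"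
  by auto

lemma tau_power:
  "a \<in> {0, 1, -1} \<Longrightarrow> tau (a ^ n) = tau a ^ n" for a :: "'a alg_closure"
  by (induction n) (auto simp: minus_one_power_iff)

lemma half_pow: "2 * ((CARD('a) ^ k - 1) div 2) = CARD('a) ^ k - 1"
  using odd_card by simp

lemma half_pow_pos: "k \<ge> 1 \<Longrightarrow> (CARD('a) ^ k - 1) div 2 \<ge> 1"
proof -
  assume "k \<ge> 1"
  hence "CARD('a) ^ k \<ge> CARD('a) ^ 1" by (intro power_increasing) (auto simp: Suc_leI)
  thus ?thesis using card_ge_3 by simp
qed

lemma ext_field_power_half:
  fixes y :: "'a alg_closure"
  assumes k: "k \<ge> 1" and y: "y \<in> ext_field k"
  shows "y ^ ((CARD('a) ^ k - 1) div 2) \<in> {0, 1, -1}"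
proof (cases "y = 0")
  case True
  thus ?thesis using half_pow_pos[OF k] by simp
next
  case False
  have "y ^ (CARD('a) ^ k - 1) * y = y"
    using y by (simp add: mem_ext_field flip: power_Suc2)
  hence "y ^ (CARD('a) ^ k - 1) = 1" using False by simp
  hence "(y ^ ((CARD('a) ^ k - 1) div 2))\<^sup>2 = 1"
    by (simp only: power_mult[symmetric] mult.commute[of _ 2] half_pow)
  thus ?thesis by (simp add: power2_eq_1_iff)
qed

lemma chi_mult:
  fixes y z :: "'a alg_closure"
  assumes "k \<ge> 1" "y \<in> ext_field k" "z \<in> ext_field k"
  shows "chi k (y * z) = chi k y * chi k z"
  unfolding chi_def power_mult_distrib
  by (intro tau_mult ext_field_power_half assms)

lemma chi_power:
  fixes y :: "'a alg_closure"
  assumes "k \<ge> 1" "y \<in> ext_field k"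
  shows "chi k (y ^ n) = chi k y ^ n"
proof -
  have "chi k (y ^ n) = tau ((y ^ ((CARD('a) ^ k - 1) div 2)) ^ n)"
    by (simp add: chi_def mult.commute flip: power_mult)
  thus ?thesis unfolding chi_def using tau_power[OF ext_field_power_half[OF assms]] by simp
qed

lemma chi_eq_0_iff: "k \<ge> 1 \<Longrightarrow> chi k y = 0 \<longleftrightarrow> y = 0" for y :: "'a alg_closure"
  using half_pow_pos[of k] by (auto simp: chi_def tau_def)

lemma chi_square_eq_1: "k \<ge> 1 \<Longrightarrow> y \<noteq> 0 \<Longrightarrow> (chi k y)\<^sup>2 = 1" for y :: "'a alg_closure"
  using chi_eq_0_iff[of k y] chi_values[of k y] by auto

text \<open>A square root \<open>z\<close> of \<open>y\<close> satisfies
  \<open>z^(q^k - 1) = y^((q^k - 1)/2)\<close>; for \<open>y\<close> different from 0 it therefore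
  lies in F_(q^k) exactly when Euler's power is 1.\<close>

lemma card_square_roots:
  fixes y :: "'a alg_closure"
  assumes k: "k \<ge> 1" and y: "y \<in> ext_field k"
  shows "real (card {z \<in> ext_field k. z\<^sup>2 = y}) = 1 + chi k y"
proof (cases "y = 0")
  case True
  have "(0 :: 'a alg_closure) \<in> ext_field k" by (simp add: mem_ext_field)
  hence "{z \<in> ext_field k. z\<^sup>2 = y} = {0 :: 'a alg_closure}"
    using True by auto
  thus ?thesis using True k by (simp add: chi_eq_0_iff)
next
  case False
  obtain z where z: "z\<^sup>2 = y" using nth_root_exists[of 2 y] by auto
  have z0: "z \<noteq> 0" using z False by auto
  have zz: "z \<noteq> - z"
  proof
    assume "z = - z"
    hence "2 * z = 0" by (metis add.right_inverse mult_2)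
    thus False using z0 two_neq_0 by simp
  qed
  have roots: "{z. z\<^sup>2 = y} = {z, - z}"
    using power2_eq_iff[of _ z] z by auto
  have "z ^ (CARD('a) ^ k) = z ^ (CARD('a) ^ k - 1) * z"
    by (simp flip: power_Suc2)
  also have "z ^ (CARD('a) ^ k - 1) = y ^ ((CARD('a) ^ k - 1) div 2)"
    by (simp only: z[symmetric] power_mult[symmetric] half_pow)
  finally have zp: "z \<in> ext_field k \<longleftrightarrow> y ^ ((CARD('a) ^ k - 1) div 2) = 1"
    using z0 by (simp add: mem_ext_field)
  have mz: "- z \<in> ext_field k \<longleftrightarrow> z \<in> ext_field k"
    using odd_card by (simp add: mem_ext_field)
  show ?thesis
  proof (cases "y ^ ((CARD('a) ^ k - 1) div 2) = 1")
    case True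
    hence "{z \<in> ext_field k. z\<^sup>2 = y} = {z, - z}" using roots zp mz by auto
    thus ?thesis using True zz by (simp add: chi_def)
  next
    case F: False
    hence e: "{z \<in> ext_field k. z\<^sup>2 = y} = {}" using roots zp mz by auto
    have "y ^ ((CARD('a) ^ k - 1) div 2) \<noteq> 0" using False by simp
    hence "chi k y = - 1" using F by (simp add: chi_def tau_def)
    thus ?thesis unfolding e by simp
  qed
qed

lemma sum_pow_card: "(CARD('a) ^ d - 1) * (\<Sum>i<m. CARD('a) ^ (d * i)) = CARD('a) ^ (d * m) - 1"
proof -
  have "int ((CARD('a) ^ d - 1) * (\<Sum>i<m. CARD('a) ^ (d * i))) =
      (int CARD('a) ^ d - 1) * (\<Sum>i<m. (int CARD('a) ^ d) ^ i)"
    by (simp add: of_nat_diff power_mult)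
  also have "\<dots> = (int CARD('a) ^ d) ^ m - 1" by (rule power_diff_1_eq[symmetric])
  also have "\<dots> = int (CARD('a) ^ (d * m) - 1)" by (simp add: of_nat_diff power_mult)
  finally show ?thesis by (simp only: of_nat_eq_iff)
qed

text \<open>The quotient of two Euler exponents is a geometric series. This compares quadratic
  characters of nested fields in \<open>chi_extend\<close> and identifies the symbol at a place in
  \<open>sy_place\<close>.\<close>

lemma half_pow_dvd:
  "((CARD('a) ^ d - 1) div 2) * (\<Sum>i<m. CARD('a) ^ (d * i)) = (CARD('a) ^ (d * m) - 1) div 2"
proof -
  have "2 * (((CARD('a) ^ d - 1) div 2) * (\<Sum>i<m. CARD('a) ^ (d * i))) = 2 * ((CARD('a) ^ (d * m) - 1) div 2)"
    by (simp only: half_pow sum_pow_card mult.assoc[symmetric])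
  thus ?thesis by simp
qed

lemma chi_extend:
  fixes y :: "'a alg_closure"
  assumes d: "d \<ge> 1" and m: "m \<ge> 1" and y: "y \<in> ext_field d"
  shows "chi (d * m) y = chi d y ^ m"
proof -
  define a where "a = y ^ ((CARD('a) ^ d - 1) div 2)"
  have a: "a \<in> {0, 1, -1}" using ext_field_power_half[OF d y] by (simp only: a_def)
  define M where "M = (\<Sum>i<m. CARD('a) ^ (d * i))"
  \<comment> \<open>\<open>M\<close> is a sum of \<open>m\<close> odd numbers. For
    \<open>a = -1\<close> only its parity matters, and for \<open>a = 0\<close> only that it is
    positive.\<close>
  have par: "even M \<longleftrightarrow> even m"
    unfolding M_def using odd_card by (induction m) auto
  have "CARD('a) ^ (d * 0) \<le> M" unfolding M_def by (rule member_le_sum) (use m in auto)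
  hence M1: "M \<ge> 1" by simp
  have "chi (d * m) y = tau (a ^ M)"
    unfolding chi_def a_def M_def by (simp only: power_mult[symmetric] half_pow_dvd)
  also have "\<dots> = tau a ^ M" by (rule tau_power[OF a])
  also have "\<dots> = tau a ^ m"
    using a par M1 m by (auto simp: power_0_left minus_one_power_iff)
  finally show ?thesis by (simp add: chi_def a_def)
qed

text \<open>The roots of \<open>v\<close> are the Frobenius conjugates of \<open>b\<close>, so
  \<open>res v Q\<close> is the norm of \<open>ev Q b\<close> down to the base field.\<close>

lemma res_place:
  fixes v :: "'a poly"
  assumes v: "v \<in> finite_places" and b: "ev v b = 0"
  shows "res v Q = ev Q b ^ (\<Sum>i<degree v. CARD('a) ^ i)"
proof -
  have "res v Q = (\<Prod>i<degree v. ev Q (b ^ (CARD('a) ^ i)))"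
    unfolding res_def place_ac_roots[OF v b] by (simp add: prod_unfold_prod_mset multiset.map_comp comp_def)
  thus ?thesis by (simp add: ev_frobenius_pow power_sum)
qed

lemma res_mult_left: "monic f \<Longrightarrow> monic g \<Longrightarrow> res (f * g) Q = res f Q * res g Q"
  by (subgoal_tac "f \<noteq> 0 \<and> g \<noteq> 0") (auto simp: res_def ac_roots_mult)

lemma res_mult_right: "res f (P * Q) = res f P * res f Q"
  by (simp add: res_def prod_mset.distrib)

lemma res_in_ext_field:
  fixes f :: "'a poly"
  assumes "monic f"
  shows "res f Q \<in> ext_field 1"
  using assms
proof (induction f rule: monic_induct)
  case one
  show ?case by (simp add: res_def mem_ext_field)
next
  case (mult v f)
  obtain b where b: "ev v b = 0" using place_has_root[OF mult(1)] .
  have d: "degree v \<ge> 1" using place_degree_pos[OF mult(1)] by simp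
  have "ev Q b \<in> ext_field (degree v)"
    by (rule ext_field_ev[OF place_root_in_ext_field[OF mult(1) b]])
  hence "ev Q b ^ (CARD('a) ^ degree v) = ev Q b" by (simp only: mem_ext_field)
  define S where "S = (\<Sum>i<degree v. CARD('a) ^ i)"
  \<comment> \<open>Multiplying the geometric series by \<open>q\<close> trades its term 1 for
    \<open>q^(degree v)\<close>, an exponent that acts on \<open>ev Q b\<close> like 1; so the norm
    is fixed by Frobenius.\<close>
  have S: "S * CARD('a) + 1 = S + CARD('a) ^ degree v"
  proof -
    have "S * CARD('a) + 1 = (\<Sum>i<Suc (degree v). CARD('a) ^ i)"
      unfolding S_def sum.lessThan_Suc_shift by (simp add: sum_distrib_left sum_distrib_right mult.commute)
    thus ?thesis by (simp add: S_def)
  qed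
  have "(ev Q b ^ S) ^ CARD('a) = ev Q b ^ S"
  proof (cases "ev Q b = 0")
    case True
    have "CARD('a) ^ 0 \<le> S" unfolding S_def by (rule member_le_sum) (use d in auto)
    thus ?thesis using True by (simp add: power_0_left)
  next
    case False
    have "(ev Q b ^ S) ^ CARD('a) * ev Q b = ev Q b ^ (S * CARD('a) + 1)"
      by (simp add: power_mult)
    also have "\<dots> = ev Q b ^ S * ev Q b"
      unfolding S power_add by (simp only: \<open>ev Q b ^ (CARD('a) ^ degree v) = ev Q b\<close>)
    finally show ?thesis using False by simp
  qed
  hence "res v Q \<in> ext_field 1"
    unfolding res_place[OF mult(1) b] S_def[symmetric] by (simp add: mem_ext_field)
  moreover have "monic v" using mult(1) by (simp add: finite_places_def)
  ultimately show ?case using mult by (simp add: res_mult_left ext_field_closed)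
qed

lemma sy_mult_left: "monic f \<Longrightarrow> monic g \<Longrightarrow> sy (f * g) Q = sy f Q * sy g Q" for f g Q :: "'a poly"
  unfolding sy_def by (simp only: res_mult_left) (intro chi_mult res_in_ext_field; simp)

lemma sy_mult_right: "monic f \<Longrightarrow> sy f (P * Q) = sy f P * sy f Q" for f P Q :: "'a poly"
  unfolding sy_def by (simp only: res_mult_right) (intro chi_mult res_in_ext_field; simp)

lemma sy_1_left [simp]: "sy 1 Q = 1" for Q :: "'a poly"
  by (simp add: sy_def res_def chi_def)

lemma sy_1_right [simp]: "sy f 1 = 1" for f :: "'a poly"
  by (simp add: sy_def res_def chi_def)

lemma sy_power_left: "monic f \<Longrightarrow> sy (f ^ n) Q = sy f Q ^ n" for f Q :: "'a poly"
  by (induction n) (simp_all add: sy_mult_left lead_coeff_power)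

text \<open>The norm followed by the Euler power of the base field is the Euler power of the residue
  field. At a place the symbol is thus the quadratic character of the residue field.\<close>

lemma sy_place:
  fixes v :: "'a poly"
  assumes v: "v \<in> finite_places" and b: "ev v b = 0"
  shows "sy v Q = chi (degree v) (ev Q b)"
proof -
  let ?h = "(CARD('a) ^ 1 - 1) div 2"
  have "sy v Q = tau (ev Q b ^ (?h * (\<Sum>i<degree v. CARD('a) ^ (1 * i))))"
    unfolding sy_def chi_def res_place[OF v b] by (simp add: mult.commute flip: power_mult)
  thus ?thesis unfolding half_pow_dvd chi_def by simp
qed

lemma sy_place_eq_0_iff: "v \<in> finite_places \<Longrightarrow> sy v Q = 0 \<longleftrightarrow> v dvd Q" for v :: "'a poly"
proof -
  assume v: "v \<in> finite_places"
  obtain b where b: "ev v b = 0" using place_has_root[OF v] .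
  have "degree v \<ge> 1" using place_degree_pos[OF v] by simp
  thus ?thesis
    unfolding sy_place[OF v b] by (simp add: chi_eq_0_iff ev_place_eq_0_iff[OF v b])
qed

lemma sy_place_square: "v \<in> finite_places \<Longrightarrow> (sy v Q)\<^sup>2 = (if v dvd Q then 0 else 1)" for v :: "'a poly"
  using sy_place_eq_0_iff[of v Q] sy_values[of v Q] by auto

text \<open>Grouping points by places turns a character sum over F_(q^k) into a sum over places, the
  form in which it can be averaged over \<open>Q\<close>.\<close>

lemma sum_chi_ev:
  fixes Q :: "'a poly"
  assumes k: "k \<ge> 1"
  shows "(\<Sum>x\<in>ext_field k. chi k (ev Q x)) =
    (\<Sum>v\<in>places_dvd k. real (degree v) * sy v Q ^ (k div degree v))"
proof (subst sum_ext_field[OF k], rule sum.cong)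
  fix v :: "'a poly" assume "v \<in> places_dvd k"
  hence v: "v \<in> finite_places" and dvd: "degree v dvd k" by (auto simp: places_dvd_def)
  let ?m = "k div degree v"
  have d: "degree v \<ge> 1" using place_degree_pos[OF v] by simp
  have m: "?m \<ge> 1" "degree v * ?m = k" using dvd k by (auto simp: Suc_le_eq div_greater_zero_iff dvd_imp_le)
  have v0: "v \<noteq> 0" using place_nonzero[OF v] .
  have "chi k (ev Q x) = sy v Q ^ ?m" if "x \<in># ac_roots v" for x
  proof -
    have x: "ev v x = 0" using that mem_ac_roots[OF v0] by simp
    have "ev Q x \<in> ext_field (degree v)"
      by (rule ext_field_ev[OF place_root_in_ext_field[OF v x]])
    from chi_extend[OF d m(1) this] show ?thesis by (simp only: m(2) sy_place[OF v x])
  qed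
  hence "(\<Sum>x\<in>#ac_roots v. chi k (ev Q x)) = (\<Sum>x\<in>#ac_roots v. sy v Q ^ ?m)"
    by (intro arg_cong[of _ _ sum_mset] image_mset_cong)
  also have "\<dots> = real (degree v) * sy v Q ^ ?m"
    using v by (simp add: ac_roots_split(2) finite_places_def)
  finally show "(\<Sum>x\<in>#ac_roots v. chi k (ev Q x)) = real (degree v) * sy v Q ^ ?m" .
qed simp

text \<open>Otherwise all \<open>q^k - 1\<close> non-zero elements would be roots of
  \<open>X^h - 1\<close> with \<open>h = (q^k - 1)/2\<close>.\<close>

lemma exists_ext_field_nonsquare:
  assumes k: "k \<ge> 1"
  shows "\<exists>y\<in>ext_field k. chi k (y :: 'a alg_closure) = - 1"
proof (rule ccontr)
  assume no: "\<not> ?thesis"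
  let ?h = "(CARD('a) ^ k - 1) div 2"
  let ?P = "monom 1 ?h - 1 :: 'a alg_closure poly"
  have h: "?h \<ge> 1" using half_pow_pos[OF k] .
  have "degree ?P \<le> ?h" by (intro degree_diff_le) (auto simp: degree_monom_eq)
  moreover have "?P \<noteq> 0"
  proof
    assume "?P = 0"
    hence "poly ?P 0 = 0" by simp
    thus False using h by (simp add: poly_monom power_0_left)
  qed
  ultimately have c: "card {x. poly ?P x = 0} \<le> ?h"
    using card_poly_roots_bound[of ?P] by linarith
  have "y ^ ?h = 1" if "y \<in> ext_field k - {0}" for y :: "'a alg_closure"
    using no that ext_field_power_half[OF k, of y] h by (auto simp: chi_def)
  hence sub: "ext_field k - {0} \<subseteq> {x. poly ?P x = 0}" by (auto simp: poly_monom)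
  have "card (ext_field k - {0 :: 'a alg_closure}) \<le> ?h"
    using card_mono[OF poly_roots_finite[OF \<open>?P \<noteq> 0\<close>] sub] c by linarith
  moreover have "(0 :: 'a alg_closure) \<in> ext_field k" by (simp add: mem_ext_field)
  ultimately have "CARD('a) ^ k - 1 \<le> ?h"
    by (simp add: card_Diff_singleton card_ext_field[OF k])
  thus False using half_pow[of k] h by linarith
qed

lemma exists_sy_minus_1:
  fixes v :: "'a poly"
  assumes v: "v \<in> finite_places"
  shows "\<exists>c. sy v c = - 1"
proof -
  obtain b where b: "ev v b = 0" using place_has_root[OF v] .
  have d: "degree v \<ge> 1" using place_degree_pos[OF v] by simp
  obtain y :: "'a alg_closure" where y: "y \<in> ext_field (degree v)" "chi (degree v) y = - 1"
    using exists_ext_field_nonsquare[OF d] by blast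
  from y(1) have "y \<in> (\<lambda>f. ev f b) ` polys_lt (degree v)"
    using place_root_field[OF v b] by (simp only: bij_betw_def)
  then obtain c where "y = ev c b" by (rule imageE)
  thus ?thesis using y(2) sy_place[OF v b] by auto
qed

section \<open>Constants, periodicity and reciprocity\<close>

definition leg :: "'a \<Rightarrow> real" where "leg c = chi 1 (to_ac c)"

lemma leg_nonzero_square: "c \<noteq> 0 \<Longrightarrow> (leg c)\<^sup>2 = 1"
  by (simp add: leg_def chi_square_eq_1)

lemma exists_leg_minus_1: "\<exists>c. c \<noteq> 0 \<and> leg c = - 1"
proof -
  obtain y :: "'a alg_closure" where y: "y \<in> ext_field 1" "chi 1 y = - 1"
    using exists_ext_field_nonsquare[of 1] by auto
  then obtain c where "y = to_ac c" using range_to_ac[where 'a='a] by blast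
  thus ?thesis using y using chi_eq_0_iff[of 1 0] by (intro exI[of _ c]) (auto simp: leg_def)
qed

lemma sy_smult:
  assumes "monic f"
  shows "sy f (smult c Q) = leg c ^ degree f * sy f Q"
proof -
  have "res f (smult c Q) = to_ac c ^ degree f * res f Q"
    by (simp add: res_def prod_mset.distrib ac_roots_split(2)[OF assms] prod_mset_constant)
  moreover have "chi 1 (to_ac c ^ degree f * res f Q) = chi 1 (to_ac c ^ degree f) * chi 1 (res f Q)"
    by (rule chi_mult[OF order_refl ext_field_closed(3)[OF to_ac_in_ext_field to_ac_in_ext_field]
          res_in_ext_field[OF assms]])
  moreover have "chi 1 (to_ac c ^ degree f) = chi 1 (to_ac c) ^ degree f"
    by (intro chi_power to_ac_in_ext_field order_refl)
  ultimately show ?thesis unfolding sy_def leg_def by simp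
qed

lemma sy_cong_mod:
  fixes D f g :: "'a poly"
  assumes D: "monic D" and fg: "D dvd f - g"
  shows "sy D f = sy D g"
proof -
  have D0: "D \<noteq> 0" using D by auto
  obtain t where "f - g = D * t" using fg by (elim dvdE)
  hence t: "f = g + D * t" by (simp add: algebra_simps)
  have "ev f x = ev g x" if "x \<in># ac_roots D" for x
    using that by (simp add: t mem_ac_roots[OF D0])
  hence "res D f = res D g" unfolding res_def
    by (intro arg_cong[of _ _ prod_mset] image_mset_cong)
  thus ?thesis by (simp add: sy_def)
qed

lemma sy_mod: "monic D \<Longrightarrow> sy D (f mod D) = sy D f" for D f :: "'a poly"
  by (rule sy_cong_mod) (simp_all flip: mod_eq_dvd_iff)

lemma prod_mset_swap_diff:
  fixes A B :: "'a alg_closure multiset"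
  shows "(\<Prod>x\<in>#A. \<Prod>y\<in>#B. x - y) = (- 1) ^ (size A * size B) * (\<Prod>y\<in>#B. \<Prod>x\<in>#A. y - x)"
proof (induction A)
  case (add a A)
  have neg: "(\<Prod>y\<in>#B. a - y) = (- 1) ^ size B * (\<Prod>y\<in>#B. y - a)"
    by (induction B) (simp_all add: algebra_simps)
  show ?case using add by (simp add: prod_mset.distrib neg power_add mult_ac)
qed simp

text \<open>Both resultants are the product of all differences between a root of \<open>f\<close>
  and a root of \<open>D\<close>, taken in opposite order, so they differ by one sign for each pair
  of roots.\<close>

lemma sy_reciprocity:
  fixes f D :: "'a poly"
  assumes f: "monic f" and D: "monic D"
  shows "sy f D = leg (- 1) ^ (degree f * degree D) * sy D f"
proof -
  have lin: "ev g x = (\<Prod>y\<in>#ac_roots g. x - y)" if "monic g" for g :: "'a poly" and x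
  proof -
    have "poly (\<Prod>y\<in>#A. [:-y, 1:]) x = (\<Prod>y\<in>#A. x - y)" for A :: "'a alg_closure multiset"
      by (induction A) (simp_all add: algebra_simps)
    thus ?thesis unfolding ev_def by (subst ac_roots_split(1)[OF that])
  qed
  have "res f D = (\<Prod>x\<in>#ac_roots f. \<Prod>y\<in>#ac_roots D. x - y)"
    by (simp add: res_def lin[OF D])
  also have "\<dots> = (- 1) ^ (degree f * degree D) * (\<Prod>y\<in>#ac_roots D. \<Prod>x\<in>#ac_roots f. y - x)"
    by (subst prod_mset_swap_diff) (simp only: ac_roots_split(2) f D)
  also have "(\<Prod>y\<in>#ac_roots D. \<Prod>x\<in>#ac_roots f. y - x) = res D f"
    by (simp add: res_def lin[OF f])
  finally have eq: "res f D = to_ac (- 1) ^ (degree f * degree D) * res D f" by simp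
  have "chi 1 (to_ac (- 1) ^ (degree f * degree D) * res D f) =
      chi 1 (to_ac (- 1 :: 'a) ^ (degree f * degree D)) * chi 1 (res D f)"
    by (rule chi_mult[OF order_refl ext_field_closed(3)[OF to_ac_in_ext_field to_ac_in_ext_field]
          res_in_ext_field[OF D]])
  moreover have "chi 1 (to_ac (- 1 :: 'a) ^ (degree f * degree D)) =
      chi 1 (to_ac (- 1 :: 'a)) ^ (degree f * degree D)"
    by (intro chi_power to_ac_in_ext_field order_refl)
  ultimately show ?thesis unfolding sy_def leg_def eq by simp
qed

lemma sy_reciprocity_even:
  "monic f \<Longrightarrow> monic D \<Longrightarrow> even (degree f * degree D) \<Longrightarrow> sy f D = sy D f" for f D :: "'a poly"
proof -
  assume f: "monic f" and D: "monic D" and e: "even (degree f * degree D)"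
  from e obtain m where "degree f * degree D = 2 * m" by (elim evenE)
  hence "leg (- 1) ^ (degree f * degree D) = 1" using leg_nonzero_square[of "-1"] by (simp add: power_mult)
  thus "sy f D = sy D f" using sy_reciprocity[OF f D] by simp
qed

section \<open>Orthogonality of the symbol over residue classes\<close>

lemma place_power_dvd_cancel:
  fixes v :: "'a poly"
  assumes v: "v \<in> finite_places" and a: "\<not> v dvd a"
  shows "v ^ k dvd a * x \<Longrightarrow> v ^ k dvd x"
proof (induction k arbitrary: x)
  case (Suc k)
  have "v dvd a * x" using Suc.prems unfolding power_Suc by (rule dvd_mult_left)
  hence "v dvd x" using place_dvd_mult[OF v] a by blast
  then obtain y where y: "x = v * y" by (elim dvdE)
  have "v * v ^ k dvd v * (a * y)" using Suc.prems by (simp add: y mult.left_commute)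
  hence "v ^ k dvd a * y" using place_nonzero[OF v] by simp
  hence "v ^ k dvd y" by (rule Suc.IH)
  thus ?case by (simp add: y)
qed simp

text \<open>A place dividing the square-free part of \<open>D\<close> occurs in \<open>D\<close>
  with odd multiplicity.\<close>

lemma nonsquare_decompose:
  fixes D :: "'a poly"
  assumes D: "monic D" and ns: "\<And>h. D \<noteq> h\<^sup>2"
  obtains v k E where "v \<in> finite_places" "odd k" "D = v ^ k * E" "\<not> v dvd E" "monic E"
proof -
  obtain s h where sh: "squarefree s" "monic s" "monic h" "D = s * h\<^sup>2"
    using squarefree_decomp_exists[OF D] by blast
  have "degree s \<noteq> 0"
  proof
    assume "degree s = 0"
    hence "s = 1" using sh(2) by (auto elim!: degree_eq_zeroE)
    thus False using ns[of h] sh(4) by simp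
  qed
  then obtain v s' where v: "v \<in> finite_places" and s': "s = v * s'"
    using exists_place_dvd[of s] by (auto elim!: dvdE)
  have vm: "monic v" using v by (simp add: finite_places_def)
  have h0: "h \<noteq> 0" using sh by auto
  obtain j h' where h': "h = v ^ j * h'" "\<not> v dvd h'" using place_decompose[OF v h0] by blast
  have nv: "\<not> v dvd s'"
  proof
    assume "v dvd s'"
    hence "v * v dvd v * s'" by (rule mult_dvd_mono[OF dvd_refl])
    hence "v\<^sup>2 dvd s" by (simp only: s' power2_eq_square)
    thus False using place_square_dvd_squarefree[OF v sh(1)] by simp
  qed
  have Deq: "D = v ^ (2 * j + 1) * (s' * h'\<^sup>2)"
    unfolding sh(4) h' s' by (simp add: power_mult_distrib power_mult[symmetric] mult.commute[of 2] ac_simps)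
  moreover have "\<not> v dvd s' * h'\<^sup>2" using nv h'(2) place_dvd_mult[OF v] place_dvd_power[OF v] by blast
  moreover have "monic (s' * h'\<^sup>2)"
    using D unfolding Deq by (simp add: lead_coeff_mult lead_coeff_power vm)
  ultimately show ?thesis by (intro that[OF v _ Deq]) simp_all
qed

text \<open>Multiplication by a unit \<open>h\<close> modulo \<open>D\<close> with symbol -1
  permutes the residues and reverses the sign of the sum.\<close>

lemma sum_sy_residues_eq_0:
  fixes D :: "'a poly"
  assumes D: "monic D" and ns: "\<And>h. D \<noteq> h\<^sup>2"
  shows "(\<Sum>r\<in>polys_lt (degree D). sy D r) = 0"
proof -
  let ?e = "degree D"
  obtain v k E where v: "v \<in> finite_places" and k: "odd k" and DE: "D = v ^ k * E" "\<not> v dvd E"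
    and Em: "monic E"
    using nonsquare_decompose[OF D ns] by blast
  have vm: "monic v" using v by (simp add: finite_places_def)
  obtain c where c: "sy v c = - 1" using exists_sy_minus_1[OF v] by blast
  obtain b where b: "(E * b) mod v = 1" using place_inverse_mod[OF v DE(2)] by blast
  \<comment> \<open>Explicit Chinese remainder theorem: \<open>h\<close> is 1 modulo
    \<open>E\<close> and \<open>c\<close> modulo \<open>v\<close>. Since the exponent of
    \<open>v\<close> in \<open>D\<close> is odd, the symbol of \<open>h\<close> at \<open>D\<close>
    is -1.\<close>
  define h where "h = 1 + E * b * (c - 1)"
  have "v dvd E * b - 1"
    using b place_degree_pos[OF v] by (simp add: mod_eq_dvd_iff[symmetric] mod_poly_less)
  moreover have "h - c = (E * b - 1) * (c - 1)" by (simp add: h_def algebra_simps)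
  ultimately have "v dvd h - c" by simp
  hence syv: "sy v h = - 1" using sy_cong_mod[OF vm] c by simp
  have "E dvd h - 1" by (simp add: h_def mult.assoc)
  hence syE: "sy E h = 1" using sy_cong_mod[OF Em, of h 1] by simp
  have syD: "sy D h = - 1"
    using k by (simp add: DE(1) sy_mult_left sy_power_left vm Em syv syE lead_coeff_power)
  have nv: "\<not> v dvd h" using sy_place_eq_0_iff[OF v, of h] syv by simp
  \<comment> \<open>\<open>h\<close> is a unit modulo \<open>D\<close>: it can be cancelled modulo
    \<open>E\<close>, where it is 1, and modulo \<open>v ^ k\<close>, as \<open>v\<close> does not
    divide it.\<close>
  have cancel: "D dvd x" if "D dvd h * x" for x
  proof -
    have "E dvd h * x" using that DE(1) by (meson dvd_mult_right)
    moreover have "h * x = E * (b * (c - 1) * x) + x" by (simp add: h_def algebra_simps)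
    ultimately have "E dvd x" by (metis dvd_add_right_iff dvd_triv_left)
    then obtain t where t: "x = E * t" by (elim dvdE)
    have "v ^ k dvd h * x" using that DE(1) by (meson dvd_mult_left)
    hence "v ^ k dvd x" by (rule place_power_dvd_cancel[OF v nv])
    hence "v ^ k dvd t" unfolding t by (rule place_power_dvd_cancel[OF v DE(2)])
    thus ?thesis unfolding DE(1) t by (simp add: mult.commute mult_dvd_mono)
  qed
  have D0: "D \<noteq> 0" using D by auto
  have "bij_betw (\<lambda>r. (h * r) mod D) (polys_lt ?e) (polys_lt ?e)"
    by (rule bij_betw_mult_mod[OF D0 cancel])
  hence "(\<Sum>r\<in>polys_lt ?e. sy D r) = (\<Sum>r\<in>polys_lt ?e. sy D ((h * r) mod D))"
    by (rule sum.reindex_bij_betw[symmetric])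
  also have "\<dots> = (\<Sum>r\<in>polys_lt ?e. - sy D r)"
    by (simp add: sy_mod sy_mult_right D syD)
  finally show ?thesis by (simp add: sum_negf)
qed

lemma sum_monics_periodic:
  fixes D :: "'a poly" and w :: "'a poly \<Rightarrow> real"
  assumes D: "monic D" and n: "degree D \<le> n"
    and per: "\<And>k r. w (D * k + r) = w r"
  shows "(\<Sum>f\<in>monics n. w f) = real (card (monics (n - degree D) :: 'a poly set)) *
      (\<Sum>r\<in>polys_lt (degree D). w r)"
proof -
  have "D \<in> monics (degree D)" using D by (simp add: monics_def)
  from sum.reindex_bij_betw[OF bij_betw_divmod[OF this n], of w]
  have "(\<Sum>f\<in>monics n. w f) = (\<Sum>(k, r)\<in>(monics (n - degree D) :: 'a poly set) \<times> polys_lt (degree D). w r)"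
    by (simp add: case_prod_unfold per)
  also have "\<dots> = (\<Sum>k\<in>(monics (n - degree D) :: 'a poly set). \<Sum>r\<in>polys_lt (degree D). w r)"
    by (rule sum.cartesian_product[symmetric])
  finally show ?thesis by simp
qed

lemma sum_sy_right_eq_0:
  fixes D :: "'a poly"
  assumes D: "monic D" and ns: "\<And>h. D \<noteq> h\<^sup>2" and n: "degree D \<le> n"
  shows "(\<Sum>f\<in>monics n. sy D f) = 0"
proof -
  have "sy D (D * k + r) = sy D r" for k r by (rule sy_cong_mod[OF D]) simp
  thus ?thesis using sum_monics_periodic[OF D n, of "sy D"] sum_sy_residues_eq_0[OF D ns] by simp
qed

text \<open>Reciprocity moves \<open>D\<close> to the first argument; the sign depends only on the
  degrees and is therefore common to all terms.\<close>

lemma sum_sy_left_eq_0: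
  fixes D :: "'a poly"
  assumes D: "monic D" and ns: "\<And>h. D \<noteq> h\<^sup>2" and n: "degree D \<le> n"
  shows "(\<Sum>f\<in>monics n. sy f D) = 0"
proof -
  have "(\<Sum>f\<in>monics n. sy f D) = (\<Sum>f\<in>monics n. leg (- 1) ^ (n * degree D) * sy D f)"
  proof (rule sum.cong)
    fix f :: "'a poly" assume "f \<in> monics n"
    hence "monic f" "degree f = n" by (auto simp: monics_def)
    thus "sy f D = leg (- 1) ^ (n * degree D) * sy D f" using sy_reciprocity[OF _ D] by metis
  qed simp
  also have "\<dots> = 0" using sum_sy_right_eq_0[OF assms] by (simp flip: sum_distrib_left)
  finally show ?thesis .
qed

end

subsection \<open>Character sums modulo a place of even degree\<close>

lemma bij_betw_smult_monics:
  "bij_betw (\<lambda>(c, f). smult c f) ((UNIV - {0}) \<times> monics m) (polys_lt (Suc m) - polys_lt m :: 'a::field poly set)"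
proof (rule bij_betw_byWitness[where f' = "\<lambda>f. (lead_coeff f, smult (inverse (lead_coeff f)) f)"])
  show "(\<lambda>(c, f). smult c f) ` ((UNIV - {0}) \<times> monics m) \<subseteq> polys_lt (Suc m) - (polys_lt m :: 'a poly set)"
    by (auto simp: polys_lt_def monics_def)
  show "(\<lambda>f. (lead_coeff f, smult (inverse (lead_coeff f)) f)) ` (polys_lt (Suc m) - polys_lt m)
      \<subseteq> (UNIV - {0}) \<times> (monics m :: 'a poly set)"
  proof (rule image_subsetI)
    fix f :: "'a poly" assume f: "f \<in> polys_lt (Suc m) - polys_lt m"
    hence f0: "f \<noteq> 0" and d: "degree f = m" by (auto simp: polys_lt_def)
    have "coeff f m \<noteq> 0" using f0 d by auto
    thus "(lead_coeff f, smult (inverse (lead_coeff f)) f) \<in> (UNIV - {0}) \<times> monics m"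
      using d by (simp add: monics_def)
  qed
qed (auto simp: monics_def polys_lt_def)

text \<open>The space is the direct sum of the kernel of \<open>l\<close> and the line through
  \<open>y0\<close>.\<close>

lemma card_kernel_polys_lt:
  fixes l :: "'a::{field,finite} poly \<Rightarrow> 'a"
  assumes add: "\<And>f g. l (f + g) = l f + l g" and smult: "\<And>c f. l (smult c f) = c * l f"
    and y0: "y0 \<in> polys_lt k" "l y0 \<noteq> 0"
  shows "card {y \<in> polys_lt k. l y = 0} * CARD('a) = CARD('a) ^ k"
proof -
  let ?K = "{y \<in> polys_lt k. l y = 0}"
  let ?c = "\<lambda>y. l y / l y0"
  have dif: "l (f - g) = l f - l g" for f g
    using add[of "f - g" g] by (simp add: algebra_simps)
  have "bij_betw (\<lambda>(y, c). y + smult c y0) (?K \<times> UNIV) (polys_lt k)"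
    by (rule bij_betw_byWitness[where f' = "\<lambda>y. (y - smult (?c y) y0, ?c y)"])
      (use y0 in \<open>auto simp: add smult dif polys_lt_add polys_lt_diff polys_lt_smult\<close>)
  from bij_betw_same_card[OF this] show ?thesis
    by (simp add: card_cartesian_product card_polys_lt)
qed

definition places_deg :: "nat \<Rightarrow> 'a::{field,finite} poly set" where
  "places_deg d = {v \<in> finite_places. degree v = d}"

lemma places_deg_subset: "places_deg d \<subseteq> monics d"
  by (auto simp: places_deg_def dest: place_monic)

lemma finite_places_deg [simp]: "finite (places_deg d :: 'a::{field,finite} poly set)"
  by (rule finite_subset[OF places_deg_subset]) simp

lemma card_places_deg: "card (places_deg d :: 'a::{field,finite} poly set) \<le> CARD('a) ^ d"
  using card_mono[OF finite_monics places_deg_subset] by (simp add: card_monics)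

lemma place_not_square: "v \<in> finite_places \<Longrightarrow> v \<noteq> h\<^sup>2" for v :: "'a::{field,finite} poly"
proof
  assume v: "v \<in> finite_places" and eq: "v = h\<^sup>2"
  have "irreducible v" using v by (simp add: finite_places_def)
  hence "is_unit h" using irreducibleD[of v h h] eq by (auto simp: power2_eq_square)
  hence "is_unit v" unfolding eq power2_eq_square by (rule is_unit_mult_iff[THEN iffD2, OF conjI]) fact
  thus False using \<open>irreducible v\<close> by (simp add: irreducible_def)
qed

text \<open>All polynomials of degree below \<open>m\<close> are taken, not only the monic ones:
  this range is a vector space, so it has an orthogonal complement in the functional
  equation.\<close>

definition interval_sum :: "'a::{field,finite} poly \<Rightarrow> nat \<Rightarrow> real" where
  "interval_sum v m = (\<Sum>f\<in>polys_lt m. sy v f)"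

definition monic_sum :: "'a::{field,finite} poly \<Rightarrow> nat \<Rightarrow> real" where
  "monic_sum v m = (\<Sum>f\<in>monics m. sy v f)"

definition sqfree_sum :: "'a::{field,finite} poly \<Rightarrow> nat \<Rightarrow> real" where
  "sqfree_sum v m = (\<Sum>f\<in>sqfree_monics m. sy v f)"

definition coprime_count :: "'a::{field,finite} poly \<Rightarrow> nat \<Rightarrow> nat" where
  "coprime_count v m = card {Q \<in> sqfree_monics m. \<not> v dvd Q}"

context odd_field
begin

section \<open>Vanishing and functional equation at one place\<close>

lemma monic_sum_eq_0: "v \<in> finite_places \<Longrightarrow> m \<ge> degree v \<Longrightarrow> monic_sum v m = 0" for v :: "'a poly"
  unfolding monic_sum_def
  by (rule sum_sy_right_eq_0) (auto simp: finite_places_def[symmetric] place_not_square, auto simp: finite_places_def)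

lemma interval_sum_degree: "v \<in> finite_places \<Longrightarrow> interval_sum v (degree v) = 0" for v :: "'a poly"
  unfolding interval_sum_def
  by (rule sum_sy_residues_eq_0) (auto simp: finite_places_def[symmetric] place_not_square, auto simp: finite_places_def)

text \<open>A constant enters the symbol with exponent \<open>degree v\<close>, so an even degree
  makes the symbol blind to leading coefficients.\<close>

lemma sy_smult_even:
  fixes v :: "'a poly"
  assumes "monic v" "even (degree v)" "c \<noteq> 0"
  shows "sy v (smult c f) = sy v f"
proof -
  obtain k where "degree v = 2 * k" using assms(2) by (elim evenE)
  hence "leg c ^ degree v = 1" using leg_nonzero_square[OF assms(3)] by (simp add: power_mult)
  thus ?thesis by (simp add: sy_smult[OF assms(1)])
qed

lemma interval_sum_0 [simp]: "v \<in> finite_places \<Longrightarrow> interval_sum v 0 = 0" for v :: "'a poly"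
  by (simp add: interval_sum_def sy_place_eq_0_iff)

lemma interval_sum_Suc:
  fixes v :: "'a poly"
  assumes vm: "monic v" and e: "even (degree v)"
  shows "interval_sum v (Suc m) = interval_sum v m + (real CARD('a) - 1) * monic_sum v m"
proof -
  have "interval_sum v (Suc m) = interval_sum v m + (\<Sum>f\<in>polys_lt (Suc m) - polys_lt m. sy v f)"
    unfolding interval_sum_def by (subst sum.subset_diff[OF polys_lt_mono[of m "Suc m"]]) auto
  also have "(\<Sum>f\<in>polys_lt (Suc m) - polys_lt m. sy v f) =
      (\<Sum>(c, f)\<in>(UNIV - {0}) \<times> monics m. sy v (smult c f))"
    using sum.reindex_bij_betw[OF bij_betw_smult_monics, of "sy v" m] by (simp add: case_prod_unfold)
  also have "\<dots> = (\<Sum>c\<in>UNIV - {0 :: 'a}. \<Sum>f\<in>monics m. sy v (smult c f))"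
    by (rule sum.cartesian_product[symmetric])
  also have "\<dots> = (\<Sum>c\<in>UNIV - {0 :: 'a}. monic_sum v m)"
    unfolding monic_sum_def by (intro sum.cong refl sy_smult_even vm e) simp
  also have "\<dots> = (real CARD('a) - 1) * monic_sum v m"
    by (simp add: card_Diff_singleton of_nat_diff)
  finally show ?thesis .
qed

text \<open>
  Functional equation. Under the pairing \<open>(x, y) \<mapsto> \<ell>(x y mod v)\<close>, where \<open>\<ell>\<close> takes the coefficient
  of \<open>X\<^bsup>d-1\<^esup>\<close>, the polynomials of degree less than \<open>m\<close> and those of degree less than \<open>d - m\<close> are
  orthogonal complements of each other. Since the character is trivial on constants, the indicator function of
  \<open>\<ell> = 0\<close> can replace additive characters.
\<close>

lemma interval_sum_functional_equation:
  fixes v :: "'a poly"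
  assumes v: "v \<in> finite_places" and d: "degree v = Suc (m + r)"
  shows "(real CARD('a) - 1) * real CARD('a) ^ r * interval_sum v m =
    interval_sum v (m + r) * interval_sum v (Suc r)"
proof -
  let ?q = "real CARD('a)" and ?d = "Suc (m + r)"
  have vm: "monic v" using v by (simp add: finite_places_def)
  define l where "l = (\<lambda>x y. coeff ((x * y) mod v) (m + r))"
  define t :: "'a \<Rightarrow> real" where "t = (\<lambda>c. if c = 0 then 1 else 0)"
  have l_add: "l x (f + g) = l x f + l x g" for x f g
    by (simp add: l_def distrib_left poly_mod_add_left)
  have l_smult: "l x (smult c f) = c * l x f" for x c f
    by (simp add: l_def mod_smult_left)
  \<comment> \<open>Substitute \<open>z = x * y mod v\<close>, which permutes the residues and
    multiplies the symbol by \<open>sy v y\<close>; the condition on \<open>l\<close> then says that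
    \<open>z\<close> has degree below \<open>m + r = degree v - 1\<close>.\<close>
  have Z: "(\<Sum>x\<in>polys_lt ?d. t (l x y) * sy v x) = sy v y * interval_sum v (m + r)"
    if y: "y \<in> polys_lt (Suc r)" for y
  proof (cases "y = 0")
    case True
    thus ?thesis using interval_sum_degree[OF v] sy_place_eq_0_iff[OF v, of 0] d
      by (simp add: l_def t_def interval_sum_def)
  next
    case False
    have nd: "\<not> v dvd y"
    proof
      assume "v dvd y"
      hence "degree v \<le> degree y" using False by (rule dvd_imp_degree_le)
      thus False using y False d by (auto simp: polys_lt_def)
    qed
    have sq: "sy v y * sy v y = 1" using sy_place_square[OF v, of y] nd by (simp add: power2_eq_square)
    have "t (l x y) * sy v x = sy v y * (t (coeff ((y * x) mod v) (m + r)) * sy v ((y * x) mod v))" for x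
    proof -
      have "sy v y * (t (coeff ((y * x) mod v) (m + r)) * sy v ((y * x) mod v)) =
          t (l x y) * (sy v y * sy v y * sy v x)"
        by (simp add: l_def sy_mod[OF vm] sy_mult_right[OF vm] mult.commute[of y])
      thus ?thesis by (simp add: sq)
    qed
    hence "(\<Sum>x\<in>polys_lt ?d. t (l x y) * sy v x) =
        sy v y * (\<Sum>x\<in>polys_lt ?d. t (coeff ((y * x) mod v) (m + r)) * sy v ((y * x) mod v))"
      by (simp only: sum_distrib_left)
    also have "(\<Sum>x\<in>polys_lt ?d. t (coeff ((y * x) mod v) (m + r)) * sy v ((y * x) mod v)) =
        (\<Sum>z\<in>polys_lt ?d. t (coeff z (m + r)) * sy v z)"
      using sum.reindex_bij_betw[OF bij_betw_mult_mod_place[OF v nd], of "\<lambda>z. t (coeff z (m + r)) * sy v z"]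
      by (simp only: d)
    also have "\<dots> = (\<Sum>z\<in>polys_lt (m + r). sy v z)"
    proof (rule sum.mono_neutral_cong_right)
      show "\<forall>z\<in>polys_lt ?d - polys_lt (m + r). t (coeff z (m + r)) * sy v z = 0"
      proof
        fix z :: "'a poly" assume z: "z \<in> polys_lt ?d - polys_lt (m + r)"
        then obtain i where i: "i \<ge> m + r" "coeff z i \<noteq> 0" by (auto simp: polys_lt_coeff)
        hence "i = m + r" using z by (metis DiffD1 le_antisym not_less_eq_eq polys_lt_coeff)
        thus "t (coeff z (m + r)) * sy v z = 0" using i by (simp add: t_def)
      qed
    qed (auto simp: polys_lt_coeff t_def)
    finally show ?thesis by (simp add: interval_sum_def)
  qed
  \<comment> \<open>The number of \<open>y\<close> orthogonal to \<open>x\<close>: all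
    \<open>q^(r + 1)\<close> of them if \<open>x\<close> has degree below \<open>m\<close>, and
    otherwise the \<open>q^r\<close> points of a hyperplane.\<close>
  have N: "(\<Sum>y\<in>polys_lt (Suc r). t (l x y)) = ?q ^ r + (if x \<in> polys_lt m then (?q - 1) * ?q ^ r else 0)"
    if x: "x \<in> polys_lt ?d" for x
  proof (cases "x \<in> polys_lt m")
    case True
    have "l x y = 0" if y: "y \<in> polys_lt (Suc r)" for y
    proof (cases "x = 0 \<or> y = 0")
      case False
      hence "degree (x * y) < m + r" using True y by (auto simp: polys_lt_def degree_mult_eq)
      thus ?thesis using d by (simp add: l_def mod_poly_less coeff_eq_0)
    qed (auto simp: l_def)
    hence "(\<Sum>y\<in>polys_lt (Suc r). t (l x y)) = (\<Sum>y\<in>(polys_lt (Suc r) :: 'a poly set). 1)"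
      by (intro sum.cong) (auto simp: t_def)
    also have "\<dots> = ?q ^ Suc r" by (simp add: card_polys_lt)
    finally show ?thesis using True by (simp add: algebra_simps)
  next
    case False
    hence x0: "x \<noteq> 0" and e: "m \<le> degree x" "degree x \<le> m + r" using x by (auto simp: polys_lt_def)
    \<comment> \<open>This shifts \<open>x\<close> to degree exactly \<open>degree v - 1\<close>, so
      that \<open>l\<close> returns its leading coefficient.\<close>
    let ?y = "monom 1 (m + r - degree x) :: 'a poly"
    have y: "?y \<in> polys_lt (Suc r)" using e by (auto simp: polys_lt_def degree_monom_eq)
    have dxy: "degree (x * ?y) = m + r" using x0 e by (simp add: degree_mult_eq degree_monom_eq)
    have "lead_coeff (x * ?y) = lead_coeff x" by (simp only: lead_coeff_mult lead_coeff_monom mult_1_right)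
    moreover have "(x * ?y) mod v = x * ?y" using dxy d by (simp add: mod_poly_less)
    ultimately have "l x ?y \<noteq> 0" using x0 dxy by (simp add: l_def)
    from card_kernel_polys_lt[of "l x", OF l_add l_smult y this]
    have "card {y \<in> polys_lt (Suc r). l x y = 0} = CARD('a) ^ r" by simp
    moreover have "(\<Sum>y\<in>polys_lt (Suc r). t (l x y)) = real (card {y \<in> polys_lt (Suc r). l x y = 0})"
      unfolding t_def by (simp flip: sum.inter_filter)
    ultimately show ?thesis using False by simp
  qed
  \<comment> \<open>Evaluate the sum over orthogonal pairs in both orders. The share
    \<open>q^r\<close> common to all \<open>x\<close> drops out, since the complete sum of the
    symbol vanishes.\<close>
  have "interval_sum v (m + r) * interval_sum v (Suc r) =
      (\<Sum>y\<in>polys_lt (Suc r). \<Sum>x\<in>polys_lt ?d. t (l x y) * sy v x)"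
    unfolding interval_sum_def[of v "Suc r"] sum_distrib_left
    by (rule sum.cong[OF refl]) (subst Z, assumption, rule mult.commute)
  also have "\<dots> = (\<Sum>x\<in>polys_lt ?d. (\<Sum>y\<in>polys_lt (Suc r). t (l x y)) * sy v x)"
    by (subst sum.swap) (simp only: sum_distrib_right)
  also have "\<dots> = (\<Sum>x\<in>polys_lt ?d. ?q ^ r * sy v x + (if x \<in> polys_lt m then (?q - 1) * ?q ^ r * sy v x else 0))"
    by (intro sum.cong refl) (simp add: N distrib_right)
  also have "\<dots> = ?q ^ r * interval_sum v ?d + (\<Sum>x\<in>polys_lt ?d \<inter> polys_lt m. (?q - 1) * ?q ^ r * sy v x)"
    by (simp add: sum.distrib sum_distrib_left interval_sum_def sum.inter_restrict)
  also have "polys_lt ?d \<inter> polys_lt m = (polys_lt m :: 'a poly set)"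
    using polys_lt_mono[of m ?d] by auto
  also have "(\<Sum>x\<in>polys_lt m. (?q - 1) * ?q ^ r * sy v x) = (?q - 1) * ?q ^ r * interval_sum v m"
    by (simp add: interval_sum_def sum_distrib_left)
  finally show ?thesis using interval_sum_degree[OF v] d by simp
qed

text \<open>In the functional equation the factor \<open>interval_sum v (m + r)\<close> has length
  \<open>d - 1\<close> whatever \<open>m\<close> is. Its absolute value is computed once and divided
  out, which leaves a reflection between \<open>m\<close> and \<open>d - m\<close>.\<close>

lemma abs_interval_sum_reflect:
  fixes v :: "'a poly"
  assumes v: "v \<in> finite_places" and d: "degree v = d" and e: "even d" and m: "m \<le> d"
  shows "sqrt (real CARD('a)) ^ (2 * (d - m)) * \<bar>interval_sum v m\<bar> =
      sqrt (real CARD('a)) ^ d * \<bar>interval_sum v (d - m)\<bar>"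
proof (cases "m = d")
  case True
  thus ?thesis using interval_sum_degree[OF v] d v by simp
next
  case False
  let ?q = "real CARD('a)"
  have q: "?q > 1" using card_field_gt_1[where 'a='a] by simp
  obtain k' where k': "d = 2 * k'" using e by (elim evenE)
  have "d > 0" using place_degree_pos[OF v] d by simp
  then obtain k where "k' = Suc k" using k' by (cases k') auto
  hence k: "d = Suc (Suc (2 * k))" using k' by simp
  have "monic_sum v 0 = 1" by (simp add: monic_sum_def)
  hence U1: "interval_sum v (Suc 0) = ?q - 1"
    using interval_sum_Suc[of v 0] e d v by (simp add: finite_places_def)
  \<comment> \<open>With \<open>m = 1\<close> and \<open>r = d - 2\<close> both factors on the right
    are the sum of length \<open>d - 1\<close>, so its square is known.\<close>
  have "(?q - 1) * ?q ^ (2 * k) * (?q - 1) = interval_sum v (Suc (2 * k)) * interval_sum v (Suc (2 * k))"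
    using interval_sum_functional_equation[OF v, of "Suc 0" "2 * k"] d k by (simp add: U1)
  moreover have "?q ^ (2 * k) = ?q ^ k * ?q ^ k" by (simp add: mult_2 power_add)
  ultimately have "\<bar>interval_sum v (Suc (2 * k))\<bar>\<^sup>2 = ((?q - 1) * ?q ^ k)\<^sup>2"
    by (simp add: power2_eq_square mult_ac)
  hence U: "\<bar>interval_sum v (Suc (2 * k))\<bar> = (?q - 1) * ?q ^ k"
    by (rule power2_eq_imp_eq) (use q in auto)
  obtain r where r: "d = Suc (m + r)" using False m less_iff_Suc_add[of m d] by auto
  have mr: "m + r = Suc (2 * k)" using r k by simp
  have "\<bar>(?q - 1) * ?q ^ r * interval_sum v m\<bar> = \<bar>interval_sum v (Suc (2 * k)) * interval_sum v (Suc r)\<bar>"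
    using interval_sum_functional_equation[OF v, of m r] r d mr by simp
  hence "(?q - 1) * (?q ^ r * \<bar>interval_sum v m\<bar>) = (?q - 1) * (?q ^ k * \<bar>interval_sum v (Suc r)\<bar>)"
    using q by (simp add: abs_mult U mult.assoc)
  hence "?q ^ r * \<bar>interval_sum v m\<bar> = ?q ^ k * \<bar>interval_sum v (Suc r)\<bar>" using q by simp
  hence "?q ^ Suc r * \<bar>interval_sum v m\<bar> = ?q ^ Suc k * \<bar>interval_sum v (Suc r)\<bar>" by simp
  moreover have "d - m = Suc r" using r by simp
  moreover have "sqrt ?q ^ d = ?q ^ Suc k" "sqrt ?q ^ (2 * Suc r) = ?q ^ Suc r"
    by (simp_all add: k power_mult)
  ultimately show ?thesis by (simp only:)
qed

section \<open>Bounds on average over the places of one degree\<close>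

lemma mean_square_monic_sum:
  assumes m: "2 * m \<le> d"
  shows "(\<Sum>v\<in>(places_deg d :: 'a poly set). (monic_sum v m)\<^sup>2) \<le> (real m + 1) * real CARD('a) ^ (m + d)"
proof -
  have "(\<Sum>v\<in>(places_deg d :: 'a poly set). (monic_sum v m)\<^sup>2) \<le>
      (\<Sum>f\<in>(monics d :: 'a poly set). (monic_sum f m)\<^sup>2)"
    by (rule sum_mono2) (use places_deg_subset in auto)
  also have "\<dots> = (\<Sum>f\<in>(monics d :: 'a poly set). \<Sum>Q\<in>monics m. \<Sum>R\<in>monics m. sy f (Q * R))"
  proof (rule sum.cong)
    fix f :: "'a poly" assume "f \<in> monics d"
    hence "monic f" by (auto simp: monics_def)
    thus "(monic_sum f m)\<^sup>2 = (\<Sum>Q\<in>monics m. \<Sum>R\<in>monics m. sy f (Q * R))"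
      by (simp add: monic_sum_def power2_eq_square sum_product sy_mult_right)
  qed simp
  also have "\<dots> = (\<Sum>Q\<in>monics m. \<Sum>R\<in>monics m. \<Sum>f\<in>(monics d :: 'a poly set). sy f (Q * R))"
    by (rule trans[OF sum.swap]) (intro sum.cong refl sum.swap)
  also have "\<dots> \<le> (\<Sum>Q\<in>monics m. \<Sum>R\<in>monics m. if \<exists>h :: 'a poly. Q * R = h\<^sup>2 then real CARD('a) ^ d else 0)"
  proof (intro sum_mono)
    fix Q R :: "'a poly" assume QR: "Q \<in> monics m" "R \<in> monics m"
    show "(\<Sum>f\<in>(monics d :: 'a poly set). sy f (Q * R)) \<le>
        (if \<exists>h :: 'a poly. Q * R = h\<^sup>2 then real CARD('a) ^ d else 0)"
    proof (cases "\<exists>h :: 'a poly. Q * R = h\<^sup>2")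
      case True
      have "(\<Sum>f\<in>(monics d :: 'a poly set). sy f (Q * R)) \<le> (\<Sum>f\<in>(monics d :: 'a poly set). 1)"
        by (intro sum_mono order_trans[OF abs_ge_self abs_sy_le_1])
      thus ?thesis using True by (simp add: card_monics)
    next
      case False
      \<comment> \<open>This is where \<open>2 * m \<le> d\<close> enters: the modulus
        \<open>Q * R\<close> has degree at most \<open>d\<close>, so \<open>f\<close> runs over
        complete residue systems.\<close>
      have "Q * R \<in> monics (m + m)" using QR by (rule monics_mult)
      hence "monic (Q * R)" "degree (Q * R) = 2 * m" by (auto simp: monics_def)
      thus ?thesis using sum_sy_left_eq_0[of "Q * R" d] False m by auto
    qed
  qed
  also have "\<dots> = (\<Sum>(Q, R)\<in>{(Q, R). Q \<in> monics m \<and> R \<in> monics m \<and> (\<exists>h :: 'a poly. Q * R = h\<^sup>2)}. real CARD('a) ^ d)"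
    by (subst sum.cartesian_product, rule sum.mono_neutral_cong_right) (auto split: if_splits)
  also have "\<dots> = real (card {(Q, R). Q \<in> monics m \<and> R \<in> monics m \<and> (\<exists>h :: 'a poly. Q * R = h\<^sup>2)}) *
      real CARD('a) ^ d"
    by (simp add: case_prod_unfold)
  also have "\<dots> \<le> real ((m + 1) * CARD('a) ^ m) * real CARD('a) ^ d"
    by (intro mult_right_mono of_nat_mono card_square_pairs) auto
  finally show ?thesis by (simp add: power_add algebra_simps)
qed

lemma sum_abs_monic_sum_short:
  assumes m: "2 * m \<le> d"
  shows "(\<Sum>v\<in>(places_deg d :: 'a poly set). \<bar>monic_sum v m\<bar>) \<le>
      (real m + 1) * real CARD('a) ^ d * sqrt (real CARD('a)) ^ m"
proof -
  let ?q = "real CARD('a)" and ?P = "places_deg d :: 'a poly set" and ?s = "sqrt (real CARD('a))"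
  define t where "t = ?s ^ m"
  have q: "?q > 1" using card_field_gt_1[where 'a='a] by simp
  have t: "t > 0" using q by (simp add: t_def)
  have tt: "t * t = ?q ^ m" by (simp add: t_def flip: power_mult_distrib)
  \<comment> \<open>The inequality between the means, with \<open>t = q^(m/2)\<close> the expected
    size of a monic sum, does the work of Cauchy-Schwarz.\<close>
  have "t * (2 * \<bar>x\<bar>) \<le> x\<^sup>2 + ?q ^ m" for x
    using zero_le_power2[of "\<bar>x\<bar> - t"] tt by (simp add: power2_eq_square algebra_simps)
  hence "(\<Sum>v\<in>?P. t * (2 * \<bar>monic_sum v m\<bar>)) \<le> (\<Sum>v\<in>?P. (monic_sum v m)\<^sup>2 + ?q ^ m)"
    by (intro sum_mono)
  hence "t * (2 * (\<Sum>v\<in>?P. \<bar>monic_sum v m\<bar>)) \<le> (\<Sum>v\<in>?P. (monic_sum v m)\<^sup>2) + real (card ?P) * ?q ^ m"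
    by (simp add: sum.distrib sum_distrib_left)
  also have "\<dots> \<le> (real m + 1) * ?q ^ (m + d) + ?q ^ d * ?q ^ m"
  proof (intro add_mono mult_right_mono mean_square_monic_sum[OF m])
    have "real (card ?P) \<le> real (CARD('a) ^ d)" using card_places_deg by (rule of_nat_mono)
    thus "real (card ?P) \<le> ?q ^ d" by simp
  qed simp
  also have "\<dots> \<le> 2 * ((real m + 1) * ?q ^ d * ?q ^ m)"
  proof -
    have "1 * (?q ^ d * ?q ^ m) \<le> (real m + 1) * (?q ^ d * ?q ^ m)" by (intro mult_right_mono) auto
    thus ?thesis by (simp add: power_add mult_ac)
  qed
  also have "\<dots> = t * (2 * ((real m + 1) * ?q ^ d * t))" by (simp add: tt[symmetric] mult_ac)
  finally show ?thesis using t by (simp add: t_def)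
qed

text \<open>Reflection reduces to length \<open>d - m \<le> d/2\<close>, where the sum is made of
  short monic sums. The factor \<open>q^(m - d/2)\<close> of the reflection times their size
  \<open>q^((d - m)/2)\<close> is again \<open>q^(m/2)\<close>.\<close>

lemma sum_abs_interval_sum_long:
  assumes e: "even d" and m: "m \<le> d" "d \<le> 2 * m"
  shows "(\<Sum>v\<in>(places_deg d :: 'a poly set). \<bar>interval_sum v m\<bar>)
    \<le> (real CARD('a) - 1) * (real d + 1)\<^sup>2 * real CARD('a) ^ d * sqrt (real CARD('a)) ^ m"
proof -
  let ?q = "real CARD('a)" and ?P = "places_deg d :: 'a poly set" and ?s = "sqrt (real CARD('a))"
  have q: "?q > 1" using card_field_gt_1[where 'a='a] by simp
  have s: "?s > 1" using q by simp
  let ?k = "d - m"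
  have U: "\<bar>interval_sum v k\<bar> \<le> (?q - 1) * (\<Sum>j<k. \<bar>monic_sum v j\<bar>)" if "v \<in> ?P" for v k
  proof (induction k)
    case 0
    thus ?case using that by (simp add: places_deg_def)
  next
    case (Suc k)
    have "interval_sum v (Suc k) = interval_sum v k + (?q - 1) * monic_sum v k"
      using that e by (intro interval_sum_Suc) (auto simp: places_deg_def finite_places_def)
    hence "\<bar>interval_sum v (Suc k)\<bar> \<le> \<bar>interval_sum v k\<bar> + (?q - 1) * \<bar>monic_sum v k\<bar>"
      using q abs_triangle_ineq[of "interval_sum v k" "(?q - 1) * monic_sum v k"] by (simp add: abs_mult)
    thus ?case using Suc by (simp add: distrib_left)
  qed
  have "(\<Sum>v\<in>?P. \<bar>interval_sum v ?k\<bar>) \<le> (\<Sum>v\<in>?P. (?q - 1) * (\<Sum>j<?k. \<bar>monic_sum v j\<bar>))"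
    by (intro sum_mono U)
  also have "\<dots> = (?q - 1) * (\<Sum>j<?k. \<Sum>v\<in>?P. \<bar>monic_sum v j\<bar>)"
    by (subst sum.swap) (simp add: sum_distrib_left)
  also have "\<dots> \<le> (?q - 1) * (\<Sum>j<?k. (real d + 1) * ?q ^ d * ?s ^ ?k)"
  proof (intro mult_left_mono sum_mono)
    fix j assume j: "j \<in> {..<?k}"
    have "(\<Sum>v\<in>?P. \<bar>monic_sum v j\<bar>) \<le> (real j + 1) * ?q ^ d * ?s ^ j"
      using j m by (intro sum_abs_monic_sum_short) auto
    also have "\<dots> \<le> (real d + 1) * ?q ^ d * ?s ^ ?k"
      using j m s q by (intro mult_mono power_increasing) auto
    finally show "(\<Sum>v\<in>?P. \<bar>monic_sum v j\<bar>) \<le> (real d + 1) * ?q ^ d * ?s ^ ?k" .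
  qed (use q in simp)
  also have "\<dots> = (?q - 1) * (real ?k * ((real d + 1) * ?q ^ d * ?s ^ ?k))" by simp
  also have "\<dots> \<le> (?q - 1) * ((real d + 1) * ((real d + 1) * ?q ^ d * ?s ^ ?k))"
    using q by (intro mult_left_mono mult_right_mono) auto
  finally have A: "(\<Sum>v\<in>?P. \<bar>interval_sum v ?k\<bar>) \<le> (?q - 1) * (real d + 1)\<^sup>2 * ?q ^ d * ?s ^ ?k"
    by (simp add: power2_eq_square mult_ac)
  have "?s ^ (2 * ?k) * (\<Sum>v\<in>?P. \<bar>interval_sum v m\<bar>) = ?s ^ d * (\<Sum>v\<in>?P. \<bar>interval_sum v ?k\<bar>)"
    unfolding sum_distrib_left
    by (intro sum.cong refl abs_interval_sum_reflect) (use e m in \<open>auto simp: places_deg_def\<close>)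
  also have "\<dots> \<le> ?s ^ d * ((?q - 1) * (real d + 1)\<^sup>2 * ?q ^ d * ?s ^ ?k)"
    by (intro mult_left_mono A) simp
  also have "\<dots> = ?s ^ (2 * ?k) * ((?q - 1) * (real d + 1)\<^sup>2 * ?q ^ d * ?s ^ m)"
  proof -
    have "d + ?k = 2 * ?k + m" using m by simp
    hence "?s ^ d * ?s ^ ?k = ?s ^ (2 * ?k) * ?s ^ m" by (simp only: power_add[symmetric])
    thus ?thesis by (simp only: mult.assoc mult.left_commute[of "?s ^ d"] mult.left_commute[of "?s ^ (2 * ?k)"])
  qed
  finally show ?thesis using s by simp
qed

lemma sum_abs_monic_sum:
  assumes e: "even d"
  shows "(\<Sum>v\<in>(places_deg d :: 'a poly set). \<bar>monic_sum v m\<bar>)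
    \<le> 2 * (real d + 1)\<^sup>2 * real CARD('a) ^ d * sqrt (real CARD('a)) ^ (m + 1)"
proof -
  let ?q = "real CARD('a)" and ?P = "places_deg d :: 'a poly set" and ?s = "sqrt (real CARD('a))"
  have q: "?q > 1" using card_field_gt_1[where 'a='a] by simp
  have s: "?s > 1" using q by simp
  consider "2 * m \<le> d" | "m \<ge> d" | "m < d" "2 * m > d" by linarith
  thus ?thesis
  proof cases
    case 1
    have "(\<Sum>v\<in>?P. \<bar>monic_sum v m\<bar>) \<le> (real m + 1) * ?q ^ d * ?s ^ m"
      by (rule sum_abs_monic_sum_short[OF 1])
    also have "\<dots> \<le> (2 * (real d + 1)\<^sup>2) * ?q ^ d * ?s ^ (m + 1)"
    proof (intro mult_mono power_increasing)
      have "real m + 1 \<le> (real d + 1) * 1" using 1 by simp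
      also have "\<dots> \<le> (real d + 1) * (2 * (real d + 1))" by (intro mult_left_mono) auto
      finally show "real m + 1 \<le> 2 * (real d + 1)\<^sup>2" by (simp add: power2_eq_square algebra_simps)
    qed (use s q in auto)
    finally show ?thesis .
  next
    case 2
    have "(\<Sum>v\<in>?P. \<bar>monic_sum v m\<bar>) = 0"
      using monic_sum_eq_0 2 by (auto simp: places_deg_def intro!: sum.neutral)
    thus ?thesis using s q by simp
  next
    \<comment> \<open>Beyond the middle a monic sum is the difference of two consecutive interval
      sums divided by \<open>q - 1\<close>; the longer one has length \<open>m + 1\<close>, which
      explains the exponent in the bound.\<close>
    case 3
    have "(?q - 1) * (\<Sum>v\<in>?P. \<bar>monic_sum v m\<bar>) = (\<Sum>v\<in>?P. \<bar>interval_sum v (Suc m) - interval_sum v m\<bar>)"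
      unfolding sum_distrib_left
    proof (rule sum.cong)
      fix v assume "v \<in> ?P"
      hence "interval_sum v (Suc m) = interval_sum v m + (?q - 1) * monic_sum v m"
        using e by (intro interval_sum_Suc) (auto simp: places_deg_def finite_places_def)
      thus "(?q - 1) * \<bar>monic_sum v m\<bar> = \<bar>interval_sum v (Suc m) - interval_sum v m\<bar>"
        using q by (simp add: abs_mult)
    qed simp
    also have "\<dots> \<le> (\<Sum>v\<in>?P. \<bar>interval_sum v (Suc m)\<bar>) + (\<Sum>v\<in>?P. \<bar>interval_sum v m\<bar>)"
      unfolding sum.distrib[symmetric] by (intro sum_mono abs_triangle_ineq4)
    also have "\<dots> \<le> (?q - 1) * (2 * (real d + 1)\<^sup>2 * ?q ^ d * ?s ^ (m + 1))"
    proof -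
      have "(?q - 1) * (real d + 1)\<^sup>2 * ?q ^ d * ?s ^ m \<le> (?q - 1) * (real d + 1)\<^sup>2 * ?q ^ d * ?s ^ (m + 1)"
        using s q by (intro mult_left_mono power_increasing) auto
      thus ?thesis
        using sum_abs_interval_sum_long[OF e, of "Suc m"] sum_abs_interval_sum_long[OF e, of m] 3
        by (simp add: mult_ac)
    qed
    finally have "(?q - 1) * (\<Sum>v\<in>?P. \<bar>monic_sum v m\<bar>) \<le>
        (?q - 1) * (2 * (real d + 1)\<^sup>2 * ?q ^ d * ?s ^ (m + 1))" .
    thus ?thesis using q by simp
  qed
qed

end

subsection \<open>Averages over square-free polynomials\<close>

lemma card_sqfree_monics_sum:
  "real CARD('a::{field,finite}) ^ n =
    (\<Sum>k\<le>n div 2. real CARD('a) ^ k * real (card (sqfree_monics (n - 2 * k) :: 'a poly set)))"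
  using sum_monics_squarefree_decomp[of "\<lambda>_ :: 'a poly. 1" n] by (simp add: card_monics)

lemma sum_halves_shift:
  fixes F :: "nat \<Rightarrow> real"
  shows "(\<Sum>k\<le>Suc (Suc n) div 2. F k) = F 0 + (\<Sum>k\<le>n div 2. F (Suc k))"
proof -
  have "Suc (Suc n) div 2 = Suc (n div 2)" by simp
  thus ?thesis by (simp only: sum.atMost_Suc_shift)
qed

text \<open>In the decomposition of degree \<open>n \<ge> 2\<close> the terms with
  \<open>k \<ge> 1\<close> are \<open>q\<close> times the decomposition of degree
  \<open>n - 2\<close>, so the count is \<open>q^n - q * q^(n - 2)\<close>.\<close>

lemma card_sqfree_monics:
  "real (card (sqfree_monics n :: 'a::{field,finite} poly set)) =
    real CARD('a) ^ n - (if n \<ge> 2 then real CARD('a) ^ (n - 1) else 0)"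
proof -
  let ?q = "real CARD('a)"
  consider "n = 0" | "n = 1" | m where "n = Suc (Suc m)" by (metis One_nat_def not0_implies_Suc)
  thus ?thesis
  proof cases
    case 3
    have "?q ^ n = real (card (sqfree_monics n :: 'a poly set)) + ?q * ?q ^ m"
      unfolding card_sqfree_monics_sum[of n, where 'a='a] card_sqfree_monics_sum[of m, where 'a='a]
      by (simp only: 3 sum_halves_shift) (simp add: sum_distrib_left mult.assoc)
    thus ?thesis by (simp add: 3)
  qed (use card_sqfree_monics_sum[of n, where 'a='a] in auto)
qed

text \<open>Genus \<open>g\<close> takes the degrees \<open>2 * g + 2\<close> and
  \<open>2 * g + 1\<close> together; the two counts telescope to \<open>q^n - q^(n - 2)\<close> as
  soon as \<open>n \<ge> 3\<close>.\<close>

definition pair_count :: "nat \<Rightarrow> 'a::{field,finite} itself \<Rightarrow> real" where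
  "pair_count n _ = real (card (sqfree_monics n :: 'a poly set)) +
     (if n = 0 then 0 else real (card (sqfree_monics (n - 1) :: 'a poly set)))"

text \<open>Exact from \<open>n = 3\<close> on. Below that it deviates because every polynomial of
  degree 0 or 1 in the family is square-free.\<close>

lemma pair_count_approx:
  "\<bar>pair_count n TYPE('a::{field,finite}) - (real CARD('a) ^ n - real CARD('a) ^ n / (real CARD('a))\<^sup>2)\<bar>
    \<le> (if n \<ge> 3 then 0 else 2)"
proof -
  let ?q = "real CARD('a)"
  have q: "?q \<ge> 2" using card_field_gt_1[where 'a='a] by simp
  have i: "1 / ?q \<le> 1" "1 / ?q\<^sup>2 \<le> 1" "0 \<le> 1 / ?q" "0 \<le> 1 / ?q\<^sup>2"
    using q by (auto simp: divide_le_eq_1 one_le_power)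
  consider "n = 0" | "n = 1" | "n = 2" | m where "n = Suc (Suc (Suc m))"
    by (metis One_nat_def Suc_1 not0_implies_Suc)
  thus ?thesis
  proof cases
    case 1
    have "1 / ?q\<^sup>2 \<le> 2" using i by linarith
    thus ?thesis using 1 by (simp add: pair_count_def card_sqfree_monics abs_le_iff)
  next
    case 2
    have "?q / ?q\<^sup>2 = 1 / ?q" using q by (simp add: power2_eq_square)
    thus ?thesis using i 2 by (simp add: pair_count_def card_sqfree_monics abs_le_iff)
  next
    case 3
    thus ?thesis using q by (simp add: pair_count_def card_sqfree_monics)
  next
    case 4
    thus ?thesis using q by (simp add: pair_count_def card_sqfree_monics field_simps power2_eq_square)
  qed
qed

lemma pair_count_even:
  "pair_count (2 * g + 2) TYPE('a::{field,finite}) =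
    real CARD('a) ^ (2 * g + 2) - (if g = 0 then 0 else real CARD('a) ^ (2 * g))"
  by (cases g) (simp_all add: pair_count_def card_sqfree_monics)

lemma coprime_count_rec:
  fixes v :: "'a::{field,finite} poly"
  assumes v: "v \<in> finite_places" and d: "degree v = d"
  shows "real (card (sqfree_monics n :: 'a poly set)) =
    real (coprime_count v n) + (if n \<ge> d then real (coprime_count v (n - d)) else 0)"
proof -
  have "sqfree_monics n = {Q \<in> sqfree_monics n. \<not> v dvd Q} \<union> {Q \<in> sqfree_monics n. v dvd Q}" by auto
  hence "card (sqfree_monics n :: 'a poly set) =
      card ({Q \<in> sqfree_monics n. \<not> v dvd Q} \<union> {Q \<in> sqfree_monics n. v dvd Q})" by simp
  also have "\<dots> = coprime_count v n + card {Q \<in> sqfree_monics n. v dvd Q}"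
    unfolding coprime_count_def by (rule card_Un_disjoint) auto
  also have "card {Q \<in> sqfree_monics n. v dvd Q} = (if n \<ge> d then coprime_count v (n - d) else 0)"
  proof (cases "n \<ge> d")
    case True
    thus ?thesis using bij_betw_same_card[OF bij_betw_sqfree_dvd[OF v d True]]
      by (simp add: coprime_count_def)
  next
    case False
    have "{Q \<in> sqfree_monics n. v dvd Q} = {}"
      using False dvd_monics_degree_le place_monic[OF v] d by (auto simp: sqfree_monics_def)
    thus ?thesis using False by (simp only:) simp
  qed
  finally show ?thesis by simp
qed

definition coprime_pair_count :: "'a::{field,finite} poly \<Rightarrow> nat \<Rightarrow> real" where
  "coprime_pair_count v n = real (coprime_count v n) + (if n = 0 then 0 else real (coprime_count v (n - 1)))"

lemma coprime_pair_count_rec: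
  fixes v :: "'a::{field,finite} poly"
  assumes v: "v \<in> finite_places" and d: "degree v = d"
  shows "pair_count n TYPE('a) = coprime_pair_count v n + (if n \<ge> d then coprime_pair_count v (n - d) else 0)"
proof -
  have d1: "d \<ge> 1" using place_degree_pos[OF v] d by simp
  have e: "n - 1 - d = n - d - 1" by simp
  show ?thesis
    unfolding pair_count_def coprime_pair_count_def coprime_count_rec[OF v d, of n] coprime_count_rec[OF v d, of "n - 1"] e
    using d1 by (cases "n \<ge> d"; cases "n = d"; cases "n = 0") auto
qed

text \<open>Iterating the recursion produces an alternating geometric series of ratio
  \<open>- q^(-d)\<close>, hence the density \<open>q^d / (1 + q^d)\<close>. An error of at most 2
  enters only at arguments below 3, at most twice before the final step below \<open>d\<close>,
  which costs at most 3; so the bound is uniform in \<open>n\<close> and \<open>d\<close>.\<close>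

lemma coprime_pair_count_approx_aux:
  fixes v :: "'a::{field,finite} poly"
  assumes v: "v \<in> finite_places" and d: "degree v = d"
  defines "q \<equiv> real CARD('a)"
  shows "\<bar>coprime_pair_count v n - (q ^ n - q ^ n / q\<^sup>2) * (q ^ d / (1 + q ^ d))\<bar> \<le> 3 + 2 * real (min n 2)"
proof (induction n rule: less_induct)
  case (less n)
  let ?A = "pair_count n TYPE('a)" and ?k = "q ^ n - q ^ n / q\<^sup>2"
  have q: "q > 1" using card_field_gt_1[where 'a='a] by (simp add: q_def)
  have q0: "q > 0" using q by simp
  have d1: "d \<ge> 1" using place_degree_pos[OF v] d by simp
  have A: "\<bar>?A - ?k\<bar> \<le> (if n \<ge> 3 then 0 else 2)" using pair_count_approx[of n, where 'a='a]
    by (simp add: q_def)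
  have qd: "1 + q ^ d > 0" using q0 by (simp add: add_pos_nonneg)
  have "q ^ n / q\<^sup>2 \<le> q ^ n" "0 \<le> q ^ n / q\<^sup>2" using q
    by (auto simp: divide_le_eq one_le_power mult_le_cancel_left1)
  hence kn: "0 \<le> ?k" "?k \<le> q ^ n" by auto
  have gen: "K * (q ^ d / (1 + q ^ d)) = K - K / (1 + q ^ d)" for K
    using qd by (simp add: field_simps)
  have gen2: "(q ^ d * K) * (q ^ d / (1 + q ^ d)) + K * (q ^ d / (1 + q ^ d)) = q ^ d * K" for K
  proof -
    have "(q ^ d * K) * (q ^ d / (1 + q ^ d)) + K * (q ^ d / (1 + q ^ d)) =
        K * q ^ d * ((1 + q ^ d) / (1 + q ^ d))"
      by (simp only: add_divide_distrib distrib_left times_divide_eq_right) (simp add: mult_ac)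
    thus ?thesis using qd by (simp add: mult.commute)
  qed
  show ?case
  proof (cases "n \<ge> d")
    case False
    have "coprime_pair_count v n = ?A" using coprime_pair_count_rec[OF v d, of n] False by simp
    hence "coprime_pair_count v n - ?k * (q ^ d / (1 + q ^ d)) = (?A - ?k) + ?k / (1 + q ^ d)"
      by (simp only: gen)
    also have "\<bar>\<dots>\<bar> \<le> \<bar>?A - ?k\<bar> + \<bar>?k / (1 + q ^ d)\<bar>" by (rule abs_triangle_ineq)
    also have "\<bar>?k / (1 + q ^ d)\<bar> \<le> 1"
    proof -
      have "q ^ n \<le> q ^ d" using False q by (intro power_increasing) auto
      hence "?k \<le> 1 + q ^ d" using kn by simp
      thus ?thesis using kn qd by (simp add: divide_le_eq_1 abs_le_iff)
    qed
    finally show ?thesis using A by (auto split: if_splits)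
  next
    case True
    have "q ^ n = q ^ d * q ^ (n - d)" using True by (simp flip: power_add)
    hence e: "?k * (q ^ d / (1 + q ^ d)) + (q ^ (n - d) - q ^ (n - d) / q\<^sup>2) * (q ^ d / (1 + q ^ d)) = ?k"
      using gen2[of "q ^ (n - d) - q ^ (n - d) / q\<^sup>2"]
        by (simp only: right_diff_distrib times_divide_eq_right \<open>q ^ n = q ^ d * q ^ (n - d)\<close>)
    have "coprime_pair_count v n = ?A - coprime_pair_count v (n - d)"
      using coprime_pair_count_rec[OF v d, of n] True by simp
    hence "coprime_pair_count v n - ?k * (q ^ d / (1 + q ^ d)) =
        (?A - ?k) - (coprime_pair_count v (n - d) - (q ^ (n - d) - q ^ (n - d) / q\<^sup>2) * (q ^ d / (1 + q ^ d)))"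
      using e by linarith
    hence "\<bar>coprime_pair_count v n - ?k * (q ^ d / (1 + q ^ d))\<bar> \<le>
        \<bar>?A - ?k\<bar> + \<bar>coprime_pair_count v (n - d) - (q ^ (n - d) - q ^ (n - d) / q\<^sup>2) * (q ^ d / (1 + q ^ d))\<bar>"
      by (simp only: abs_triangle_ineq4)
    also have "\<dots> \<le> (if n \<ge> 3 then 0 else 2) + (3 + 2 * real (min (n - d) 2))"
      by (intro add_mono A less.IH) (use True d1 in auto)
    also have "\<dots> \<le> 3 + 2 * real (min n 2)" using d1 True by (auto simp: min_def)
    finally show ?thesis .
  qed
qed

text \<open>The constant is \<open>7 + 2\<close>: the preceding bound at its largest, and the
  replacement of \<open>q^n - q^(n - 2)\<close> by the true count.\<close>

lemma coprime_pair_count_approx: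
  fixes v :: "'a::{field,finite} poly"
  assumes v: "v \<in> finite_places" and d: "degree v = d"
  defines "q \<equiv> real CARD('a)"
  shows "\<bar>coprime_pair_count v n - pair_count n TYPE('a) * (1 - 1 / (1 + q ^ d))\<bar> \<le> 9"
proof -
  let ?A = "pair_count n TYPE('a)" and ?k = "q ^ n - q ^ n / q\<^sup>2"
  have qd: "1 + q ^ d > 0" by (simp add: q_def add_pos_nonneg)
  have t: "1 - 1 / (1 + q ^ d) = q ^ d / (1 + q ^ d)" using qd by (simp add: field_simps)
  have t1: "\<bar>q ^ d / (1 + q ^ d)\<bar> \<le> 1" using qd by (simp add: divide_le_eq_1 q_def)
  have "\<bar>coprime_pair_count v n - ?k * (q ^ d / (1 + q ^ d))\<bar> \<le> 3 + 2 * real (min n 2)"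
    using coprime_pair_count_approx_aux[OF v d] by (simp add: q_def)
  hence 1: "\<bar>coprime_pair_count v n - ?k * (q ^ d / (1 + q ^ d))\<bar> \<le> 7"
    by (auto simp: min_def split: if_splits)
  have A: "\<bar>?A - ?k\<bar> \<le> 2" using pair_count_approx[of n, where 'a='a] by (auto simp: q_def split: if_splits)
  have 2: "\<bar>(?A - ?k) * (q ^ d / (1 + q ^ d))\<bar> \<le> 2"
  proof -
    have "\<bar>?A - ?k\<bar> * \<bar>q ^ d / (1 + q ^ d)\<bar> \<le> 2 * 1" by (intro mult_mono A t1) auto
    thus ?thesis by (simp only: abs_mult mult_1_right)
  qed
  have "coprime_pair_count v n - ?A * (q ^ d / (1 + q ^ d)) =
      (coprime_pair_count v n - ?k * (q ^ d / (1 + q ^ d))) - (?A - ?k) * (q ^ d / (1 + q ^ d))"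
    by (simp only: left_diff_distrib)
  thus ?thesis unfolding t using 1 2 by linarith
qed

context odd_field
begin

section \<open>From monic sums to square-free sums\<close>

lemma sum_sy_square_monics:
  fixes v :: "'a poly"
  assumes v: "v \<in> finite_places" and d: "degree v = d"
  shows "(\<Sum>h\<in>monics k. (sy v h)\<^sup>2) = real CARD('a) ^ k - (if k \<ge> d then real CARD('a) ^ (k - d) else 0)"
proof -
  have vm: "v \<in> monics d" using place_monic[OF v] d by simp
  have "(\<Sum>h\<in>monics k. (sy v h)\<^sup>2) = (\<Sum>h\<in>monics k. 1 - (if v dvd h then 1 else 0))"
    by (intro sum.cong) (auto simp: sy_place_square[OF v])
  also have "\<dots> = real CARD('a) ^ k - real (card {h \<in> monics k. v dvd h})"
    by (simp add: sum_subtractf card_monics sum.If_cases Int_def)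
  also have "card {h \<in> monics k. v dvd h} = (if k \<ge> d then CARD('a) ^ (k - d) else 0)"
  proof (cases "k \<ge> d")
    case True
    thus ?thesis using bij_betw_same_card[OF bij_betw_mult_monics[OF vm True]] by (simp add: card_monics)
  next
    case False
    have "{h \<in> monics k. v dvd h} = {}"
      using False dvd_monics_degree_le[OF _ vm] by auto
    thus ?thesis using False by (simp only:) simp
  qed
  finally show ?thesis by simp
qed

lemma monic_sum_sqfree_decomp:
  fixes v :: "'a poly"
  assumes v: "v \<in> finite_places"
  shows "monic_sum v m = (\<Sum>k\<le>m div 2. (\<Sum>h\<in>monics k. (sy v h)\<^sup>2) * sqfree_sum v (m - 2 * k))"
proof -
  have "monic v" using v by (simp add: finite_places_def)
  thus ?thesis unfolding monic_sum_def sqfree_sum_def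
    by (intro sum_monics_squarefree_decomp sy_mult_right)
qed

text \<open>Coefficient form of \<open>S(u) * (1 - u^(2d)) = A(u) * (1 - q * u^2)\<close>, where
  \<open>A\<close> and \<open>S\<close> generate the monic and the square-free sums: the squares of
  polynomials prime to \<open>v\<close> have the generating function
  \<open>(1 - u^(2d)) / (1 - q * u^2)\<close>.\<close>

lemma sqfree_sum_rec:
  fixes v :: "'a poly"
  assumes v: "v \<in> finite_places" and d: "degree v = d"
  shows "sqfree_sum v m = (if m \<ge> 2 * d then sqfree_sum v (m - 2 * d) else 0) + monic_sum v m
    - (if m \<ge> 2 then real CARD('a) * monic_sum v (m - 2) else 0)"
proof -
  let ?q = "real CARD('a)"
  define b where "b = (\<lambda>k. ?q ^ k - (if k \<ge> d then ?q ^ (k - d) else 0))"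
  have d1: "d \<ge> 1" using place_degree_pos[OF v] d by simp
  have b0: "b 0 = 1" using d1 by (simp add: b_def)
  \<comment> \<open>The generating function of \<open>b\<close> is
    \<open>(1 - T^d) / (1 - q * T)\<close>, so multiplication by \<open>1 - q * T\<close> leaves
    only the indices 0 and \<open>d\<close>.\<close>
  have bs: "b (Suc k) - ?q * b k = (if Suc k = d then - 1 else 0)" for k
  proof -
    consider "Suc k < d" | "Suc k = d" | "Suc k > d" by linarith
    thus ?thesis
    proof cases
      case 3
      hence "Suc k - d = Suc (k - d)" by simp
      thus ?thesis using 3 by (simp add: b_def algebra_simps)
    qed (auto simp: b_def)
  qed
  have a: "monic_sum v n = (\<Sum>k\<le>n div 2. b k * sqfree_sum v (n - 2 * k))" for n
    unfolding monic_sum_sqfree_decomp[OF v] sum_sy_square_monics[OF v d] b_def ..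
  show ?thesis
  proof (cases "m \<ge> 2")
    case False
    hence "m div 2 = 0" by simp
    thus ?thesis using False d1 a[of m] b0 by simp
  next
    case True
    then obtain n where "m = 2 + n" using le_Suc_ex by blast
    hence n: "m = Suc (Suc n)" by simp
    have "monic_sum v m - ?q * monic_sum v n =
        sqfree_sum v m + (\<Sum>k\<le>n div 2. (b (Suc k) - ?q * b k) * sqfree_sum v (n - 2 * k))"
      unfolding a[of m] a[of n] by (simp only: n sum_halves_shift)
        (simp add: b0 sum_distrib_left sum_subtractf left_diff_distrib mult.assoc)
    also have "(\<Sum>k\<le>n div 2. (b (Suc k) - ?q * b k) * sqfree_sum v (n - 2 * k)) =
        (\<Sum>k\<le>n div 2. if k = d - 1 then - sqfree_sum v (n - 2 * k) else 0)"
      using d1 by (intro sum.cong) (auto simp: bs)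
    also have "\<dots> = (if m \<ge> 2 * d then - sqfree_sum v (m - 2 * d) else 0)"
    proof -
      have "d - 1 \<le> n div 2 \<longleftrightarrow> m \<ge> 2 * d" using d1 n by auto
      moreover have "n - 2 * (d - 1) = m - 2 * d" using d1 n by auto
      ultimately show ?thesis by (simp add: sum.delta del: One_nat_def)
    qed
    finally show ?thesis using True n by auto
  qed
qed

text \<open>Each step of the recursion costs a monic sum in degree \<open>m\<close> and
  \<open>q\<close> times one in degree \<open>m - 2\<close>; both obey the same bound because
  \<open>q * q^((m - 1)/2) = q^((m + 1)/2)\<close>. There are at most \<open>m + 1\<close>
  steps.\<close>

lemma sum_abs_sqfree_sum:
  assumes d: "even d" "d \<ge> 1"
  shows "(\<Sum>v\<in>(places_deg d :: 'a poly set). \<bar>sqfree_sum v m\<bar>)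
    \<le> (real m + 1) * (4 * (real d + 1)\<^sup>2 * real CARD('a) ^ d * sqrt (real CARD('a)) ^ (m + 1))"
proof (induction m rule: less_induct)
  case (less m)
  let ?q = "real CARD('a)" and ?P = "places_deg d :: 'a poly set" and ?s = "sqrt (real CARD('a))"
  define C where "C = 2 * (real d + 1)\<^sup>2 * ?q ^ d"
  have C: "C \<ge> 0" by (simp add: C_def)
  have q: "?q > 1" using card_field_gt_1[where 'a='a] by simp
  have s: "?s > 1" using q by simp
  have A: "(\<Sum>v\<in>?P. \<bar>monic_sum v k\<bar>) \<le> C * ?s ^ (k + 1)" for k
    using sum_abs_monic_sum[OF d(1), of k] by (simp add: C_def)
  have 1: "(\<Sum>v\<in>?P. if m \<ge> 2 * d then \<bar>sqfree_sum v (m - 2 * d)\<bar> else 0) \<le> real m * (2 * C * ?s ^ (m + 1))"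
  proof (cases "m \<ge> 2 * d")
    case True
    have "(\<Sum>v\<in>?P. \<bar>sqfree_sum v (m - 2 * d)\<bar>) \<le> (real (m - 2 * d) + 1) * (2 * C * ?s ^ (m - 2 * d + 1))"
      using less.IH[of "m - 2 * d"] True d by (simp add: C_def mult.assoc)
    also have "\<dots> \<le> real m * (2 * C * ?s ^ (m + 1))"
      using True d C s by (intro mult_mono power_increasing) auto
    finally show ?thesis using True by simp
  qed (use C s in auto)
  have 2: "(\<Sum>v\<in>?P. if m \<ge> 2 then ?q * \<bar>monic_sum v (m - 2)\<bar> else 0) \<le> C * ?s ^ (m + 1)"
  proof (cases "m \<ge> 2")
    case True
    have "(\<Sum>v\<in>?P. ?q * \<bar>monic_sum v (m - 2)\<bar>) \<le> ?q * (C * ?s ^ (m - 2 + 1))"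
      using A[of "m - 2"] by (simp flip: sum_distrib_left)
    also have "\<dots> = C * (?s\<^sup>2 * ?s ^ (m - 2 + 1))" by simp
    also have "?s\<^sup>2 * ?s ^ (m - 2 + 1) = ?s ^ (m + 1)"
      using True by (simp only: power_add[symmetric]) (rule arg_cong[of _ _ "power _"], simp)
    finally show ?thesis using True by simp
  qed (use C s in auto)
  have "(\<Sum>v\<in>?P. \<bar>sqfree_sum v m\<bar>) \<le> (\<Sum>v\<in>?P. (if m \<ge> 2 * d then \<bar>sqfree_sum v (m - 2 * d)\<bar> else 0)
      + \<bar>monic_sum v m\<bar> + (if m \<ge> 2 then ?q * \<bar>monic_sum v (m - 2)\<bar> else 0))"
  proof (rule sum_mono)
    fix v :: "'a poly" assume "v \<in> ?P"
    hence v: "v \<in> finite_places" "degree v = d" by (auto simp: places_deg_def)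
    have tri: "\<bar>x + y - z\<bar> \<le> \<bar>x\<bar> + \<bar>y\<bar> + \<bar>z\<bar>" for x y z :: real by linarith
    have "\<bar>sqfree_sum v m\<bar> \<le> \<bar>if m \<ge> 2 * d then sqfree_sum v (m - 2 * d) else 0\<bar> + \<bar>monic_sum v m\<bar>
        + \<bar>if m \<ge> 2 then ?q * monic_sum v (m - 2) else 0\<bar>"
      unfolding sqfree_sum_rec[OF v, of m] by (rule tri)
    thus "\<bar>sqfree_sum v m\<bar> \<le> (if m \<ge> 2 * d then \<bar>sqfree_sum v (m - 2 * d)\<bar> else 0)
      + \<bar>monic_sum v m\<bar> + (if m \<ge> 2 then ?q * \<bar>monic_sum v (m - 2)\<bar> else 0)"
      by (cases "m \<ge> 2 * d"; cases "m \<ge> 2") (simp_all add: abs_mult)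
  qed
  also have "\<dots> \<le> real m * (2 * C * ?s ^ (m + 1)) + C * ?s ^ (m + 1) + C * ?s ^ (m + 1)"
    unfolding sum.distrib by (intro add_mono 1 2 A)
  also have "\<dots> = (real m + 1) * (2 * C * ?s ^ (m + 1))" by (simp add: algebra_simps)
  finally show ?case by (simp add: C_def mult.assoc)
qed

end

subsection \<open>Rationality of the zeta function\<close>

text \<open>In characteristic 0 the logarithmic derivative and the constant term determine a series
  recursively; this is how \<open>P_C\<close> is compared with the L-series.\<close>

lemma fps_log_deriv_unique:
  fixes F1 F2 G :: "complex fps"
  assumes "fps_deriv F1 = F1 * G" "fps_deriv F2 = F2 * G" "fps_nth F1 0 = fps_nth F2 0"
  shows "F1 = F2"
proof (rule fps_ext)
  fix n show "fps_nth F1 n = fps_nth F2 n"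
  proof (induction n rule: less_induct)
    case (less n)
    show ?case
    proof (cases n)
      case (Suc k)
      have "of_nat n * fps_nth F n = (\<Sum>i=0..k. fps_nth F i * fps_nth G (k - i))" if "fps_deriv F = F * G"
        for F :: "complex fps"
        using arg_cong[OF that, of "\<lambda>f. fps_nth f k"] by (simp add: fps_mult_nth Suc)
      from this[OF assms(1)] this[OF assms(2)]
      have "of_nat n * fps_nth F1 n = of_nat n * fps_nth F2 n"
        using less by (simp add: Suc)
      thus ?thesis by (simp add: Suc del: of_nat_Suc)
    qed (use assms in simp)
  qed
qed

lemma fps_log_deriv_mult:
  fixes F1 F2 G1 G2 :: "complex fps"
  assumes "fps_deriv F1 = F1 * G1" "fps_deriv F2 = F2 * G2"
  shows "fps_deriv (F1 * F2) = F1 * F2 * (G1 + G2)"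
  by (simp add: assms algebra_simps)

lemma fps_log_deriv_linear:
  fixes a :: complex
  shows "fps_deriv (1 - fps_const a * fps_X) = (1 - fps_const a * fps_X) * Abs_fps (\<lambda>m. - (a ^ Suc m))"
proof (rule fps_ext)
  fix k show "fps_nth (fps_deriv (1 - fps_const a * fps_X)) k =
      fps_nth ((1 - fps_const a * fps_X) * Abs_fps (\<lambda>m. - (a ^ Suc m))) k"
    by (cases k) (simp_all add: algebra_simps)
qed

lemma fps_log_deriv_prod_linear:
  fixes c :: "nat \<Rightarrow> complex"
  shows "fps_deriv (\<Prod>j<m. 1 - fps_const (c j) * fps_X) =
    (\<Prod>j<m. 1 - fps_const (c j) * fps_X) * Abs_fps (\<lambda>k. - (\<Sum>j<m. c j ^ Suc k))"
proof (induction m)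
  case 0
  have "Abs_fps (\<lambda>k. - (\<Sum>j<0. c j ^ Suc k)) = 0" by (rule fps_ext) simp
  thus ?case by simp
next
  case (Suc m)
  have "Abs_fps (\<lambda>k. - (\<Sum>j<m. c j ^ Suc k)) + Abs_fps (\<lambda>k. - (c m ^ Suc k)) =
      Abs_fps (\<lambda>k. - (\<Sum>j<Suc m. c j ^ Suc k))"
    by (rule fps_ext) simp
  with fps_log_deriv_mult[OF Suc fps_log_deriv_linear[of "c m"]] show ?case by simp
qed

text \<open>The factors come from the roots of the reversed polynomial. Its degree is exactly
  \<open>m\<close> since \<open>F\<close> has constant term 1, and zeros among the
  \<open>c j\<close> fill the list when \<open>F\<close> has lower degree.\<close>

lemma fps_split_linear:
  fixes F :: "complex fps"
  assumes F0: "fps_nth F 0 = 1" and Fm: "\<And>n. n > m \<Longrightarrow> fps_nth F n = 0"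
  shows "\<exists>c. F = (\<Prod>j<m. 1 - fps_const (c j) * fps_X)"
proof -
  define p where "p = (\<Sum>i\<le>m. monom (fps_nth F i) (m - i))"
  have cp: "coeff p k = (if k \<le> m then fps_nth F (m - k) else 0)" for k
  proof -
    have "coeff p k = (\<Sum>i\<le>m. if i = m - k \<and> k \<le> m then fps_nth F i else 0)"
      unfolding p_def coeff_sum by (intro sum.cong) auto
    thus ?thesis by auto
  qed
  have dp: "degree p = m"
  proof (rule antisym)
    show "degree p \<le> m" by (rule degree_le) (simp add: cp)
    show "m \<le> degree p" by (rule le_degree) (simp add: cp F0)
  qed
  have p0: "p \<noteq> 0" and lp: "lead_coeff p = 1" using cp[of m] F0 dp by auto
  obtain A where A: "size A = degree p" "p = smult (lead_coeff p) (\<Prod>x\<in>#A. [:-x, 1:])"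
    using alg_closed_imp_factorization[OF p0] by blast
  obtain xs where xs: "mset xs = A" using ex_mset by blast
  have len: "length xs = m" using A(1) dp xs by (metis size_mset)
  have p: "p = (\<Prod>x\<in>#mset xs. [:-x, 1:])" using A(2) xs lp by simp
  have refl: "reflect_poly (\<Prod>x\<in>#mset ys. [:-x, 1:]) = (\<Prod>j<length ys. [:1, - (ys ! j):])"
    for ys :: "complex list"
  proof (induction ys rule: rev_induct)
    case (snoc y ys)
    have r: "reflect_poly [:-y, 1:] = [:1, - y:]"
      by (cases "y = 0") (simp_all add: reflect_poly_def)
    have "reflect_poly (\<Prod>x\<in>#mset (ys @ [y]). [:-x, 1:]) = reflect_poly (\<Prod>x\<in>#mset ys. [:-x, 1:]) * [:1, - y:]"
      by (simp add: reflect_poly_mult r del: mult_pCons_left mult_pCons_right)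
    also have "\<dots> = (\<Prod>j<length ys. [:1, - (ys ! j):]) * [:1, - y:]" by (simp only: snoc)
    also have "(\<Prod>j<length ys. [:1, - (ys ! j):]) = (\<Prod>j<length ys. [:1, - ((ys @ [y]) ! j):])"
      by (intro prod.cong) (auto simp: nth_append)
    finally show ?case by (simp del: mult_pCons_left mult_pCons_right)
  qed simp
  have lin: "fps_of_poly [:1, - a:] = 1 - fps_const a * fps_X" for a :: complex
    by (simp add: fps_of_poly_pCons)
  have "F = fps_of_poly (reflect_poly p)"
    by (rule fps_ext) (use Fm in \<open>simp add: coeff_reflect_poly dp cp\<close>)
  also have "\<dots> = fps_of_poly (\<Prod>j<m. [:1, - (xs ! j):])" unfolding p refl len ..
  also have "\<dots> = (\<Prod>j<m. 1 - fps_const (xs ! j) * fps_X)"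
    by (simp only: fps_of_poly_prod lin)
  finally show ?thesis by (intro exI[of _ "\<lambda>j. xs ! j"])
qed

definition lcoeff :: "'a::{field,finite} poly \<Rightarrow> nat \<Rightarrow> real" where
  "lcoeff Q m = (\<Sum>f\<in>monics m. sy f Q)"

definition chi_sum :: "'a::{field,finite} poly \<Rightarrow> nat \<Rightarrow> real" where
  "chi_sum Q k = (\<Sum>x\<in>ext_field k. chi k (ev Q x))"

context odd_field
begin

text \<open>
  Coefficient form of \<open>u L'(u) = L(u) \<Sum>\<^sub>k chi_sum Q k u\<^sup>k\<close> for \<open>L(u) = \<Sum>\<^sub>m lcoeff Q m u\<^sup>m\<close>: count the
  degree of each \<open>f\<close> as the sum of \<open>deg v\<close> over all prime powers \<open>v\<^sup>j\<close> dividing \<open>f\<close>.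
\<close>

lemma lcoeff_euler:
  fixes Q :: "'a poly"
  shows "real m * lcoeff Q m = (\<Sum>k=1..m. chi_sum Q k * lcoeff Q (m - k))"
proof -
  define I where "I = {(v :: 'a poly, j :: nat). v \<in> finite_places \<and> j \<ge> 1 \<and> j * degree v \<le> m}"
  have I_sub: "I \<subseteq> (\<Union>d\<le>m. monics d) \<times> {..m}"
  proof (rule subrelI)
    fix v :: "'a poly" and j assume "(v, j) \<in> I"
    hence v: "v \<in> finite_places" and j: "j \<ge> 1" "j * degree v \<le> m" by (auto simp: I_def)
    have d: "degree v \<ge> 1" using place_degree_pos[OF v] by simp
    have "1 * degree v \<le> j * degree v" "j * 1 \<le> j * degree v" using j d
      by (intro mult_right_mono mult_left_mono; simp)+
    hence "degree v \<le> m" "j \<le> m" using j(2) by linarith+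
    thus "(v, j) \<in> (\<Union>d\<le>m. monics d) \<times> {..m}" using place_monic[OF v] by auto
  qed
  have finI: "finite I" by (rule finite_subset[OF I_sub]) simp
  have vj: "v ^ j \<in> monics (j * degree v)" if "v \<in> finite_places" for v :: "'a poly" and j
    using place_monic[OF that] place_nonzero[OF that]
    by (simp add: monics_def degree_power_eq lead_coeff_power finite_places_def)
      (metis degree_power_eq lead_coeff_power power_one)
  have pp: "place_powers f = {(v, j) \<in> I. v ^ j dvd f}" if f: "f \<in> monics m" for f :: "'a poly"
  proof -
    have f0: "f \<noteq> 0" "degree f = m" using f by (auto simp: monics_def)
    have "j * degree v \<le> m" if "v \<in> finite_places" "v ^ j dvd f" for v j
      using dvd_imp_degree_le[OF that(2) f0(1)] f0(2) place_nonzero[OF that(1)]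
        by (simp add: degree_power_eq mult.commute)
    thus ?thesis by (auto simp: place_powers_def I_def)
  qed
  have "real m * lcoeff Q m = (\<Sum>f\<in>(monics m :: 'a poly set). real (degree f) * sy f Q)"
    unfolding lcoeff_def sum_distrib_left by (intro sum.cong) (auto simp: monics_def)
  also have "\<dots> = (\<Sum>f\<in>(monics m :: 'a poly set). \<Sum>(v, j)\<in>I. if v ^ j dvd f then real (degree v) * sy f Q else 0)"
  proof (rule sum.cong)
    fix f :: "'a poly" assume f: "f \<in> monics m"
    have "degree f = (\<Sum>(v, j)\<in>place_powers f. degree v)"
      using degree_eq_sum_place_powers[OF monics_nonzero[OF f]] by simp
    also have "\<dots> = (\<Sum>p\<in>{p \<in> I. fst p ^ snd p dvd f}. degree (fst p))"
      unfolding pp[OF f] by (intro sum.cong) auto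
    finally have "real (degree f) * sy f Q =
        (\<Sum>p\<in>{p \<in> I. fst p ^ snd p dvd f}. real (degree (fst p)) * sy f Q)"
      by (simp add: sum_distrib_right)
    also have "\<dots> = (\<Sum>p\<in>I. if fst p ^ snd p dvd f then real (degree (fst p)) * sy f Q else 0)"
      by (rule sum.inter_filter[OF finI])
    finally show "real (degree f) * sy f Q = (\<Sum>(v, j)\<in>I. if v ^ j dvd f then real (degree v) * sy f Q else 0)"
      by (simp add: case_prod_unfold)
  qed simp
  also have "\<dots> = (\<Sum>(v, j)\<in>I. \<Sum>f\<in>(monics m :: 'a poly set). if v ^ j dvd f then real (degree v) * sy f Q else 0)"
    by (simp only: case_prod_unfold) (rule sum.swap)
  also have "\<dots> = (\<Sum>(v, j)\<in>I. real (degree v) * sy v Q ^ j * lcoeff Q (m - j * degree v))"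
  proof (intro sum.cong refl, clarify)
    fix v :: "'a poly" and j assume "(v, j) \<in> I"
    hence v: "v \<in> finite_places" and j: "j * degree v \<le> m" by (auto simp: I_def)
    have vm: "monic v" using v by (simp add: finite_places_def)
    note vjm = vj[OF v, of j]
    from sum.reindex_bij_betw[OF bij_betw_mult_monics[OF vjm j], of "\<lambda>f. real (degree v) * sy f Q"]
    have "(\<Sum>f\<in>{f \<in> monics m. v ^ j dvd f}. real (degree v) * sy f Q) =
        (\<Sum>h\<in>monics (m - j * degree v). real (degree v) * sy (v ^ j * h) Q)" by simp
    also have "\<dots> = (\<Sum>h\<in>monics (m - j * degree v). real (degree v) * sy v Q ^ j * sy h Q)"
    proof (rule sum.cong)
      fix h :: "'a poly" assume "h \<in> monics (m - j * degree v)"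
      hence "monic h" by (auto simp: monics_def)
      moreover have "monic (v ^ j)" using vjm by (auto simp: monics_def)
      ultimately show "real (degree v) * sy (v ^ j * h) Q = real (degree v) * sy v Q ^ j * sy h Q"
        by (simp add: sy_mult_left sy_power_left vm del: lead_coeff_power)
    qed simp
    finally show "(\<Sum>f\<in>monics m. if v ^ j dvd f then real (degree v) * sy f Q else 0) =
        real (degree v) * sy v Q ^ j * lcoeff Q (m - j * degree v)"
      by (simp add: sum.inter_filter lcoeff_def sum_distrib_left)
  qed
  \<comment> \<open>Collect the pairs \<open>(v, j)\<close> by \<open>k = j * degree v\<close>; for
    fixed \<open>k\<close> this is the place form of \<open>chi_sum Q k\<close>.\<close>
  also have "\<dots> = (\<Sum>(k, v)\<in>(SIGMA k:{1..m}. places_dvd k). real (degree v) * sy v Q ^ (k div degree v) * lcoeff Q (m - k))"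
  proof (rule sum.reindex_bij_witness[where i = "\<lambda>(k, v). (v, k div degree v)"
    and j = "\<lambda>(v, j). (j * degree v, v)"])
    fix p assume "p \<in> I"
    then obtain v j where p: "p = (v, j)" and v: "v \<in> finite_places" and j: "j \<ge> 1" "j * degree v \<le> m"
      by (auto simp: I_def)
    have d: "degree v > 0" using place_degree_pos[OF v] .
    show "(case case p of (v, j) \<Rightarrow> (j * degree v, v) of (k, v) \<Rightarrow> (v, k div degree v)) = p"
      using d by (simp add: p)
    show "(case p of (v, j) \<Rightarrow> (j * degree v, v)) \<in> (SIGMA k:{1..m}. places_dvd k)"
      using v j d by (simp add: p places_dvd_def Suc_le_eq)
    show "(case case p of (v, j) \<Rightarrow> (j * degree v, v) of (k, v) \<Rightarrow>
        real (degree v) * sy v Q ^ (k div degree v) * lcoeff Q (m - k)) =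
        (case p of (v, j) \<Rightarrow> real (degree v) * sy v Q ^ j * lcoeff Q (m - j * degree v))"
      using d by (simp add: p)
  next
    fix p :: "nat \<times> 'a poly" assume "p \<in> (SIGMA k:{1..m}. places_dvd k)"
    then obtain k v where p: "p = (k, v)" and k: "1 \<le> k" "k \<le> m" and v: "v \<in> finite_places" "degree v dvd k"
      by (auto simp: places_dvd_def)
    show "(case case p of (k, v) \<Rightarrow> (v, k div degree v) of (v, j) \<Rightarrow> (j * degree v, v)) = p"
      using v by (simp add: p)
    have "k div degree v \<ge> 1" using v k dvd_imp_le[OF v(2)] place_degree_pos[OF v(1)]
      by (simp add: Suc_le_eq div_greater_zero_iff)
    thus "(case p of (k, v) \<Rightarrow> (v, k div degree v)) \<in> I"
      using v k by (simp add: p I_def)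
  qed
  also have "\<dots> = (\<Sum>k=1..m. \<Sum>v\<in>places_dvd k. real (degree v) * sy v Q ^ (k div degree v) * lcoeff Q (m - k))"
    by (subst sum.Sigma[symmetric]) auto
  also have "\<dots> = (\<Sum>k=1..m. chi_sum Q k * lcoeff Q (m - k))"
    by (intro sum.cong) (auto simp: chi_sum_def sum_chi_ev sum_distrib_right)
  finally show ?thesis .
qed

section \<open>The L-series of a hyperelliptic model is a polynomial\<close>

definition hyper_polys :: "nat \<Rightarrow> 'a poly set" where
  "hyper_polys g = {Q. squarefree Q \<and> (degree Q = 2 * g + 1 \<or> degree Q = 2 * g + 2)}"

lemma hyper_polys_split:
  assumes "Q \<in> hyper_polys g"
  obtains D where "monic D" "degree D = degree Q" "\<And>h. D \<noteq> h\<^sup>2" "Q =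
      smult (lead_coeff Q) D" "lead_coeff Q \<noteq> 0"
proof -
  have sq: "squarefree Q" and d: "degree Q > 0" using assms by (auto simp: hyper_polys_def)
  have l0: "lead_coeff Q \<noteq> 0" using d by auto
  define D where "D = smult (inverse (lead_coeff Q)) Q"
  have Q: "Q = smult (lead_coeff Q) D" using l0 by (simp add: D_def)
  have dD: "degree D = degree Q" using l0 by (simp add: D_def)
  have "D \<noteq> h\<^sup>2" for h
  proof
    assume h: "D = h\<^sup>2"
    have "h\<^sup>2 dvd Q" using Q h by (metis dvd_refl dvd_smult)
    hence "is_unit h" using sq by (simp add: squarefree_def)
    hence "degree h = 0" using is_unit_iff_degree[of h] by (cases "h = 0") auto
    hence "degree D = 0" by (simp add: h degree_power_le power2_eq_square degree_mult_eq_0)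
    thus False using d dD by simp
  qed
  moreover have "monic D" using l0 by (simp add: D_def)
  ultimately show ?thesis using that dD Q l0 by blast
qed

lemma lcoeff_eq_0:
  assumes Q: "Q \<in> hyper_polys g" and m: "m \<ge> degree Q"
  shows "lcoeff Q m = 0"
proof -
  obtain D where D: "monic D" "degree D = degree Q" "\<And>h. D \<noteq> h\<^sup>2" "Q = smult (lead_coeff Q) D"
    using hyper_polys_split[OF Q] by blast
  have "sy f Q = leg (lead_coeff Q) ^ m * sy f D" if "f \<in> monics m" for f
    using that by (subst D(4), subst sy_smult) (auto simp: monics_def)
  hence "lcoeff Q m = leg (lead_coeff Q) ^ m * (\<Sum>f\<in>monics m. sy f D)"
    by (simp add: lcoeff_def sum_distrib_left)
  thus ?thesis using sum_sy_left_eq_0[OF D(1,3), of m] m D(2) by simp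
qed

text \<open>The zero of the L-series at \<open>u = leg (lead_coeff Q)\<close>, which belongs to the
  place at infinity: \<open>q - 1\<close> times this value is the complete sum of the symbol over
  the residues modulo the monic \<open>D\<close>.\<close>

lemma lcoeff_even_degree:
  assumes Q: "Q \<in> hyper_polys g" and deg: "degree Q = 2 * g + 2"
  shows "(\<Sum>m<2*g+2. leg (lead_coeff Q) ^ m * lcoeff Q m) = 0"
proof -
  let ?l = "leg (lead_coeff Q)"
  obtain D where D: "monic D" "degree D = degree Q" "\<And>h. D \<noteq> h\<^sup>2" "Q =
      smult (lead_coeff Q) D" "lead_coeff Q \<noteq> 0"
    using hyper_polys_split[OF Q] by blast
  have l2: "?l ^ m * ?l ^ m = 1" for m
    using leg_nonzero_square[OF D(5)] by (simp add: power2_eq_square flip: power_mult_distrib)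
  have tm: "?l ^ m * lcoeff Q m = monic_sum D m" for m
    unfolding lcoeff_def monic_sum_def sum_distrib_left
  proof (rule sum.cong)
    fix f :: "'a poly" assume "f \<in> monics m"
    hence f: "monic f" "degree f = m" by (auto simp: monics_def)
    have "sy f Q = ?l ^ m * sy f D" by (subst D(4), subst sy_smult[OF f(1)]) (simp add: f(2))
    also have "sy f D = sy D f" by (rule sy_reciprocity_even[OF f(1) D(1)]) (simp add: D(2) deg)
    finally show "?l ^ m * sy f Q = sy D f" by (simp add: l2 flip: mult.assoc)
  qed simp
  have e: "even (degree D)" using D(2) deg by simp
  have "sy D 0 = 0"
  proof -
    have "size (ac_roots D) > 0" using ac_roots_split(2)[OF D(1)] D(2) deg by simp
    hence "res D 0 = 0" by (auto simp: res_def prod_mset_zero_iff)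
    thus ?thesis by (simp add: sy_def chi_eq_0_iff)
  qed
  hence i0: "interval_sum D 0 = 0" by (simp add: interval_sum_def)
  have "interval_sum D n = (real CARD('a) - 1) * (\<Sum>m<n. monic_sum D m)" for n
    by (induction n) (simp_all add: i0 interval_sum_Suc[OF D(1) e] distrib_left)
  moreover have "interval_sum D (2 * g + 2) = 0"
    using sum_sy_residues_eq_0[OF D(1,3)] D(2) deg by (simp add: interval_sum_def)
  moreover have "real CARD('a) - 1 \<noteq> 0" using card_ge_3 by simp
  ultimately show ?thesis by (simp only: tm) simp
qed

section \<open>Point counts, the numerator \<open>P_C\<close> and the Frobenius eigenvalues\<close>

lemma card_square_fibres:
  fixes F :: "'a alg_closure \<Rightarrow> 'a alg_closure"
  assumes n: "n \<ge> 1" and F: "\<And>x. x \<in> ext_field n \<Longrightarrow> F x \<in> ext_field n"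
  shows "real (card {(x, y). x \<in> ext_field n \<and> y \<in> ext_field n \<and> y\<^sup>2 = F x}) =
      real CARD('a) ^ n + (\<Sum>x\<in>ext_field n. chi n (F x))"
proof -
  have fin: "finite (ext_field n :: 'a alg_closure set)" by (rule finite_ext_field[OF n])
  have "{(x, y). x \<in> ext_field n \<and> y \<in> ext_field n \<and> y\<^sup>2 = F x} =
      (SIGMA x:ext_field n. {y \<in> ext_field n. y\<^sup>2 = F x})"
    by auto
  hence "real (card {(x, y). x \<in> ext_field n \<and> y \<in> ext_field n \<and> y\<^sup>2 = F x}) =
      (\<Sum>x\<in>ext_field n. real (card {y \<in> ext_field n. y\<^sup>2 = F x}))"
    using fin by (simp add: card_SigmaI)
  also have "\<dots> = (\<Sum>x\<in>ext_field n. 1 + chi n (F x))"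
    by (intro sum.cong card_square_roots n F) auto
  finally show ?thesis by (simp add: sum.distrib card_ext_field[OF n])
qed

lemma num_points_eq:
  fixes Q :: "'a poly"
  assumes n: "n \<ge> 1"
  shows "real (num_points g Q n) = real CARD('a) ^ n + 1 + chi_sum Q n + leg (coeff Q (2 * g + 2)) ^ n"
proof -
  have "real (card (affine_points Q n)) = real CARD('a) ^ n + chi_sum Q n"
    unfolding affine_points_def chi_sum_def ev_def[symmetric]
    by (rule card_square_fibres[OF n ext_field_ev])
  moreover have "real (card (infinite_points g Q n)) = 1 + chi n (to_ac (coeff Q (2 * g + 2)))"
    unfolding infinite_points_def by (rule card_square_roots[OF n to_ac_in_ext_field])
  moreover have "chi n (to_ac (coeff Q (2 * g + 2))) = leg (coeff Q (2 * g + 2)) ^ n"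
    using chi_extend[of 1 n "to_ac (coeff Q (2 * g + 2))"] n by (simp add: leg_def)
  ultimately show ?thesis by (simp add: num_points_def)
qed

text \<open>For \<open>n \<ge> 1\<close> the second term is the place at infinity: 0 if it ramifies,
  otherwise 1 or \<open>(-1)^n\<close> according to whether the leading coefficient is a
  square.\<close>

definition trace_sum :: "nat \<Rightarrow> 'a poly \<Rightarrow> nat \<Rightarrow> real" where
  "trace_sum g Q n = chi_sum Q n + leg (coeff Q (2 * g + 2)) ^ n"

text \<open>\<open>P_fps\<close> for a given model, freed from the choice of
  \<open>Q\<close>.\<close>

definition P_of :: "nat \<Rightarrow> 'a poly \<Rightarrow> complex fps" where
  "P_of g Q = (1 - fps_X) * (1 - fps_const (of_nat CARD('a)) * fps_X) * zeta_fps g Q"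

text \<open>The factors \<open>1 - u\<close> and \<open>1 - q * u\<close> remove
  \<open>1 + q^m\<close> from the number of points over F_(q^m).\<close>

lemma P_of_log_deriv:
  "fps_deriv (P_of g Q) = P_of g Q * Abs_fps (\<lambda>m. complex_of_real (trace_sum g Q (Suc m)))"
  and P_of_0: "fps_nth (P_of g Q) 0 = 1"
proof -
  define N :: "complex fps" where "N = Abs_fps (\<lambda>n. of_nat (num_points g Q n) / of_nat n)"
  have N0: "fps_nth N 0 = 0" by (simp add: N_def)
  have "fps_deriv (zeta_fps g Q) = zeta_fps g Q * fps_deriv N"
    unfolding zeta_fps_def N_def[symmetric] by (subst fps_compose_deriv[OF N0]) simp
  from fps_log_deriv_mult[OF fps_log_deriv_mult[OF fps_log_deriv_linear[of 1] fps_log_deriv_linear[of "of_nat CARD('a)"]] this]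
  have "fps_deriv (P_of g Q) = P_of g Q *
      (Abs_fps (\<lambda>m. - (1 ^ Suc m)) + Abs_fps (\<lambda>m. - (of_nat CARD('a) ^ Suc m)) + fps_deriv N)"
    by (simp add: P_of_def)
  also have "Abs_fps (\<lambda>m. - (1 ^ Suc m)) + Abs_fps (\<lambda>m. - (of_nat CARD('a) ^ Suc m)) + fps_deriv N =
      Abs_fps (\<lambda>m. complex_of_real (trace_sum g Q (Suc m)))"
  proof (rule fps_ext)
    fix m
    have "(of_nat (num_points g Q (Suc m)) :: complex) = complex_of_real (real (num_points g Q (Suc m)))"
      by simp
    also have "\<dots> = of_nat CARD('a) ^ Suc m + 1 + complex_of_real (trace_sum g Q (Suc m))"
      by (subst num_points_eq) (simp_all add: trace_sum_def)
    finally have "(of_nat (num_points g Q (Suc m)) :: complex) =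
        of_nat CARD('a) ^ Suc m + 1 + complex_of_real (trace_sum g Q (Suc m))" .
    thus "fps_nth (Abs_fps (\<lambda>m. - (1 ^ Suc m)) + Abs_fps (\<lambda>m. - (of_nat CARD('a) ^ Suc m)) + fps_deriv N) m =
        fps_nth (Abs_fps (\<lambda>m. complex_of_real (trace_sum g Q (Suc m)))) m"
      by (simp add: N_def del: of_nat_Suc power_Suc)
  qed
  finally show "fps_deriv (P_of g Q) = P_of g Q * Abs_fps (\<lambda>m. complex_of_real (trace_sum g Q (Suc m)))" .
  show "fps_nth (P_of g Q) 0 = 1"
    by (simp add: P_of_def zeta_fps_def fps_compose_nth)
qed

text \<open>The right side is the L-series over the finite places; the linear factor strips
  \<open>P_C\<close> of its Euler factor at infinity. Both sides have constant term 1 and the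
  logarithmic derivative generated by \<open>chi_sum\<close>.\<close>

lemma P_of_times_linear:
  "P_of g Q * (1 - fps_const (complex_of_real (leg (coeff Q (2 * g + 2)))) * fps_X) =
      Abs_fps (\<lambda>m. complex_of_real (lcoeff Q m))"
    (is "?L = ?R")
proof (rule fps_log_deriv_unique)
  let ?G = "Abs_fps (\<lambda>m. complex_of_real (chi_sum Q (Suc m)))"
  have "Abs_fps (\<lambda>m. complex_of_real (trace_sum g Q (Suc m))) +
      Abs_fps (\<lambda>m. - (complex_of_real (leg (coeff Q (2 * g + 2))) ^ Suc m)) = ?G"
    by (rule fps_ext) (simp add: trace_sum_def)
  thus "fps_deriv ?L = ?L * ?G"
    using fps_log_deriv_mult[OF P_of_log_deriv[of g Q] fps_log_deriv_linear[of "complex_of_real (leg (coeff Q (2 * g + 2)))"]]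
    by (simp only:)
  show "fps_deriv ?R = ?R * ?G"
  proof (rule fps_ext)
    fix n
    have "fps_nth (fps_deriv ?R) n = complex_of_real (real (Suc n) * lcoeff Q (Suc n))" by simp
    also have "real (Suc n) * lcoeff Q (Suc n) = (\<Sum>k=1..Suc n. chi_sum Q k * lcoeff Q (Suc n - k))"
      by (rule lcoeff_euler)
    also have "\<dots> = (\<Sum>i=0..n. lcoeff Q i * chi_sum Q (Suc (n - i)))"
      by (rule sum.reindex_bij_witness[where i = "\<lambda>i. Suc (n - i)" and j = "\<lambda>k. Suc n - k"])
        (auto simp: Suc_diff_le mult.commute)
    finally show "fps_nth (fps_deriv ?R) n = fps_nth (?R * ?G) n" by (simp add: fps_mult_nth)
  qed
  show "fps_nth ?L 0 = fps_nth ?R 0" by (simp add: P_of_0 lcoeff_def)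
qed

text \<open>Divide the L-series by \<open>1 - l * u\<close>. In degree \<open>2 * g + 1\<close> this
  factor is 1 and the L-series already has degree at most \<open>2 * g\<close>; in degree
  \<open>2 * g + 2\<close> its zero at \<open>l\<close> lowers the degree bound
  \<open>2 * g + 1\<close> by one.\<close>

lemma P_of_degree:
  assumes Q: "Q \<in> hyper_polys g" and n: "n > 2 * g"
  shows "fps_nth (P_of g Q) n = 0"
proof -
  define l where "l = leg (coeff Q (2 * g + 2))"
  let ?a = "\<lambda>m. complex_of_real (lcoeff Q m)"
  have geo: "(1 - fps_const (complex_of_real l) * fps_X) * Abs_fps (\<lambda>m. complex_of_real l ^ m) = 1"
  proof (rule fps_ext)
    fix k show "fps_nth ((1 - fps_const (complex_of_real l) * fps_X) * Abs_fps (\<lambda>m. complex_of_real l ^ m)) k =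
        fps_nth 1 k"
      by (cases k) (simp_all add: algebra_simps)
  qed
  have "P_of g Q = P_of g Q * ((1 - fps_const (complex_of_real l) * fps_X) * Abs_fps (\<lambda>m. complex_of_real l ^ m))"
    unfolding geo by simp
  also have "\<dots> = Abs_fps ?a * Abs_fps (\<lambda>m. complex_of_real l ^ m)"
    unfolding mult.assoc[symmetric] l_def P_of_times_linear ..
  finally have "fps_nth (P_of g Q) n = (\<Sum>i=0..n. ?a i * complex_of_real l ^ (n - i))"
    by (simp add: fps_mult_nth)
  hence Pn: "fps_nth (P_of g Q) n = complex_of_real (\<Sum>i=0..n. lcoeff Q i * l ^ (n - i))" by simp
  have "(\<Sum>i=0..n. lcoeff Q i * l ^ (n - i)) = 0"
  proof (cases "degree Q = 2 * g + 2")
    case True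
    have l2: "l * l = 1"
    proof -
      have "Q \<noteq> 0" using True by auto
      hence "lead_coeff Q \<noteq> 0" by simp
      thus ?thesis using leg_nonzero_square[of "lead_coeff Q"] True by (simp add: l_def power2_eq_square)
    qed
    have "(\<Sum>i=0..n. lcoeff Q i * l ^ (n - i)) = (\<Sum>i<2*g+2. lcoeff Q i * l ^ (n - i))"
    proof (rule sum.mono_neutral_right)
      show "\<forall>i\<in>{0..n} - {..<2*g+2}. lcoeff Q i * l ^ (n - i) = 0"
        using lcoeff_eq_0[OF Q] True by auto
    qed (use n in auto)
    also have "\<dots> = (\<Sum>i<2*g+2. l ^ n * (l ^ i * lcoeff Q i))"
    proof (rule sum.cong)
      fix i assume "i \<in> {..<2*g+2}"
      hence "n = (n - i) + i" using n by auto
      hence "l ^ n = l ^ (n - i) * l ^ i" by (metis power_add)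
      hence "l ^ n * l ^ i = l ^ (n - i)" using l2 by (simp add: mult.assoc flip: power_mult_distrib)
      thus "lcoeff Q i * l ^ (n - i) = l ^ n * (l ^ i * lcoeff Q i)" by (simp flip: mult.assoc)
    qed simp
    also have "\<dots> = l ^ n * (\<Sum>i<2*g+2. l ^ i * lcoeff Q i)" by (simp only: sum_distrib_left)
    also have "(\<Sum>i<2*g+2. l ^ i * lcoeff Q i) = 0"
      using lcoeff_even_degree[OF Q True] by (simp only: l_def True)
    finally show ?thesis by simp
  next
    case False
    hence d: "degree Q = 2 * g + 1" using Q by (auto simp: hyper_polys_def)
    hence l0: "l = 0" by (simp add: l_def leg_def coeff_eq_0 chi_eq_0_iff)
    have "(\<Sum>i=0..n. lcoeff Q i * l ^ (n - i)) = (\<Sum>i\<in>{n}. lcoeff Q i * l ^ (n - i))"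
      by (rule sum.mono_neutral_right) (auto simp: l0 power_0_left)
    also have "\<dots> = 0" using lcoeff_eq_0[OF Q, of n] d n by simp
    finally show ?thesis .
  qed
  thus ?thesis using Pn by simp
qed

text \<open>Here \<open>SOME\<close> is justified: \<open>P_C\<close> splits into
  \<open>2 * g\<close> linear factors, so a tuple of eigenvalues exists, and its power sums are read
  from the logarithmic derivative.\<close>

lemma tr_Theta_trace_sum:
  fixes L :: "'a ratfun alg_closure set"
  assumes L: "\<exists>Q. hyperelliptic_model g L Q" and n: "n \<ge> 1"
  shows "- complex_of_real (real CARD('a) powr (real n / 2)) * tr_Theta g L n =
    complex_of_real (trace_sum g (SOME Q. hyperelliptic_model g L Q) n)"
proof -
  define Q where "Q = (SOME Q. hyperelliptic_model g L Q)"
  have "hyperelliptic_model g L Q" unfolding Q_def using L by (rule someI_ex)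
  hence Q: "Q \<in> hyper_polys g" by (auto simp: hyperelliptic_model_def hyper_polys_def)
  have P: "P_fps g L = P_of g Q" by (simp add: P_fps_def P_of_def Q_def)
  obtain c where c: "P_of g Q = (\<Prod>j<2*g. 1 - fps_const (c j) * fps_X)"
    using fps_split_linear[of "P_of g Q" "2 * g"] P_of_0 P_of_degree[OF Q] by blast
  have q: "real CARD('a) > 0" by simp
  define s where "s = complex_of_real (sqrt (real CARD('a)))"
  have s: "s \<noteq> 0" by (simp add: s_def)
  define e where "e = (\<lambda>j. c j / s)"
  have se: "s * e j = c j" for j using s by (simp add: e_def)
  have "frob_eigenvalues g L e"
    unfolding frob_eigenvalues_def P c s_def[symmetric] se ..
  hence tr: "tr_Theta g L n = (\<Sum>j<2*g. e j ^ n)" by (rule tr_Theta_eq[OF _ n])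
  have "real CARD('a) powr (real n / 2) = sqrt (real CARD('a)) ^ n"
    using q by (simp add: powr_half_sqrt[symmetric] powr_powr powr_realpow[symmetric] mult.commute)
  hence "- complex_of_real (real CARD('a) powr (real n / 2)) * tr_Theta g L n = - (\<Sum>j<2*g. c j ^ n)"
    by (simp add: tr s_def[symmetric] sum_distrib_left sum_negf se flip: power_mult_distrib)
  also have "\<dots> = complex_of_real (trace_sum g Q n)"
  proof -
    obtain m where m: "n = Suc m" using n by (cases n) auto
    have "P_of g Q * Abs_fps (\<lambda>k. - (\<Sum>j<2*g. c j ^ Suc k)) =
        P_of g Q * Abs_fps (\<lambda>m. complex_of_real (trace_sum g Q (Suc m)))"
      using P_of_log_deriv[of g Q] fps_log_deriv_prod_linear[of c "2 * g"] by (simp only: c)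
    moreover have "P_of g Q \<noteq> 0" using P_of_0[of g Q] by auto
    ultimately have "Abs_fps (\<lambda>k. - (\<Sum>j<2*g. c j ^ Suc k)) =
        Abs_fps (\<lambda>m. complex_of_real (trace_sum g Q (Suc m)))"
      by simp
    hence "fps_nth (Abs_fps (\<lambda>k. - (\<Sum>j<2*g. c j ^ Suc k))) m =
        fps_nth (Abs_fps (\<lambda>m. complex_of_real (trace_sum g Q (Suc m)))) m"
      by (rule arg_cong)
    thus ?thesis by (simp only: fps_nth_Abs_fps m)
  qed
  finally show ?thesis by (simp add: Q_def)
qed

end

subsection \<open>Quadratic extensions and square-free polynomials\<close>

abbreviation rf :: "'a::{field,finite} poly \<Rightarrow> 'a ratfun alg_closure" where
  "rf P \<equiv> to_ac (Fraction_Field.Fract P 1)"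

global_interpretation ratfun_vs: vector_space "\<lambda>(c :: 'a::field ratfun) x. to_ac c * x"
  by unfold_locales (simp_all add: algebra_simps)

lemma Fract_eq_square_imp:
  fixes P R :: "'a::{field,finite} poly"
  assumes "Fraction_Field.Fract P 1 = b\<^sup>2 * Fraction_Field.Fract R 1"
  obtains x y where "y \<noteq> 0" "P * y\<^sup>2 = R * x\<^sup>2"
proof -
  obtain x y where b: "b = Fraction_Field.Fract x y" "y \<noteq> 0" by (cases b) auto
  have "Fraction_Field.Fract P 1 = Fraction_Field.Fract (x\<^sup>2 * R) (y\<^sup>2)"
    using assms b by (simp add: power2_eq_square)
  hence "P * y\<^sup>2 = R * x\<^sup>2" using b(2) by (simp add: eq_fract mult.commute)
  thus ?thesis using that b(2) by blast
qed

text \<open>Uniqueness of the square-free part, applied to the monic normalisations, makes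
  \<open>P\<close> and \<open>R\<close> proportional; the leading coefficients show that the factor
  is a square.\<close>

lemma squarefree_ratio_square:
  fixes P R x y :: "'a::{field,finite} poly"
  assumes P: "squarefree P" and R: "squarefree R" and y: "y \<noteq> 0" and eq: "P * y\<^sup>2 = R * x\<^sup>2"
  shows "\<exists>c. c \<noteq> 0 \<and> P = smult (c\<^sup>2) R"
proof -
  have nz: "P \<noteq> 0" "R \<noteq> 0" using P R by auto
  hence x: "x \<noteq> 0" using eq y by auto
  define n where "n = (\<lambda>f :: 'a poly. smult (inverse (lead_coeff f)) f)"
  have n: "f = smult (lead_coeff f) (n f)" "monic (n f)" if "f \<noteq> 0" for f
    using that by (simp_all add: n_def)
  have sqf: "squarefree (n f)" if "squarefree f" for f
  proof (rule squarefreeI)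
    fix h assume h: "h\<^sup>2 dvd n f"
    have f0: "f \<noteq> 0" using that by auto
    have "h\<^sup>2 dvd smult (lead_coeff f) (n f)" using h by (rule dvd_smult)
    hence "h\<^sup>2 dvd f" unfolding n(1)[OF f0, symmetric] .
    thus "is_unit h" using that by (simp add: squarefree_def)
  qed
  let ?p = "lead_coeff P" and ?r = "lead_coeff R" and ?x = "lead_coeff x" and ?y = "lead_coeff y"
  have lc: "?p * ?y\<^sup>2 = ?r * ?x\<^sup>2"
    using arg_cong[OF eq, of lead_coeff] by (simp only: lead_coeff_mult lead_coeff_power)
  have "smult (?p * ?y\<^sup>2) (n P * (n y)\<^sup>2) = smult (?r * ?x\<^sup>2) (n R * (n x)\<^sup>2)"
    using eq n(1)[OF nz(1)] n(1)[OF nz(2)] n(1)[OF x] n(1)[OF y]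
    by (metis (no_types, lifting) mult_smult_left mult_smult_right smult_power smult_smult)
  hence "smult (?r * ?x\<^sup>2) (n P * (n y)\<^sup>2 - n R * (n x)\<^sup>2) = 0"
    by (simp only: lc smult_diff_right diff_self)
  hence "n P * (n y)\<^sup>2 = n R * (n x)\<^sup>2" using nz x by simp
  from squarefree_decomp_unique[OF sqf[OF P] sqf[OF R] n(2)[OF nz(1)] n(2)[OF nz(2)] n(2)[OF y] n(2)[OF x] this]
  have "n P = n R" by simp
  hence "P = smult (?p / ?r) R"
    using n(1)[OF nz(1)] nz by (simp add: n_def divide_inverse)
  moreover have "?p / ?r = (?x / ?y)\<^sup>2" using lc nz x y by (simp add: field_simps)
  ultimately show ?thesis using x y by (intro exI[of _ "?x / ?y"]) simp
qed

lemma sqrt_not_rational: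
  fixes Q :: "'a::{field,finite} poly"
  assumes Q: "squarefree Q" "degree Q > 0" and y: "y\<^sup>2 = rf Q"
  shows "y \<notin> range to_ac"
proof
  assume "y \<in> range to_ac"
  then obtain b where b: "y = to_ac b" by auto
  have "to_ac (Fraction_Field.Fract Q 1) = to_ac (b\<^sup>2)" using y b by simp
  hence "Fraction_Field.Fract Q 1 = b\<^sup>2" by (simp only: to_ac_eq_iff)
  hence "Fraction_Field.Fract Q 1 = b\<^sup>2 * Fraction_Field.Fract 1 1"
    by (simp add: One_fract_def[symmetric])
  then obtain x z where "z \<noteq> 0" "Q * z\<^sup>2 = 1 * x\<^sup>2" by (rule Fract_eq_square_imp)
  from squarefree_ratio_square[OF Q(1) squarefree_1 this] obtain c where "Q = smult (c\<^sup>2) 1" by blast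
  thus False using Q(2) by simp
qed

definition quad_span :: "'a::{field,finite} ratfun alg_closure \<Rightarrow> 'a ratfun alg_closure set" where
  "quad_span y = {to_ac a + to_ac b * y | a b. True}"

lemma span_1_y: "ratfun_vs.span {1, y} = quad_span (y :: 'a::{field,finite} ratfun alg_closure)"
proof -
  have "ratfun_vs.span {1, y} = {x. \<exists>a b. x = to_ac a + to_ac b * y}"
    unfolding ratfun_vs.span_insert ratfun_vs.span_empty
    by (auto simp: algebra_simps)
  thus ?thesis by (auto simp: quad_span_def)
qed

lemma independent_1_y:
  assumes "y \<notin> range to_ac"
  shows "ratfun_vs.independent {1, y :: 'a::{field,finite} ratfun alg_closure}" and "card {1, y} = 2"
proof -
  have ne: "y \<noteq> 1" using assms by (metis rangeI to_ac_1)
  have "ratfun_vs.span {1} = range (to_ac :: 'a ratfun \<Rightarrow> _)"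
    by (auto simp: ratfun_vs.span_singleton)
  hence "y \<notin> ratfun_vs.span {1}" using assms by simp
  moreover have "ratfun_vs.independent {1 :: 'a ratfun alg_closure}"
    by (simp add: ratfun_vs.dependent_single)
  ultimately have "ratfun_vs.independent (insert y {1})" by (simp add: ratfun_vs.independent_insert)
  thus "ratfun_vs.independent {1, y}" by (simp add: insert_commute)
  show "card {1, y} = 2" using ne by auto
qed

text \<open>An element outside the span would make three independent elements in dimension
  2.\<close>

lemma quadratic_extension_eq_quad_span:
  fixes L :: "'a::{field,finite} ratfun alg_closure set"
  assumes L: "quadratic_extension L" and y: "y \<in> L" "y \<notin> range to_ac"
  shows "L = quad_span y"
proof
  have cl: "range to_ac \<subseteq> L" "\<And>x z. x \<in> L \<Longrightarrow> z \<in> L \<Longrightarrow> x - z \<in> L" "\<And>x z. x \<in> L \<Longrightarrow> z \<in> L \<Longrightarrow> x * z \<in> L"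
    and dim: "ratfun_vs.dim L = 2"
    using L by (auto simp: quadratic_extension_def)
  have add: "x + z \<in> L" if "x \<in> L" "z \<in> L" for x z
  proof -
    have "to_ac 0 \<in> L" using cl(1) by blast
    hence "0 - z \<in> L" using cl(2)[of 0 z] that by simp
    from cl(2)[OF that(1) this] show ?thesis by simp
  qed
  show "quad_span y \<subseteq> L"
  proof
    fix x assume "x \<in> quad_span y"
    then obtain a b where x: "x = to_ac a + to_ac b * y" by (auto simp: quad_span_def)
    have "to_ac a \<in> L" "to_ac b \<in> L" using cl(1) by auto
    thus "x \<in> L" unfolding x by (intro add cl(3) y(1))
  qed
  show "L \<subseteq> quad_span y"
  proof
    fix z assume z: "z \<in> L"
    obtain B where B: "B \<subseteq> L" "ratfun_vs.independent B" "L \<subseteq> ratfun_vs.span B" "card B = 2"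
      using ratfun_vs.basis_exists[of L] dim by metis
    have fB: "finite B" using B(4) by (metis card.infinite zero_neq_numeral)
    show "z \<in> quad_span y"
    proof (rule ccontr)
      assume nz: "z \<notin> quad_span y"
      hence "ratfun_vs.independent (insert z {1, y})"
        by (intro ratfun_vs.independent_insertI independent_1_y[OF y(2)]) (simp add: span_1_y)
      moreover have "insert z {1, y} \<subseteq> ratfun_vs.span B"
      proof -
        have "to_ac 1 \<in> L" using cl(1) by blast
        thus ?thesis using B(3) z y by auto
      qed
      ultimately have "card (insert z {1, y}) \<le> card B"
        using ratfun_vs.independent_span_bound[OF fB] by blast
      moreover have "z \<notin> {1, y}" using nz ratfun_vs.span_base span_1_y by blast
      hence "card (insert z {1, y}) = 3" using independent_1_y(2)[OF y(2)]
        by (subst card_insert_disjoint) auto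
      ultimately show False using B(4) by simp
    qed
  qed
qed

lemma mult_linear_forms:
  fixes a b c d y :: "'b::comm_ring_1"
  shows "(a + b * y) * (c + d * y) = a * c + (a * d + b * c) * y + b * d * y\<^sup>2"
  by (simp add: algebra_simps power2_eq_square)

text \<open>Inverses come from the norm: \<open>x\<close> times its conjugate lies in the base
  field, and it is not 0 because \<open>y\<close> is irrational.\<close>

lemma quad_span_quadratic_extension:
  fixes y :: "'a::{field,finite} ratfun alg_closure"
  assumes y2: "y\<^sup>2 = to_ac r" and y: "y \<notin> range to_ac"
  shows "quadratic_extension (quad_span y)"
  unfolding quadratic_extension_def
proof (intro conjI ballI)
  have mem: "to_ac a + to_ac b * y \<in> quad_span y" for a b by (auto simp: quad_span_def)
  show "range to_ac \<subseteq> quad_span y" using mem[of _ 0] by auto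
  have "ratfun_vs.dim (quad_span y) = card {1, y}"
    by (rule ratfun_vs.dim_unique) (use ratfun_vs.span_superset[of "{1, y}"] independent_1_y[OF y] in \<open>auto simp: span_1_y\<close>)
  thus "ratfun_vs.dim (quad_span y) = 2" using independent_1_y[OF y] by simp
  fix x assume "x \<in> quad_span y"
  then obtain a b where x: "x = to_ac a + to_ac b * y" by (auto simp: quad_span_def)
  show "inverse x \<in> quad_span y"
  proof (cases "x = 0")
    case True
    thus ?thesis using mem[of 0 0] by simp
  next
    case False
    have N: "x * (to_ac a - to_ac b * y) = to_ac (a\<^sup>2 - b\<^sup>2 * r)"
    proof -
      have "x * (to_ac a - to_ac b * y) = (to_ac a)\<^sup>2 - (to_ac b)\<^sup>2 * y\<^sup>2"
        by (simp add: x algebra_simps power2_eq_square)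
      thus ?thesis by (simp add: y2)
    qed
    have "a\<^sup>2 - b\<^sup>2 * r \<noteq> 0"
    proof
      assume "a\<^sup>2 - b\<^sup>2 * r = 0"
      hence e: "to_ac a = to_ac b * y" using N False by simp
      show False
      proof (cases "b = 0")
        case True
        thus False using e x False by simp
      next
        case F: False
        hence "y = to_ac (a / b)" using e by simp
        thus False using y by blast
      qed
    qed
    hence nz: "to_ac (a\<^sup>2 - b\<^sup>2 * r) \<noteq> 0" by (simp only: to_ac_eq_0_iff not_False_eq_True)
    have "x * ((to_ac a - to_ac b * y) / to_ac (a\<^sup>2 - b\<^sup>2 * r)) = 1"
      unfolding times_divide_eq_right N using nz by (rule divide_self)
    hence "inverse x = (to_ac a - to_ac b * y) / to_ac (a\<^sup>2 - b\<^sup>2 * r)" by (rule inverse_unique)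
    also have "\<dots> = to_ac (a / (a\<^sup>2 - b\<^sup>2 * r)) + to_ac (- b / (a\<^sup>2 - b\<^sup>2 * r)) * y"
      by (simp only: to_ac_divide to_ac_minus diff_divide_distrib) simp
    finally show ?thesis by (simp only: mem)
  qed
  fix z assume "z \<in> quad_span y"
  then obtain c d where z: "z = to_ac c + to_ac d * y" by (auto simp: quad_span_def)
  have "x - z = to_ac (a - c) + to_ac (b - d) * y" by (simp add: x z algebra_simps)
  thus "x - z \<in> quad_span y" using mem by metis
  have "x * z = to_ac a * to_ac c + (to_ac a * to_ac d + to_ac b * to_ac c) * y + to_ac b * to_ac d * y\<^sup>2"
    unfolding x z by (rule mult_linear_forms)
  also have "\<dots> = to_ac (a * c + b * d * r) + to_ac (a * d + b * c) * y"
    by (simp only: y2 to_ac_add to_ac_mult add_ac)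
  finally show "x * z \<in> quad_span y" using mem by metis
qed

context odd_field
begin

section \<open>Extensions of genus \<open>g\<close> and their models\<close>

lemma two_ratfun_neq_0: "(2 :: 'a ratfun alg_closure) \<noteq> 0"
proof
  assume "(2 :: 'a ratfun alg_closure) = 0"
  hence "to_ac (2 :: 'a ratfun) = 0" by simp
  hence "(2 :: 'a ratfun) = 0" by (simp only: to_ac_eq_0_iff)
  moreover have "(2 :: 'a ratfun) = Fraction_Field.Fract 2 1"
    by (metis one_add_one One_fract_def add_fract mult_1 mult_1_right one_neq_zero)
  ultimately have "(2 :: 'a poly) = 0" by (simp add: Zero_fract_def eq_fract)
  hence "(2 :: 'a) = 0" by (simp add: numeral_poly)
  hence "to_ac (2 :: 'a) = 0" by simp
  thus False using two_neq_0 by simp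
qed

lemma exists_quad_ext:
  assumes Q: "Q \<in> hyper_polys g"
  shows "\<exists>L :: 'a ratfun alg_closure set. L \<in> quad_exts g \<and> hyperelliptic_model g L Q"
proof -
  obtain y :: "'a ratfun alg_closure" where y: "y\<^sup>2 = rf Q" using nth_root_exists[of 2 "rf Q"] by auto
  have sq: "squarefree Q" "degree Q > 0" using Q by (auto simp: hyper_polys_def)
  have "y = to_ac 0 + to_ac 1 * y" by simp
  hence yL: "y \<in> quad_span y" unfolding quad_span_def by blast
  have "quadratic_extension (quad_span y)"
    by (rule quad_span_quadratic_extension[OF y sqrt_not_rational[OF sq y]])
  moreover have "hyperelliptic_model g (quad_span y) Q"
    using Q yL y by (auto simp: hyperelliptic_model_def hyper_polys_def)
  ultimately show ?thesis by (auto simp: quad_exts_def)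
qed

text \<open>Two square roots of the same \<open>Q\<close> differ by a sign and hence generate the
  same field.\<close>

lemma quad_ext_unique:
  fixes L L' :: "'a ratfun alg_closure set"
  assumes L: "L \<in> quad_exts g" "hyperelliptic_model g L Q"
    and L': "L' \<in> quad_exts g" "hyperelliptic_model g L' Q"
  shows "L = L'"
proof -
  obtain y where y: "y \<in> L" "y\<^sup>2 = rf Q" using L(2) by (auto simp: hyperelliptic_model_def)
  obtain z where z: "z \<in> L'" "z\<^sup>2 = rf Q" using L'(2) by (auto simp: hyperelliptic_model_def)
  have sq: "squarefree Q" "degree Q > 0" using L(2) by (auto simp: hyperelliptic_model_def)
  have e: "L = quad_span y" "L' = quad_span z"
    using L(1) L'(1) quadratic_extension_eq_quad_span[OF _ y(1) sqrt_not_rational[OF sq y(2)]]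
      quadratic_extension_eq_quad_span[OF _ z(1) sqrt_not_rational[OF sq z(2)]]
    by (auto simp: quad_exts_def)
  have "z\<^sup>2 = y\<^sup>2" using y z by simp
  hence "z = y \<or> z = - y" by (simp only: power2_eq_iff)
  moreover have "quad_span (- y) = quad_span y"
    unfolding quad_span_def by safe (metis minus_mult_minus to_ac_minus minus_minus)+
  ultimately show ?thesis using e by auto
qed

text \<open>An element \<open>a + b * y\<close> with rational square has \<open>a * b = 0\<close>,
  and \<open>b\<close> is not 0 because a square root of \<open>R\<close> is irrational. So
  \<open>R\<close> is \<open>Q\<close> times the square of a rational function, and square-freeness
  makes it the square of a constant.\<close>

lemma hyperelliptic_models_eq:
  fixes L :: "'a ratfun alg_closure set"
  assumes L: "L \<in> quad_exts g" "hyperelliptic_model g L Q"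
  shows "{R. hyperelliptic_model g L R} = {smult (c\<^sup>2) Q | c. c \<noteq> 0}"
proof (intro equalityI subsetI)
  obtain y where y: "y \<in> L" "y\<^sup>2 = rf Q" using L(2) by (auto simp: hyperelliptic_model_def)
  have sq: "squarefree Q" "degree Q > 0" using L(2) by (auto simp: hyperelliptic_model_def)
  have yr: "y \<notin> range to_ac" by (rule sqrt_not_rational[OF sq y(2)])
  have qe: "quadratic_extension L" using L(1) by (simp add: quad_exts_def)
  have Ls: "L = quad_span y" by (rule quadratic_extension_eq_quad_span[OF qe y(1) yr])
  {
    fix R assume "R \<in> {R. hyperelliptic_model g L R}"
    then obtain z where z: "z \<in> L" "z\<^sup>2 = rf R" and R: "squarefree R" "degree R > 0"
      by (auto simp: hyperelliptic_model_def)
    obtain a b where ab: "z = to_ac a + to_ac b * y" using z(1) Ls by (auto simp: quad_span_def)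
    have zz: "rf R = to_ac (a\<^sup>2 + b\<^sup>2 * Fraction_Field.Fract Q 1) + 2 * to_ac (a * b) * y"
    proof -
      have "z\<^sup>2 = (to_ac a)\<^sup>2 + (to_ac b)\<^sup>2 * y\<^sup>2 + 2 * (to_ac a * to_ac b) * y"
        unfolding ab power2_eq_square[of "_ + _"] mult_linear_forms
        by (simp add: power2_eq_square distrib_right mult.commute[of "to_ac b" "to_ac a"])
      thus ?thesis by (simp add: z(2) y(2))
    qed
    have "a * b = 0"
    proof (rule ccontr)
      assume "a * b \<noteq> 0"
      hence "to_ac (2 * (a * b)) \<noteq> 0" using two_ratfun_neq_0 by simp
      moreover have "to_ac (2 * (a * b)) * y =
          to_ac (Fraction_Field.Fract R 1 - (a\<^sup>2 + b\<^sup>2 * Fraction_Field.Fract Q 1))"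
        using zz by simp
      ultimately have "y = to_ac ((Fraction_Field.Fract R 1 - (a\<^sup>2 + b\<^sup>2 * Fraction_Field.Fract Q 1)) / (2 * (a * b)))"
        unfolding to_ac_divide by (metis nonzero_mult_div_cancel_left)
      thus False using yr by blast
    qed
    moreover have "b \<noteq> 0" using sqrt_not_rational[OF R z(2)] ab by auto
    ultimately have a0: "a = 0" by simp
    have "to_ac (Fraction_Field.Fract R 1) = to_ac (b\<^sup>2 * Fraction_Field.Fract Q 1)" using zz a0 by simp
    hence "Fraction_Field.Fract R 1 = b\<^sup>2 * Fraction_Field.Fract Q 1" by (simp only: to_ac_eq_iff)
    then obtain x w where "w \<noteq> 0" "R * w\<^sup>2 = Q * x\<^sup>2" by (rule Fract_eq_square_imp)
    from squarefree_ratio_square[OF R(1) sq(1) this]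
    show "R \<in> {smult (c\<^sup>2) Q | c. c \<noteq> 0}" by auto
  next
    fix R assume "R \<in> {smult (c\<^sup>2) Q | c. c \<noteq> 0}"
    then obtain c where c: "c \<noteq> 0" "R = smult (c\<^sup>2) Q" by auto
    have "squarefree R"
    proof (rule squarefreeI)
      fix h assume "h\<^sup>2 dvd R"
      hence "h\<^sup>2 dvd Q" using c by (simp add: dvd_smult_iff)
      thus "is_unit h" using sq(1) by (simp add: squarefree_def)
    qed
    moreover have "degree R = degree Q" using c by simp
    moreover have "to_ac (Fraction_Field.Fract [:c:] 1) * y \<in> L"
      using qe y(1) by (auto simp: quadratic_extension_def)
    moreover have "(to_ac (Fraction_Field.Fract [:c:] 1) * y)\<^sup>2 = rf R"
    proof -
      have "(to_ac (Fraction_Field.Fract [:c:] 1) * y)\<^sup>2 =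
          to_ac ((Fraction_Field.Fract [:c:] 1)\<^sup>2 * Fraction_Field.Fract Q 1)"
        by (simp add: power_mult_distrib y(2))
      also have "(Fraction_Field.Fract [:c:] 1)\<^sup>2 * Fraction_Field.Fract Q 1 = Fraction_Field.Fract R 1"
        by (simp add: c(2) power2_eq_square)
      finally show ?thesis .
    qed
    ultimately show "R \<in> {R. hyperelliptic_model g L R}"
      using L(2) unfolding hyperelliptic_model_def by auto
  }
qed

lemma finite_hyper_polys [simp]: "finite (hyper_polys g)"
proof (rule finite_subset)
  show "hyper_polys g \<subseteq> polys_lt (2 * g + 3)" by (auto simp: hyper_polys_def polys_lt_def)
qed simp

text \<open>Every extension has the same number of models, one for each non-zero square of the base
  field, and the invariance of \<open>f\<close> removes the dependence on the model chosen by
  \<open>SOME\<close>.\<close>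

lemma average_quad_exts:
  fixes f :: "'a poly \<Rightarrow> complex"
  assumes inv: "\<And>c Q. c \<noteq> 0 \<Longrightarrow> Q \<in> hyper_polys g \<Longrightarrow> f (smult (c\<^sup>2) Q) = f Q"
  shows "average (quad_exts g) (\<lambda>L. f (SOME Q. hyperelliptic_model g L Q)) = average (hyper_polys g) f"
proof -
  let ?E = "quad_exts g :: 'a ratfun alg_closure set set"
  define M where "M = (\<lambda>L :: 'a ratfun alg_closure set. {R. hyperelliptic_model g L R})"
  define h where "h = card ((\<lambda>c. c\<^sup>2) ` (UNIV - {0 :: 'a}))"
  have "(1 :: 'a) \<in> UNIV - {0}" by simp
  hence "(\<lambda>c. c\<^sup>2) ` (UNIV - {0 :: 'a}) \<noteq> {}" by blast
  hence h: "h \<noteq> 0" unfolding h_def by (simp only: card_eq_0_iff) simp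
  have HM: "hyper_polys g = (\<Union>L\<in>?E. M L)"
  proof (intro equalityI subsetI)
    fix Q assume "Q \<in> hyper_polys g"
    thus "Q \<in> (\<Union>L\<in>?E. M L)" using exists_quad_ext by (auto simp: M_def)
  next
    fix Q assume "Q \<in> (\<Union>L\<in>?E. M L)"
    thus "Q \<in> hyper_polys g" by (auto simp: M_def hyperelliptic_model_def hyper_polys_def)
  qed
  have ex: "\<exists>Q. hyperelliptic_model g L Q" if "L \<in> ?E" for L using that by (auto simp: quad_exts_def)
  have some: "hyperelliptic_model g L (SOME Q. hyperelliptic_model g L Q)" if "L \<in> ?E" for L
    using ex[OF that] by (rule someI_ex)
  have finE: "finite ?E"
  proof (rule inj_on_finite)
    show "inj_on (\<lambda>L. SOME Q. hyperelliptic_model g L Q) ?E"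
      by (rule inj_onI) (metis quad_ext_unique some)
    show "(\<lambda>L. SOME Q. hyperelliptic_model g L Q) ` ?E \<subseteq> hyper_polys g"
      using some by (auto simp: hyperelliptic_model_def hyper_polys_def)
  qed simp
  have fM: "finite (M L)" if "L \<in> ?E" for L
    by (rule finite_subset[OF _ finite_hyper_polys[of g]]) (use that HM in blast)
  have dj: "M L \<inter> M L' = {}" if "L \<in> ?E" "L' \<in> ?E" "L \<noteq> L'" for L L'
    using that quad_ext_unique by (auto simp: M_def)
  have sumM: "(\<Sum>Q\<in>M L. f Q) = of_nat h * f (SOME Q. hyperelliptic_model g L Q)" and cardM: "card (M L) = h"
    if L: "L \<in> ?E" for L
  proof -
    define Q where "Q = (SOME Q. hyperelliptic_model g L Q)"
    have m: "hyperelliptic_model g L Q" unfolding Q_def by (rule some[OF L])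
    have QH: "Q \<in> hyper_polys g" using m by (auto simp: hyperelliptic_model_def hyper_polys_def)
    hence Q0: "Q \<noteq> 0" by (auto simp: hyper_polys_def)
    have Me: "M L = (\<lambda>c. smult c Q) ` ((\<lambda>c. c\<^sup>2) ` (UNIV - {0 :: 'a}))"
      unfolding M_def hyperelliptic_models_eq[OF L m] by auto
    have "inj_on (\<lambda>c. smult c Q) ((\<lambda>c. c\<^sup>2) ` (UNIV - {0 :: 'a}))"
    proof (rule inj_onI)
      fix c d assume "smult c Q = smult d Q"
      hence "smult (c - d) Q = 0" by (simp add: smult_diff_left)
      thus "c = d" using Q0 by simp
    qed
    thus card: "card (M L) = h" unfolding Me h_def by (rule card_image)
    have "(\<Sum>R\<in>M L. f R) = (\<Sum>R\<in>M L. f Q)"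
      by (rule sum.cong) (use inv QH in \<open>auto simp: Me\<close>)
    thus "(\<Sum>Q\<in>M L. f Q) = of_nat h * f Q" by (simp add: card)
  qed
  have "(\<Sum>Q\<in>hyper_polys g. f Q) = (\<Sum>L\<in>?E. \<Sum>Q\<in>M L. f Q)"
    unfolding HM by (rule sum.UNION_disjoint[OF finE]) (use fM dj in auto)
  also have "\<dots> = of_nat h * (\<Sum>L\<in>?E. f (SOME Q. hyperelliptic_model g L Q))"
    by (simp add: sumM sum_distrib_left)
  finally have s: "(\<Sum>Q\<in>hyper_polys g. f Q) = of_nat h * (\<Sum>L\<in>?E. f (SOME Q. hyperelliptic_model g L Q))" .
  have "card (hyper_polys g) = (\<Sum>L\<in>?E. card (M L))"
    unfolding HM by (rule card_UN_disjoint[OF finE]) (use fM dj in auto)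
  also have "\<dots> = card ?E * h" by (simp add: cardM)
  finally show ?thesis using h s by (simp add: average_def)
qed

end

subsection \<open>The average trace\<close>

text \<open>The exponent 5 collects \<open>(n + 1)^4\<close> and one factor linear in
  \<open>g\<close> from the final error. The estimate is
  \<open>(1 + y/5)^5 \<le> exp y\<close>.\<close>

lemma polynomial_le_exponential:
  fixes q \<epsilon> :: real
  assumes q: "q > 1" and \<epsilon>: "\<epsilon> > 0"
  shows "\<exists>K\<ge>0. \<forall>x::nat. (real x + 1) ^ 5 \<le> K * q powr (\<epsilon> * real x)"
proof -
  define c where "c = \<epsilon> * ln q"
  have c: "c > 0" using q \<epsilon> by (simp add: c_def)
  have "(real x + 1) ^ 5 \<le> (5 / c) ^ 5 * exp c * q powr (\<epsilon> * real x)" for x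
  proof -
    let ?y = "c * (real x + 1)"
    have y: "?y \<ge> 0" using c by simp
    have "(?y / 5) ^ 5 \<le> (1 + ?y / real 5) ^ 5" using y by (intro power_mono) auto
    also have "\<dots> \<le> exp ?y" by (rule exp_ge_one_plus_x_over_n_power_n) (use y in auto)
    finally have "(?y / 5) ^ 5 \<le> exp ?y" .
    hence "(5 / c) ^ 5 * (?y / 5) ^ 5 \<le> (5 / c) ^ 5 * exp ?y"
      using c by (intro mult_left_mono) auto
    moreover have "(5 / c) ^ 5 * (?y / 5) ^ 5 = (real x + 1) ^ 5"
      using c by (simp flip: power_mult_distrib)
    moreover have "exp ?y = exp c * q powr (\<epsilon> * real x)"
      using q by (simp add: powr_def c_def distrib_left exp_add mult_ac)
    ultimately show ?thesis by simp
  qed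
  moreover have "(5 / c) ^ 5 * exp c \<ge> 0" using c by simp
  ultimately show ?thesis by blast
qed

context odd_field
begin

section \<open>Reduction to monic square-free polynomials\<close>

lemma leg_mult: "leg (c * d) = leg c * leg d"
  unfolding leg_def to_ac_mult by (rule chi_mult[OF order_refl to_ac_in_ext_field to_ac_in_ext_field])

lemma leg_0 [simp]: "leg 0 = 0" and leg_1 [simp]: "leg 1 = 1"
proof -
  show "leg 0 = 0" using chi_eq_0_iff[of 1 0] by (simp add: leg_def)
  show "leg 1 = 1" by (simp add: leg_def chi_def)
qed

lemma trace_sum_smult:
  assumes n: "n \<ge> 1"
  shows "trace_sum g (smult c Q) n = leg c ^ n * trace_sum g Q n"
proof -
  have "chi_sum (smult c Q) n = leg c ^ n * chi_sum Q n"
    unfolding chi_sum_def sum_chi_ev[OF n] sum_distrib_left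
  proof (rule sum.cong)
    fix v :: "'a poly" assume "v \<in> places_dvd n"
    hence v: "monic v" "degree v dvd n" by (auto simp: places_dvd_def finite_places_def)
    have "sy v (smult c Q) ^ (n div degree v) =
        leg c ^ (degree v * (n div degree v)) * sy v Q ^ (n div degree v)"
      by (simp add: sy_smult[OF v(1)] power_mult_distrib power_mult)
    also have "degree v * (n div degree v) = n" using v(2) by simp
    finally show "real (degree v) * sy v (smult c Q) ^ (n div degree v) =
        leg c ^ n * (real (degree v) * sy v Q ^ (n div degree v))"
      by simp
  qed simp
  thus ?thesis by (simp add: trace_sum_def leg_mult power_mult_distrib distrib_left)
qed

lemma smult_hyper_polys: "c \<noteq> 0 \<Longrightarrow> smult c Q \<in> hyper_polys g \<longleftrightarrow> Q \<in> hyper_polys g"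
proof -
  assume c: "c \<noteq> 0"
  have "squarefree (smult c Q) \<longleftrightarrow> squarefree Q"
    using c by (auto simp: squarefree_def dvd_smult_iff)
  thus ?thesis using c by (simp add: hyper_polys_def)
qed

lemma average_quad_exts_trace:
  assumes n: "n \<ge> 1"
  shows "average (quad_exts g :: 'a ratfun alg_closure set set)
      (\<lambda>L. - complex_of_real (real CARD('a) powr (real n / 2)) * tr_Theta g L n) =
    complex_of_real ((\<Sum>Q\<in>hyper_polys g. trace_sum g Q n) / real (card (hyper_polys g)))"
proof -
  have "average (quad_exts g :: 'a ratfun alg_closure set set)
      (\<lambda>L. - complex_of_real (real CARD('a) powr (real n / 2)) * tr_Theta g L n) =
    average (quad_exts g :: 'a ratfun alg_closure set set)
      (\<lambda>L. complex_of_real (trace_sum g (SOME Q. hyperelliptic_model g L Q) n))"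
    unfolding average_def
    by (intro arg_cong2[of _ _ _ _ "(/)"] sum.cong tr_Theta_trace_sum n refl) (auto simp: quad_exts_def)
  also have "\<dots> = average (hyper_polys g) (\<lambda>Q. complex_of_real (trace_sum g Q n))"
  proof (rule average_quad_exts)
    fix c :: 'a and Q :: "'a poly" assume "c \<noteq> 0"
    hence "leg (c\<^sup>2) = 1" using leg_nonzero_square[of c] by (simp add: power2_eq_square leg_mult)
    thus "complex_of_real (trace_sum g (smult (c\<^sup>2) Q) n) = complex_of_real (trace_sum g Q n)"
      by (simp add: trace_sum_smult[OF n])
  qed
  finally show ?thesis by (simp add: average_def)
qed

text \<open>Twisting by a non-square constant permutes the family and reverses the sign of odd
  traces.\<close>

lemma sum_trace_odd:
  assumes n: "odd n"
  shows "(\<Sum>Q\<in>hyper_polys g. trace_sum g Q n) = 0"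
proof -
  have n1: "n \<ge> 1" using n by (cases n) auto
  obtain c where c: "c \<noteq> 0" "leg c = - 1" using exists_leg_minus_1 by blast
  have "bij_betw (smult c) (hyper_polys g) (hyper_polys g)"
    by (rule bij_betw_byWitness[where f' = "smult (inverse c)"]) (use c in \<open>auto simp: smult_hyper_polys\<close>)
  hence "(\<Sum>Q\<in>hyper_polys g. trace_sum g Q n) = (\<Sum>Q\<in>hyper_polys g. trace_sum g (smult c Q) n)"
    by (rule sum.reindex_bij_betw[symmetric])
  also have "\<dots> = - (\<Sum>Q\<in>hyper_polys g. trace_sum g Q n)"
    using n by (simp add: trace_sum_smult[OF n1] c sum_negf)
  finally show ?thesis by simp
qed

definition hyper_monics :: "nat \<Rightarrow> 'a poly set" where
  "hyper_monics g = sqfree_monics (2 * g + 1) \<union> sqfree_monics (2 * g + 2)"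

lemma sqfree_monics_disjoint: "m \<noteq> n \<Longrightarrow> sqfree_monics m \<inter> sqfree_monics n = {}"
  by (auto simp: sqfree_monics_def monics_def)

lemma sum_hyper_monics:
  fixes F :: "'a poly \<Rightarrow> real"
  shows "(\<Sum>Q\<in>hyper_monics g. F Q) = (\<Sum>Q\<in>sqfree_monics (2 * g + 2). F Q) + (\<Sum>Q\<in>sqfree_monics (2 * g + 1). F Q)"
  unfolding hyper_monics_def
  by (subst sum.union_disjoint) (use sqfree_monics_disjoint[of "2 * g + 1" "2 * g + 2"] in auto)

lemma card_hyper_monics: "real (card (hyper_monics g)) = pair_count (2 * g + 2) TYPE('a)"
  using sum_hyper_monics[of "\<lambda>_. 1" g] by (simp add: pair_count_def)

lemma bij_betw_hyper_monics:
  "bij_betw (\<lambda>(c, D). smult c D) ((UNIV - {0}) \<times> hyper_monics g) (hyper_polys g)"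
proof (rule bij_betw_byWitness[where f' = "\<lambda>f. (lead_coeff f, smult (inverse (lead_coeff f)) f)"])
  have mem: "D \<in> hyper_monics g \<longleftrightarrow> D \<in> hyper_polys g \<and> monic D" for D
    by (auto simp: hyper_monics_def hyper_polys_def sqfree_monics_def monics_def)
  show "\<forall>x\<in>(UNIV - {0}) \<times> hyper_monics g.
      (\<lambda>f. (lead_coeff f, smult (inverse (lead_coeff f)) f)) (case x of (c, D) \<Rightarrow> smult c D) = x"
    by (auto simp: mem)
  show "(\<lambda>(c, D). smult c D) ` ((UNIV - {0}) \<times> hyper_monics g) \<subseteq> hyper_polys g"
    using smult_hyper_polys by (force simp: mem)
  have l0: "lead_coeff f \<noteq> 0" if "f \<in> hyper_polys g" for f
    using that by (auto simp: hyper_polys_def)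
  show "\<forall>f\<in>hyper_polys g. (case (lead_coeff f, smult (inverse (lead_coeff f)) f) of (c, D) \<Rightarrow> smult c D) = f"
    using l0 by auto
  show "(\<lambda>f. (lead_coeff f, smult (inverse (lead_coeff f)) f)) ` hyper_polys g \<subseteq>
      (UNIV - {0}) \<times> hyper_monics g"
  proof (rule image_subsetI)
    fix f assume f: "f \<in> hyper_polys g"
    have "smult (inverse (lead_coeff f)) f \<in> hyper_polys g"
      using f l0[OF f] smult_hyper_polys[of "inverse (lead_coeff f)" f g] by simp
    thus "(lead_coeff f, smult (inverse (lead_coeff f)) f) \<in> (UNIV - {0}) \<times> hyper_monics g"
      using l0[OF f] by (simp add: mem)
  qed
qed

text \<open>An even trace does not see a constant factor, so the \<open>q - 1\<close> leading
  coefficients cancel from numerator and denominator.\<close>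

lemma average_trace_even:
  assumes n: "even n" "n \<ge> 1"
  shows "(\<Sum>Q\<in>hyper_polys g. trace_sum g Q n) / real (card (hyper_polys g)) =
    (\<Sum>Q\<in>hyper_monics g. trace_sum g Q n) / pair_count (2 * g + 2) TYPE('a)"
proof -
  let ?c = "real CARD('a) - 1"
  have c: "?c \<noteq> 0" using card_ge_3 by simp
  have cu: "real (card (UNIV - {0 :: 'a})) = ?c" by (simp add: card_Diff_singleton of_nat_diff)
  have "(\<Sum>Q\<in>hyper_polys g. trace_sum g Q n) =
      (\<Sum>(c, D)\<in>(UNIV - {0 :: 'a}) \<times> hyper_monics g. trace_sum g (smult c D) n)"
    using sum.reindex_bij_betw[OF bij_betw_hyper_monics, of "\<lambda>Q. trace_sum g Q n" g]
      by (simp add: case_prod_unfold)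
  also have "\<dots> = (\<Sum>c\<in>UNIV - {0 :: 'a}. \<Sum>D\<in>hyper_monics g. trace_sum g (smult c D) n)"
    by (rule sum.cartesian_product[symmetric])
  also have "\<dots> = (\<Sum>c\<in>UNIV - {0 :: 'a}. \<Sum>D\<in>hyper_monics g. trace_sum g D n)"
  proof (intro sum.cong refl)
    fix c :: 'a and D assume "c \<in> UNIV - {0}"
    hence "leg c ^ n = 1" using n(1) leg_nonzero_square[of c] by (auto elim!: evenE simp: power_mult)
    thus "trace_sum g (smult c D) n = trace_sum g D n" by (simp add: trace_sum_smult[OF n(2)])
  qed
  also have "\<dots> = ?c * (\<Sum>D\<in>hyper_monics g. trace_sum g D n)" by (simp only: sum_constant cu)
  finally have s: "(\<Sum>Q\<in>hyper_polys g. trace_sum g Q n) = ?c * (\<Sum>D\<in>hyper_monics g. trace_sum g D n)" .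
  have "card (hyper_polys g) = card (UNIV - {0 :: 'a}) * card (hyper_monics g)"
    using bij_betw_same_card[OF bij_betw_hyper_monics[of g]] by (simp only: card_cartesian_product)
  hence "real (card (hyper_polys g)) = ?c * pair_count (2 * g + 2) TYPE('a)"
    by (simp only: of_nat_mult cu card_hyper_monics)
  thus ?thesis using c s by simp
qed

section \<open>Main terms and error terms\<close>

lemma pair_count_ge: "pair_count (2 * g + 2) TYPE('a) \<ge> real CARD('a) ^ (2 * g + 2) / 2"
proof -
  have "2 * 1 \<le> real CARD('a) * real CARD('a)" using card_ge_3 by (intro mult_mono) auto
  hence "2 * real CARD('a) ^ (2 * g) \<le> real CARD('a) * real CARD('a) * real CARD('a) ^ (2 * g)"
    by (intro mult_right_mono) auto
  thus ?thesis unfolding pair_count_even by (auto simp: mult_ac)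
qed

lemma sum_degree_one_places: "(\<Sum>v\<in>(places_dvd 1 :: 'a poly set). real (degree v) / (1 + real CARD('a) ^ degree v)) =
    real CARD('a) / (1 + real CARD('a))"
proof -
  have d1: "degree v = 1" if "v \<in> places_dvd 1" for v :: "'a poly" using that by (auto simp: places_dvd_def)
  have "(\<Sum>v\<in>(places_dvd 1 :: 'a poly set). degree v) = CARD('a)"
    using sum_degree_places_dvd[of 1, where 'a='a] by simp
  hence "card (places_dvd 1 :: 'a poly set) = CARD('a)" using d1 by simp
  thus ?thesis using d1 by simp
qed

lemma sum_sy_powers:
  fixes v :: "'a poly"
  assumes v: "v \<in> finite_places" and k: "k \<ge> 1"
  shows "(\<Sum>D\<in>hyper_monics g. sy v D ^ k) =
    (if even k then coprime_pair_count v (2 * g + 2) else sqfree_sum v (2 * g + 2) + sqfree_sum v (2 * g + 1))"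
proof (cases "even k")
  case True
  then obtain j where j: "k = 2 * j" by (elim evenE)
  have "sy v D ^ k = (if v dvd D then 0 else 1)" for D
    using sy_place_square[OF v, of D] k by (simp add: j power_mult power_0_left)
  hence "(\<Sum>D\<in>sqfree_monics m. sy v D ^ k) = real (coprime_count v m)" for m
    by (simp add: coprime_count_def sum.If_cases Int_def)
  thus ?thesis using True by (simp add: sum_hyper_monics coprime_pair_count_def)
next
  case False
  have "sy v D ^ k = sy v D" for D
    using sy_values[of v D] False k by (auto simp: power_0_left)
  thus ?thesis using False by (simp add: sum_hyper_monics sqfree_sum_def)
qed

text \<open>\<open>n / degree v\<close> is even exactly when \<open>degree v\<close> divides
  \<open>n / 2\<close>, which decides between coprimality counts and genuine character sums. The
  last term is the place at infinity.\<close>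

lemma sum_trace_even:
  assumes n: "even n" "n \<ge> 1"
  shows "(\<Sum>Q\<in>hyper_monics g. trace_sum g Q n) =
    (\<Sum>v\<in>(places_dvd (n div 2) :: 'a poly set). real (degree v) * coprime_pair_count v (2 * g + 2)) +
    (\<Sum>v\<in>(places_dvd n - places_dvd (n div 2) :: 'a poly set). real (degree v) * (sqfree_sum v (2 * g + 2) + sqfree_sum v (2 * g + 1))) +
    real (card (sqfree_monics (2 * g + 2) :: 'a poly set))" (is "_ = ?A + ?B + _")
proof -
  let ?F = "\<lambda>v :: 'a poly. real (degree v) * (\<Sum>Q\<in>hyper_monics g. sy v Q ^ (n div degree v))"
  have n2: "n div 2 \<ge> 1" "n = 2 * (n div 2)" using n by auto
  have sub: "places_dvd (n div 2) \<subseteq> (places_dvd n :: 'a poly set)"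
    using n2(2) by (auto simp: places_dvd_def)
  have par: "even (n div degree v) \<longleftrightarrow> v \<in> places_dvd (n div 2)" if "v \<in> places_dvd n" for v :: "'a poly"
  proof -
    have v: "v \<in> finite_places" "degree v dvd n" using that by (auto simp: places_dvd_def)
    obtain m where m: "n = degree v * m" using v(2) by (elim dvdE)
    have d: "degree v > 0" using place_degree_pos[OF v(1)] .
    have "even m \<longleftrightarrow> degree v dvd n div 2"
    proof
      assume "even m"
      then obtain j where "m = 2 * j" by (elim evenE)
      thus "degree v dvd n div 2" using m by simp
    next
      assume "degree v dvd n div 2"
      then obtain j where "n div 2 = degree v * j" by (elim dvdE)
      moreover have "degree v * m = 2 * (n div 2)" by (rule trans[OF m[symmetric] n2(2)])
      ultimately have "degree v * m = degree v * (2 * j)" by (simp only: mult.left_commute)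
      hence "m = 2 * j" using nat_mult_eq_cancel1[OF d] by blast
      thus "even m" by simp
    qed
    thus ?thesis using m d v by (simp add: places_dvd_def)
  qed
  have k1: "n div degree v \<ge> 1" if "v \<in> places_dvd n" for v :: "'a poly"
  proof -
    have v: "v \<in> finite_places" "degree v dvd n" using that by (auto simp: places_dvd_def)
    have "degree v \<le> n" using v(2) n(2) by (intro dvd_imp_le) auto
    thus ?thesis using place_degree_pos[OF v(1)] by (simp add: Suc_le_eq div_greater_zero_iff)
  qed
  have "(\<Sum>Q\<in>hyper_monics g. leg (coeff Q (2 * g + 2)) ^ n) =
      real (card (sqfree_monics (2 * g + 2) :: 'a poly set))"
  proof -
    have "(\<Sum>Q\<in>sqfree_monics (2 * g + 2). leg (coeff Q (2 * g + 2)) ^ n) =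
        (\<Sum>Q\<in>(sqfree_monics (2 * g + 2) :: 'a poly set). 1)"
      by (rule sum.cong) (auto simp: sqfree_monics_def monics_def)
    moreover have "(\<Sum>Q\<in>sqfree_monics (2 * g + 1). leg (coeff Q (2 * g + 2)) ^ n) =
        (\<Sum>Q\<in>(sqfree_monics (2 * g + 1) :: 'a poly set). 0)"
    proof (rule sum.cong)
      fix Q :: "'a poly" assume "Q \<in> sqfree_monics (2 * g + 1)"
      hence "coeff Q (2 * g + 2) = 0" by (intro coeff_eq_0) (auto simp: sqfree_monics_def monics_def)
      thus "leg (coeff Q (2 * g + 2)) ^ n = 0" using n(2) by (simp add: power_0_left)
    qed simp
    ultimately show ?thesis by (simp add: sum_hyper_monics)
  qed
  moreover have "(\<Sum>Q\<in>hyper_monics g. chi_sum Q n) = (\<Sum>v\<in>places_dvd n. ?F v)"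
    unfolding chi_sum_def sum_chi_ev[OF n(2)] sum_distrib_left by (rule sum.swap)
  moreover have "\<dots> = (\<Sum>v\<in>places_dvd (n div 2). ?F v) + (\<Sum>v\<in>places_dvd n - places_dvd (n div 2). ?F v)"
    using sum.subset_diff[OF sub finite_places_dvd[OF n(2)]] by (simp add: add.commute)
  ultimately have main: "(\<Sum>Q\<in>hyper_monics g. trace_sum g Q n) =
      (\<Sum>v\<in>places_dvd (n div 2). ?F v) + (\<Sum>v\<in>places_dvd n - places_dvd (n div 2). ?F v) +
      real (card (sqfree_monics (2 * g + 2) :: 'a poly set))"
    by (simp add: trace_sum_def sum.distrib)
  have F: "?F v = real (degree v) * (if v \<in> places_dvd (n div 2) then coprime_pair_count v (2 * g + 2)
      else sqfree_sum v (2 * g + 2) + sqfree_sum v (2 * g + 1))" if v: "v \<in> places_dvd n" for v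
  proof -
    have "v \<in> finite_places" using v by (simp add: places_dvd_def)
    from sum_sy_powers[OF this k1[OF v], of g] show ?thesis by (simp only: par[OF v])
  qed
  have "(\<Sum>v\<in>places_dvd (n div 2). ?F v) = ?A" "(\<Sum>v\<in>places_dvd n - places_dvd (n div 2). ?F v) = ?B"
    by (rule sum.cong[OF refl], subst F, use sub in \<open>auto split: if_splits\<close>)+
  thus ?thesis unfolding main by simp
qed

text \<open>Replace each count by its density \<open>1 - 1 / (1 + q^d)\<close>. The degrees add up
  to \<open>q^k\<close>, which yields both the leading term and the total weight of the errors
  9.\<close>

lemma coprime_main_term:
  assumes k: "k \<ge> 1"
  shows "\<bar>(\<Sum>v\<in>(places_dvd k :: 'a poly set). real (degree v) * coprime_pair_count v N) -
      pair_count N TYPE('a) * (real CARD('a) ^ k - (\<Sum>v\<in>(places_dvd k :: 'a poly set). real (degree v) / (1 + real CARD('a) ^ degree v)))\<bar>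
    \<le> 9 * real CARD('a) ^ k"
proof -
  let ?A = "pair_count N TYPE('a)" and ?q = "real CARD('a)"
  have deg: "(\<Sum>v\<in>(places_dvd k :: 'a poly set). real (degree v)) = ?q ^ k"
    using arg_cong[OF sum_degree_places_dvd[OF k, where 'a='a], of real] by simp
  have "(\<Sum>v\<in>(places_dvd k :: 'a poly set). real (degree v) * coprime_pair_count v N) -
      ?A * (?q ^ k - (\<Sum>v\<in>(places_dvd k :: 'a poly set). real (degree v) / (1 + ?q ^ degree v))) =
      (\<Sum>v\<in>(places_dvd k :: 'a poly set). real (degree v) * (coprime_pair_count v N - ?A * (1 - 1 / (1 + ?q ^ degree v))))"
    unfolding deg[symmetric] by (simp add: sum_subtractf sum_distrib_left right_diff_distrib mult_ac)
  also have "\<bar>\<dots>\<bar> \<le> (\<Sum>v\<in>(places_dvd k :: 'a poly set). \<bar>real (degree v) * (coprime_pair_count v N - ?A * (1 - 1 / (1 + ?q ^ degree v)))\<bar>)"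
    by (rule sum_abs)
  also have "\<dots> \<le> (\<Sum>v\<in>(places_dvd k :: 'a poly set). real (degree v) * 9)"
  proof (rule sum_mono)
    fix v :: "'a poly" assume "v \<in> places_dvd k"
    hence "v \<in> finite_places" by (simp add: places_dvd_def)
    from coprime_pair_count_approx[OF this refl, of N]
    show "\<bar>real (degree v) * (coprime_pair_count v N - ?A * (1 - 1 / (1 + ?q ^ degree v)))\<bar> \<le>
        real (degree v) * 9"
      unfolding abs_mult by (intro mult_mono) auto
  qed
  also have "\<dots> = 9 * ?q ^ k" by (simp flip: deg sum_distrib_right)
  finally show ?thesis .
qed

lemma character_sum_error:
  assumes n: "even n" "n \<ge> 1"
  shows "\<bar>\<Sum>v\<in>(places_dvd n - places_dvd (n div 2) :: 'a poly set). real (degree v) *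
      (sqfree_sum v (2 * g + 2) + sqfree_sum v (2 * g + 1))\<bar>
    \<le> 8 * (real n + 1) ^ 4 * (2 * real g + 3) * real CARD('a) ^ n * (real CARD('a) * real CARD('a) ^ (g + 1))"
proof -
  let ?q = "real CARD('a)" and ?s = "sqrt (real CARD('a))" and ?N = "2 * g + 2"
  have q: "?q > 1" using card_field_gt_1[where 'a='a] by simp
  have s: "?s > 1" using q by simp
  define F where "F = (\<lambda>v :: 'a poly. \<bar>sqfree_sum v (2 * g + 2)\<bar> + \<bar>sqfree_sum v (2 * g + 1)\<bar>)"
  have F0: "F v \<ge> 0" for v by (simp add: F_def)
  \<comment> \<open>Up to the factor 4, a bound for one square-free sum at the largest degrees that
    occur; the two degrees of \<open>Q\<close> then give \<open>8 * Y\<close>.\<close>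
  define Y where "Y = (2 * real g + 3) * (real n + 1)\<^sup>2 * ?q ^ n * ?s ^ (?N + 1)"
  have Y0: "Y \<ge> 0" using s q by (simp add: Y_def)
  define E where "E = {d \<in> {1..n}. even d}"
  have sub: "places_dvd n - places_dvd (n div 2) \<subseteq> (\<Union>d\<in>E. places_deg d :: 'a poly set)"
  proof
    fix v :: "'a poly" assume v: "v \<in> places_dvd n - places_dvd (n div 2)"
    hence vp: "v \<in> finite_places" and dv: "degree v dvd n" and nd: "\<not> degree v dvd n div 2"
      by (auto simp: places_dvd_def)
    have "degree v \<le> n" using dv n(2) by (intro dvd_imp_le) auto
    \<comment> \<open>An odd degree dividing \<open>n\<close> would already divide
      \<open>n div 2\<close>; so the averaged bounds for even degree apply to all places
      left.\<close>
    moreover have "even (degree v)"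
    proof (rule ccontr)
      assume "odd (degree v)"
      hence "coprime (degree v) 2" by simp
      moreover have "degree v dvd (n div 2) * 2" using dv n(1) by simp
      ultimately have "degree v dvd n div 2" by (simp only: coprime_dvd_mult_left_iff)
      thus False using nd by simp
    qed
    ultimately show "v \<in> (\<Union>d\<in>E. places_deg d)"
      using vp place_degree_pos[OF vp] by (auto simp: E_def places_deg_def Suc_le_eq)
  qed
  have "\<bar>\<Sum>v\<in>(places_dvd n - places_dvd (n div 2) :: 'a poly set). real (degree v) *
      (sqfree_sum v (2 * g + 2) + sqfree_sum v (2 * g + 1))\<bar>
      \<le> (\<Sum>v\<in>(places_dvd n - places_dvd (n div 2) :: 'a poly set). \<bar>real (degree v) * (sqfree_sum v (2 * g + 2) + sqfree_sum v (2 * g + 1))\<bar>)"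
    by (rule sum_abs)
  also have "\<dots> \<le> (\<Sum>v\<in>(places_dvd n - places_dvd (n div 2) :: 'a poly set). real (degree v) * F v)"
    unfolding abs_mult F_def by (intro sum_mono mult_mono abs_triangle_ineq) auto
  also have "\<dots> \<le> (\<Sum>v\<in>(\<Union>d\<in>E. places_deg d). real (degree v) * F v)"
    by (rule sum_mono2[OF _ sub]) (auto simp: E_def F0)
  also have "\<dots> = (\<Sum>d\<in>E. \<Sum>v\<in>(places_deg d :: 'a poly set). real (degree v) * F v)"
    by (rule sum.UNION_disjoint) (simp add: E_def, simp, auto simp: places_deg_def)
  also have "\<dots> \<le> (\<Sum>d\<in>E. real n * (8 * Y))"
  proof (rule sum_mono)
    fix d assume d: "d \<in> E"
    hence d': "even d" "d \<ge> 1" "d \<le> n" by (auto simp: E_def)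
    have bnd: "(\<Sum>v\<in>(places_deg d :: 'a poly set). \<bar>sqfree_sum v m\<bar>) \<le> 4 * Y"
      if "m \<le> ?N" for m
    proof -
      have "(\<Sum>v\<in>(places_deg d :: 'a poly set). \<bar>sqfree_sum v m\<bar>) \<le>
          (real m + 1) * (4 * (real d + 1)\<^sup>2 * ?q ^ d * ?s ^ (m + 1))"
        by (rule sum_abs_sqfree_sum[OF d'(1,2)])
      also have "\<dots> \<le> (2 * real g + 3) * (4 * (real n + 1)\<^sup>2 * ?q ^ n * ?s ^ (?N + 1))"
        using that d' q s by (intro mult_mono power_increasing power_mono) auto
      also have "\<dots> = 4 * Y" by (simp only: Y_def mult_ac)
      finally show ?thesis .
    qed
    have "(\<Sum>v\<in>(places_deg d :: 'a poly set). real (degree v) * F v) =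
        real d * (\<Sum>v\<in>(places_deg d :: 'a poly set). F v)"
      unfolding sum_distrib_left by (rule sum.cong) (auto simp: places_deg_def)
    also have "\<dots> \<le> real n * (8 * Y)"
    proof (rule mult_mono)
      show "(\<Sum>v\<in>(places_deg d :: 'a poly set). F v) \<le> 8 * Y"
        using bnd[of "2 * g + 2"] bnd[of "2 * g + 1"] unfolding F_def sum.distrib by simp
    qed (use d' in \<open>auto intro!: sum_nonneg F0\<close>)
    finally show "(\<Sum>v\<in>(places_deg d :: 'a poly set). real (degree v) * F v) \<le> real n * (8 * Y)" .
  qed
  also have "\<dots> = real (card E) * (real n * (8 * Y))" by simp
  also have "\<dots> \<le> (real n + 1) * ((real n + 1) * (8 * ((2 * real g + 3) * (real n + 1)\<^sup>2 * ?q ^ n * (?q * ?q ^ (g + 1)))))"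
  proof (intro mult_mono order_refl)
    have "card E \<le> card {1..n}" unfolding E_def by (intro card_mono) auto
    thus "real (card E) \<le> real n + 1" by simp
    have "?s ^ (?N + 1) = ?s * (?s\<^sup>2) ^ (g + 1)" by (simp only: power_mult[symmetric]) (simp add: mult_ac)
    also have "\<dots> \<le> ?q * ?q ^ (g + 1)"
    proof -
      have "?s * 1 \<le> ?s * ?s" using s by (intro mult_left_mono) auto
      thus ?thesis by (intro mult_mono) auto
    qed
    finally show "Y \<le> (2 * real g + 3) * (real n + 1)\<^sup>2 * ?q ^ n * (?q * ?q ^ (g + 1))"
      unfolding Y_def by (intro mult_left_mono) auto
  qed (use q s Y0 in auto)
  also have "\<dots> = 8 * (real n + 1) ^ 4 * (2 * real g + 3) * ?q ^ n * (?q * ?q ^ (g + 1))"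
    by (simp only: power2_eq_square power4_eq_xxxx mult_ac)
  finally show ?thesis .
qed

text \<open>For \<open>g \<ge> 1\<close> the share of degree \<open>2 * g + 2\<close> in the family
  is \<open>(q - 1) * q / ((q - 1) * (q + 1))\<close>. For \<open>g = 0\<close> this fails because
  all linear polynomials are square-free.\<close>

lemma infinite_place_term:
  "\<bar>real (card (sqfree_monics (2 * g + 2) :: 'a poly set)) / pair_count (2 * g + 2) TYPE('a) -
      real CARD('a) / (1 + real CARD('a))\<bar>
    \<le> (if g = 0 then 1 else 0)"
proof (cases "g = 0")
  case True
  let ?q = "real CARD('a)"
  have q: "?q > 1" using card_field_gt_1[where 'a='a] by simp
  have e: "2 * g + 2 = 2" using True by simp
  have "pair_count (2 * g + 2) TYPE('a) = ?q\<^sup>2" using pair_count_even[of g, where 'a='a] True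
    by (simp add: power2_eq_square)
  hence "real (card (sqfree_monics (2 * g + 2) :: 'a poly set)) / pair_count (2 * g + 2) TYPE('a) =
      1 - 1 / ?q"
    using q unfolding e by (simp add: card_sqfree_monics diff_divide_distrib power2_eq_square)
  moreover have "?q / (1 + ?q) = 1 - 1 / (1 + ?q)" using q by (simp add: field_simps)
  moreover have "0 \<le> 1 / ?q" "1 / ?q \<le> 1" "0 \<le> 1 / (1 + ?q)" "1 / (1 + ?q) \<le> 1" using q
    by (auto simp: divide_le_eq_1)
  ultimately have "\<bar>real (card (sqfree_monics (2 * g + 2) :: 'a poly set)) / pair_count (2 * g + 2) TYPE('a) -
      ?q / (1 + ?q)\<bar> \<le> 1"
    by linarith
  thus ?thesis using True by (simp only: if_True simp_thms)
next
  case False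
  let ?q = "real CARD('a)"
  have q: "?q > 1" using card_field_gt_1[where 'a='a] by simp
  define t where "t = ?q ^ (2 * g)"
  have t: "t > 0" using q by (simp add: t_def)
  have "pair_count (2 * g + 2) TYPE('a) = t * ((?q - 1) * (?q + 1))"
    unfolding pair_count_even using False by (simp add: t_def algebra_simps)
  moreover have "real (card (sqfree_monics (2 * g + 2) :: 'a poly set)) = t * ((?q - 1) * ?q)"
    by (simp add: card_sqfree_monics t_def algebra_simps)
  ultimately have "real (card (sqfree_monics (2 * g + 2) :: 'a poly set)) / pair_count (2 * g + 2) TYPE('a) =
      ?q / (1 + ?q)"
    using q t by (simp add: add.commute)
  thus ?thesis using False by simp
qed

text \<open>The constants 9 and 8 of the two error terms double on division by
  \<open>pair_count\<close>, which is at least \<open>q^(2g + 2) / 2\<close>; the remaining 1 is the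
  place at infinity for \<open>g = 0\<close>.\<close>

lemma average_trace_error:
  assumes n: "even n" "n \<ge> 1"
  shows "\<bar>(\<Sum>Q\<in>hyper_monics g. trace_sum g Q n) / pair_count (2 * g + 2) TYPE('a) -
      (real CARD('a) ^ (n div 2) - (\<Sum>v | v \<in> (finite_places :: 'a poly set) \<and> degree v dvd n div 2 \<and> degree v \<noteq> 1.
          real (degree v) / (1 + real CARD('a) ^ degree v)))\<bar>
    \<le> (19 + 16 * real CARD('a)) * ((real n + 1) ^ 4 * (2 * real g + 3)) * (real CARD('a) ^ n / real CARD('a) ^ (g + 1))"
proof -
  let ?q = "real CARD('a)" and ?N = "2 * g + 2" and ?k = "n div 2"
  let ?A = "pair_count (2 * g + 2) TYPE('a)"
  let ?w = "\<lambda>v :: 'a poly. real (degree v) / (1 + real CARD('a) ^ degree v)"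
  let ?S = "{v. v \<in> (finite_places :: 'a poly set) \<and> degree v dvd n div 2 \<and> degree v \<noteq> 1}"
  have q: "?q > 1" using card_field_gt_1[where 'a='a] by simp
  have k: "?k \<ge> 1" "n = 2 * ?k" using n by auto
  have A2: "?A \<ge> ?q ^ ?N / 2" by (rule pair_count_ge)
  have A0: "?A > 0" using A2 q by (smt (verit) zero_less_power divide_pos_pos)
  \<comment> \<open>The term \<open>q / (1 + q)\<close> separated here cancels against the place at
    infinity, which leaves \<open>E3\<close>.\<close>
  have split: "(\<Sum>v\<in>(places_dvd ?k :: 'a poly set). ?w v) = ?q / (1 + ?q) + (\<Sum>v\<in>?S. ?w v)"
  proof -
    have e: "places_dvd ?k = places_dvd 1 \<union> ?S" using k by (auto simp: places_dvd_def)
    have "finite (places_dvd ?k :: 'a poly set)" using k by simp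
    hence "finite ?S" unfolding e by simp
    moreover have "places_dvd 1 \<inter> ?S = {}" by (auto simp: places_dvd_def)
    ultimately show ?thesis unfolding e sum_degree_one_places[symmetric]
      by (intro sum.union_disjoint finite_places_dvd) auto
  qed
  define E1 where "E1 = (\<Sum>v\<in>(places_dvd ?k :: 'a poly set). real (degree v) * coprime_pair_count v ?N) -
      ?A * (?q ^ ?k - (\<Sum>v\<in>(places_dvd ?k :: 'a poly set). ?w v))"
  define E2 where "E2 = (\<Sum>v\<in>(places_dvd n - places_dvd ?k :: 'a poly set). real (degree v) * (sqfree_sum v ?N + sqfree_sum v (2 * g + 1)))"
  define E3 where "E3 = real (card (sqfree_monics ?N :: 'a poly set)) / ?A - ?q / (1 + ?q)"
  have "(\<Sum>Q\<in>hyper_monics g. trace_sum g Q n) =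
      E1 + ?A * (?q ^ ?k - (\<Sum>v\<in>(places_dvd ?k :: 'a poly set). ?w v)) + E2 + real (card (sqfree_monics ?N :: 'a poly set))"
    unfolding sum_trace_even[OF n] E1_def E2_def by simp
  hence "(\<Sum>Q\<in>hyper_monics g. trace_sum g Q n) / ?A - (?q ^ ?k - (\<Sum>v\<in>?S. ?w v)) = E1 / ?A + E2 / ?A + E3"
    unfolding split E3_def using A0 by (simp add: add_divide_distrib)
  also have "\<bar>\<dots>\<bar> \<le> \<bar>E1 / ?A\<bar> + \<bar>E2 / ?A\<bar> + \<bar>E3\<bar>" by linarith
  also have "\<dots> \<le> (18 + 16 * ?q + 1) * ((real n + 1) ^ 4 * (2 * real g + 3)) * (?q ^ n / ?q ^ (g + 1))"
  proof -
    let ?P = "(real n + 1) ^ 4 * (2 * real g + 3)" and ?R = "?q ^ n / ?q ^ (g + 1)"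
    have P1: "1 \<le> ?P"
    proof -
      have "1 * 1 \<le> ?P" by (intro mult_mono one_le_power) auto
      thus ?thesis by simp
    qed
    have R0: "?R > 0" using q by simp
    have div: "\<bar>x\<bar> / ?A \<le> 2 * y / ?q ^ ?N" if "\<bar>x\<bar> \<le> y" for x y
    proof -
      have "\<bar>x\<bar> / ?A \<le> y / (?q ^ ?N / 2)"
        using that A2 A0 q by (intro frac_le) auto
      thus ?thesis by (simp add: mult.commute)
    qed
    have NN: "?q ^ ?N = ?q ^ (g + 1) * ?q ^ (g + 1)" by (simp flip: power_add) (simp add: mult_2)
    have "\<bar>E1\<bar> \<le> 9 * ?q ^ ?k" unfolding E1_def by (rule coprime_main_term[OF k(1)])
    from div[OF this] have "\<bar>E1 / ?A\<bar> \<le> 2 * (9 * ?q ^ ?k) / ?q ^ ?N" using A0 by simp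
    also have "\<dots> \<le> 18 * (1 * ?R)"
    proof -
      have "?q ^ ?k / ?q ^ ?N \<le> ?q ^ n / ?q ^ (g + 1)"
        using q k by (intro frac_le power_increasing) auto
      thus ?thesis by simp
    qed
    also have "\<dots> \<le> 18 * (?P * ?R)" using P1 R0 by (intro mult_left_mono mult_right_mono) auto
    finally have 1: "\<bar>E1 / ?A\<bar> \<le> 18 * (?P * ?R)" .
    have "\<bar>E2\<bar> \<le> 8 * (real n + 1) ^ 4 * (2 * real g + 3) * ?q ^ n * (?q * ?q ^ (g + 1))"
      unfolding E2_def by (rule character_sum_error[OF n])
    from div[OF this] have "\<bar>E2 / ?A\<bar> \<le>
        2 * (8 * (real n + 1) ^ 4 * (2 * real g + 3) * ?q ^ n * (?q * ?q ^ (g + 1))) / ?q ^ ?N"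
      using A0 by simp
    also have "\<dots> = 16 * ?q * (?P * ?R)" unfolding NN using q by simp
    finally have 2: "\<bar>E2 / ?A\<bar> \<le> 16 * ?q * (?P * ?R)" .
    have 3: "\<bar>E3\<bar> \<le> 1 * (?P * ?R)"
    proof (cases "g = 0")
      case True
      \<comment> \<open>In genus 0 the quotient \<open>q^n / q^(g + 1)\<close> is still at least 1,
        as \<open>n \<ge> 1\<close>, so the general bound covers the exceptional term.\<close>
      have "?q ^ 1 \<le> ?q ^ n" using q n by (intro power_increasing) auto
      hence "1 \<le> ?R" using q True by simp
      hence "1 * 1 \<le> ?P * ?R" using P1 by (intro mult_mono) auto
      moreover have "\<bar>E3\<bar> \<le> 1" using infinite_place_term[of g] True unfolding E3_def
        by (simp only: if_True simp_thms)
      ultimately show ?thesis by linarith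
    next
      case False
      hence "E3 = 0" using infinite_place_term[of g] unfolding E3_def by simp
      thus ?thesis using P1 R0 by simp
    qed
    have "\<bar>E1 / ?A\<bar> + \<bar>E2 / ?A\<bar> + \<bar>E3\<bar> \<le> 18 * (?P * ?R) + 16 * ?q * (?P * ?R) + 1 * (?P * ?R)"
      by (intro add_mono 1 2 3)
    also have "\<dots> = (18 + 16 * ?q + 1) * ?P * ?R" by (simp only: distrib_right mult.assoc)
    finally show ?thesis .
  qed
  finally show ?thesis by (simp add: add_ac)
qed

end

theorem theorem2p3:
  fixes \<epsilon> :: real
  assumes "odd CARD('a::{field,finite})" and "\<epsilon> > 0"
  shows "\<exists>K. \<forall>g n. n \<ge> 1 \<longrightarrow>
    norm (average (quad_exts g :: 'a ratfun alg_closure set set)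
            (\<lambda>L. - complex_of_real (real CARD('a) powr (real n / 2)) * tr_Theta g L n)
          - complex_of_real
              (eta n * real CARD('a) powr (real n / 2)
               - eta n * (\<Sum>v | v \<in> (finite_places :: 'a poly set) \<and>
                               degree v dvd n div 2 \<and> degree v \<noteq> 1.
                            real (degree v) / (1 + real CARD('a) ^ degree v))))
      \<le> K * real CARD('a) powr ((\<epsilon> - 1) * (real g + 1) + real n * (1 + \<epsilon>))"
proof -
  interpret odd_field "TYPE('a)" by unfold_locales (rule assms(1))
  let ?q = "real CARD('a)"
  have q: "?q > 1" using card_field_gt_1[where 'a='a] by simp
  obtain K where K: "K \<ge> 0" "\<And>x::nat. (real x + 1) ^ 5 \<le> K * ?q powr (\<epsilon> * real x)"
    using polynomial_le_exponential[OF q assms(2)] by blast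
  let ?C = "(19 + 16 * ?q) * 2"
  show ?thesis
  proof (intro exI allI impI)
    fix g n :: nat assume n: "n \<ge> 1"
    let ?B = "?C * K * ?q powr ((\<epsilon> - 1) * (real g + 1) + real n * (1 + \<epsilon>))"
    let ?T = "\<Sum>v | v \<in> (finite_places :: 'a poly set) \<and> degree v dvd n div 2 \<and> degree v \<noteq> 1.
                            real (degree v) / (1 + ?q ^ degree v)"
    let ?avg = "(\<Sum>Q\<in>hyper_polys g. trace_sum g Q n) / real (card (hyper_polys g))"
    have "\<bar>?avg - (eta n * ?q powr (real n / 2) - eta n * ?T)\<bar> \<le> ?B"
    proof (cases "even n")
      case False
      thus ?thesis using K(1) q by (simp add: sum_trace_odd eta_def)
    next
      case True
      have half: "?q powr (real n / 2) = ?q ^ (n div 2)"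
        using True q by (auto elim!: evenE simp: powr_realpow)
      have "\<bar>?avg - (eta n * ?q powr (real n / 2) - eta n * ?T)\<bar>
          \<le> (19 + 16 * ?q) * ((real n + 1) ^ 4 * (2 * real g + 3)) * (?q ^ n / ?q ^ (g + 1))"
        using average_trace_error[OF True n, of g] True
        by (simp only: average_trace_even[OF True n] half eta_def if_True mult_1_left)
      also have "\<dots> \<le> (19 + 16 * ?q) * (2 * (K * ?q powr (\<epsilon> * real (n + g + 1)))) * (?q ^ n / ?q ^ (g + 1))"
      proof (intro mult_right_mono mult_left_mono)
        \<comment> \<open>One exponential serves both variables: taken at \<open>n + g + 1\<close>,
          it adds \<epsilon> times \<open>n\<close> and \<epsilon> times \<open>g + 1\<close> to the
          exponent, as the claim requires.\<close>
        have "(real n + 1) ^ 4 * (2 * real g + 3) \<le> (real (n + g + 1) + 1) ^ 4 * (2 * (real (n + g + 1) + 1))"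
          by (intro mult_mono power_mono) auto
        also have "\<dots> = 2 * (real (n + g + 1) + 1) ^ 5" by (simp add: eval_nat_numeral)
        also have "\<dots> \<le> 2 * (K * ?q powr (\<epsilon> * real (n + g + 1)))" by (intro mult_left_mono K(2)) simp
        finally show "(real n + 1) ^ 4 * (2 * real g + 3) \<le> 2 * (K * ?q powr (\<epsilon> * real (n + g + 1)))" .
      qed (use q in auto)
      also have "\<dots> = ?B"
      proof -
        have "?q ^ n / ?q ^ (g + 1) = ?q powr (real n - real (g + 1))"
          using q by (simp only: powr_diff powr_realpow)
        hence "?q powr (\<epsilon> * real (n + g + 1)) * (?q ^ n / ?q ^ (g + 1)) =
            ?q powr (\<epsilon> * real (n + g + 1) + (real n - real (g + 1)))"
          by (simp only: powr_add)
        also have "\<epsilon> * real (n + g + 1) + (real n - real (g + 1)) = (\<epsilon> - 1) * (real g + 1) + real n * (1 + \<epsilon>)"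
          by (simp add: algebra_simps)
        finally show ?thesis by (simp only: mult.assoc)
      qed
      finally show ?thesis .
    qed
    thus "norm (average (quad_exts g :: 'a ratfun alg_closure set set)
            (\<lambda>L. - complex_of_real (real CARD('a) powr (real n / 2)) * tr_Theta g L n)
          - complex_of_real (eta n * ?q powr (real n / 2) - eta n * ?T)) \<le> ?B"
      unfolding average_quad_exts_trace[OF n] of_real_diff[symmetric] norm_of_real .
  qed
qed

end
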